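(* Let $n\ge 3$ and let $\Omega$ be an open and bounded subset (not necessarily connected) of $\mathbb{R}^n$. Let $f\in C^{n+1}(\mathbb{R}^n\setminus\overline{\Omega})\cap C^0(\mathbb{R}^n\setminus\Omega)$ be asymptotically flat and let the graph of $f$ be $C^{n+1}$ up to boundary. Suppose each connected component of $\partial\Omega$ is a level set of $f$ with $|Df(x)|\to\infty$ as $x\to\partial\Omega$. If the scalar curvature of the graph of $f$ is non-negative, then its mean curvature $H$ has a sign, i.e., either $H\ge 0$ everywhere or $H\le 0$ everywhere.
   Context: Notation: $Df=(f_1,\dots,f_n)$ and $D^2f=(f_{ij})$ denote the first and second partial derivatives. The graph of $f$ is a hypersurface in $\mathbb{R}^{n+1}$ with the induced metric $g_{ij}=\delta_{ij}+f_if_j$. Its mean curvature $H$ is computed with respect to the upward unit normal: \[ H=\sum_{i,j}\left(\delta_{ij}-\frac{f_if_j}{1+|Df|^2}\right)\frac{f_{ij}}{\sqrt{1+|Df|^2}} \] (extended continuously to the boundary of the graph). Level set: "each connected component of $\partial\Omega$ is a level set of $f$" means that $f$ is constant on each connected component of $\partial\Omega$ (possibly with different constants). Asymptotically flat: $f$ is asymptotically flat if its graph is a $C^2$ hypersurface up to boundary and (1) either $\lim_{|x|\to\infty}f(x)=C$ for some bounded constant $C$, or $\lim_{|x|\to\infty}f(x)=\infty$, or $\lim_{|x|\to\infty}f(x)=-\infty$; (2) $|Df(x)|=O(|x|^{-q/2})$ and $|D^2f(x)|=O(|x|^{-q/2-1})$ for some $q>\frac{n-2}{2}$; (3) the scalar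 curvature of the graph of $f$ is integrable over the graph of $f$.
   Formalization: The graph of f (equivalently ℝⁿ∖Ω) is additionally assumed connected; without this the claim fails, e.g. n=3, Ω={1<|x|<2}, a lower hemisphere over |x|≤1 (H>0) and f=−√(8(|x|−2)) over |x|≥2 (H<0). *)

theory Defs
  imports "HOL-Analysis.Analysis" "HOL-Library.Landau_Symbols"
begin

section \<open>Functions and hypersurfaces of class \<open>C\<^sup>k\<close>\<close>

text \<open>Meant for open \<open>S\<close>, where it is the usual notion: all iterated partial derivatives
  up to order \<open>k\<close> exist and are continuous.\<close>

primrec Ck_on :: "nat \<Rightarrow> 'a::euclidean_space set \<Rightarrow> ('a \<Rightarrow> 'b::real_normed_vector) \<Rightarrow> bool" where
  "Ck_on 0 S f \<longleftrightarrow> continuous_on S f"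
| "Ck_on (Suc k) S f \<longleftrightarrow>
     (\<forall>x\<in>S. f differentiable (at x)) \<and>
     (\<forall>b\<in>Basis. Ck_on k S (\<lambda>x. frechet_derivative f (at x) b))"

definition Ck_diffeomorphism ::
  "nat \<Rightarrow> 'a::euclidean_space set \<Rightarrow> 'a set \<Rightarrow> ('a \<Rightarrow> 'a) \<Rightarrow> ('a \<Rightarrow> 'a) \<Rightarrow> bool" where
  "Ck_diffeomorphism k U V \<Phi> \<Psi> \<longleftrightarrow>
     open U \<and> open V \<and> homeomorphism U V \<Phi> \<Psi> \<and> Ck_on k U \<Phi> \<and> Ck_on k V \<Psi>"

text \<open>\<open>M\<close> is an embedded \<open>C\<^sup>k\<close> hypersurface up to boundary, with boundary \<open>B \<subseteq> M\<close>: near each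
  point, an ambient diffeomorphism straightens \<open>M\<close> to a piece of the coordinate hyperplane
  \<open>y \<bullet> e = 0\<close> (points off \<open>B\<close>), or of its half \<open>y \<bullet> d \<ge> 0\<close> with \<open>B\<close> going to the edge
  \<open>y \<bullet> d = 0\<close> (points of \<open>B\<close>).\<close>

definition Ck_hypersurface_with_boundary ::
  "nat \<Rightarrow> 'a::euclidean_space set \<Rightarrow> 'a set \<Rightarrow> bool" where
  "Ck_hypersurface_with_boundary k M B \<longleftrightarrow>
     B \<subseteq> M \<and>
     (\<forall>p\<in>M - B. \<exists>U V \<Phi> \<Psi>. \<exists>e\<in>Basis.
        p \<in> U \<and> U \<inter> B = {} \<and> Ck_diffeomorphism k U V \<Phi> \<Psi> \<and>
        \<Phi> ` (M \<inter> U) = V \<inter> {y. y \<bullet> e = 0}) \<and>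
     (\<forall>p\<in>B. \<exists>U V \<Phi> \<Psi>. \<exists>e\<in>Basis. \<exists>d\<in>Basis - {e}.
        p \<in> U \<and> Ck_diffeomorphism k U V \<Phi> \<Psi> \<and>
        \<Phi> ` (M \<inter> U) = V \<inter> {y. y \<bullet> e = 0 \<and> y \<bullet> d \<ge> 0} \<and>
        \<Phi> ` (B \<inter> U) = V \<inter> {y. y \<bullet> e = 0 \<and> y \<bullet> d = 0})"

definition graph_over :: "'a set \<Rightarrow> ('a \<Rightarrow> 'b) \<Rightarrow> ('a \<times> 'b) set" where
  "graph_over S f = (\<lambda>x. (x, f x)) ` S"


section \<open>Geometry of a graph\<close>

definition pd :: "'n::finite \<Rightarrow> (real^'n \<Rightarrow> real) \<Rightarrow> real^'n \<Rightarrow> real" where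
  "pd i f x = frechet_derivative f (at x) (axis i 1)"

definition grad :: "(real^'n::finite \<Rightarrow> real) \<Rightarrow> real^'n \<Rightarrow> real^'n" where
  "grad f x = (\<chi> i. pd i f x)"

definition hess :: "(real^'n::finite \<Rightarrow> real) \<Rightarrow> real^'n \<Rightarrow> real^'n^'n" where
  "hess f x = (\<chi> i j. pd j (pd i f) x)"

text \<open>Curvature of a Riemannian metric \<open>g\<close> given by its matrix in the standard coordinates; the
  sign convention is the one for which round spheres have positive scalar curvature.\<close>

definition christoffel ::
  "(real^'n::finite \<Rightarrow> real^'n^'n) \<Rightarrow> 'n \<Rightarrow> 'n \<Rightarrow> 'n \<Rightarrow> real^'n \<Rightarrow> real" where
  "christoffel g k i j x =
     (\<Sum>l\<in>UNIV. matrix_inv (g x) $ k $ l *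
        (pd i (\<lambda>y. g y $ j $ l) x + pd j (\<lambda>y. g y $ i $ l) x - pd l (\<lambda>y. g y $ i $ j) x)) / 2"

definition ricci_curvature ::
  "(real^'n::finite \<Rightarrow> real^'n^'n) \<Rightarrow> 'n \<Rightarrow> 'n \<Rightarrow> real^'n \<Rightarrow> real" where
  "ricci_curvature g i j x =
     (\<Sum>k\<in>UNIV. pd k (christoffel g k i j) x - pd j (christoffel g k i k) x
       + (\<Sum>l\<in>UNIV. christoffel g k k l x * christoffel g l i j x
                   - christoffel g k j l x * christoffel g l i k x))"

definition scalar_curvature :: "(real^'n::finite \<Rightarrow> real^'n^'n) \<Rightarrow> real^'n \<Rightarrow> real" where
  "scalar_curvature g x =
     (\<Sum>i\<in>UNIV. \<Sum>j\<in>UNIV. matrix_inv (g x) $ i $ j * ricci_curvature g i j x)"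

definition graph_metric :: "(real^'n::finite \<Rightarrow> real) \<Rightarrow> real^'n \<Rightarrow> real^'n^'n" where
  "graph_metric f x = (\<chi> i j. (if i = j then 1 else 0) + pd i f x * pd j f x)"

definition graph_scalar_curvature :: "(real^'n::finite \<Rightarrow> real) \<Rightarrow> real^'n \<Rightarrow> real" where
  "graph_scalar_curvature f = scalar_curvature (graph_metric f)"

definition graph_mean_curvature :: "(real^'n::finite \<Rightarrow> real) \<Rightarrow> real^'n \<Rightarrow> real" where
  "graph_mean_curvature f x =
     (\<Sum>i\<in>UNIV. \<Sum>j\<in>UNIV.
        ((if i = j then 1 else 0) - pd i f x * pd j f x / (1 + (norm (grad f x))\<^sup>2)) *
        (hess f x $ i $ j / sqrt (1 + (norm (grad f x))\<^sup>2)))"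

text \<open>The mean curvature of the graph over the complement of \<open>\<Omega>\<close> at the point above \<open>x\<close>.
  Where the graph is vertical, i.e. over the boundary of \<open>\<Omega>\<close>, it is the continuous extension.\<close>

definition mean_curvature_upto_boundary ::
  "(real^'n::finite) set \<Rightarrow> (real^'n \<Rightarrow> real) \<Rightarrow> real^'n \<Rightarrow> real" where
  "mean_curvature_upto_boundary \<Omega> f x =
     (if x \<in> frontier \<Omega>
      then Lim (at x within - closure \<Omega>) (graph_mean_curvature f)
      else graph_mean_curvature f x)"

text \<open>In the last clause, \<open>sqrt (det g)\<close> is the Riemannian volume density; the boundary of the
  graph is a null set for the volume measure.\<close>

definition asymptotically_flat :: "(real^'n::finite) set \<Rightarrow> (real^'n \<Rightarrow> real) \<Rightarrow> bool" where
  "asymptotically_flat \<Omega> f \<longleftrightarrow>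
     Ck_hypersurface_with_boundary 2 (graph_over (- \<Omega>) f) (graph_over (frontier \<Omega>) f) \<and>
     ((\<exists>C. (f \<longlongrightarrow> C) at_infinity) \<or>
      filterlim f at_top at_infinity \<or> filterlim f at_bot at_infinity) \<and>
     (\<exists>q > (real CARD('n) - 2) / 2.
        (\<lambda>x. norm (grad f x)) \<in> O[at_infinity](\<lambda>x. norm x powr (- q / 2)) \<and>
        (\<lambda>x. norm (hess f x)) \<in> O[at_infinity](\<lambda>x. norm x powr (- q / 2 - 1))) \<and>
     set_integrable lborel (- closure \<Omega>)
       (\<lambda>x. graph_scalar_curvature f x * sqrt (det (graph_metric f x)))"

end

theory Submission
  imports Defs
begin

text \<open>By the Gauss equation \<open>R = H\<^sup>2 - |A|\<^sup>2\<close>, so \<open>R \<ge> 0\<close> forces \<open>D\<^sup>2f = 0\<close> wherever \<open>H = 0\<close>. By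
  Morse--Sard applied to the partial derivatives, \<open>Df\<close> is constant on every connected subset of
  \<open>{H = 0}\<close>, and such a set cannot reach the boundary, where \<open>Df\<close> is infinite.

  Suppose that \<open>H\<close> takes both signs and let \<open>P\<close> be a component of \<open>{H > 0}\<close>. The frontier of a
  complementary component of \<open>P\<close> is connected, so it lies in the boundary or \<open>f\<close> agrees there to
  first order with an affine function. Filling in these affine functions yields a subsolution of an
  elliptic equation. If \<open>P\<close> is bounded, or if it has an unbounded complementary component, whose
  affine function is then constant by the decay of \<open>Df\<close>, the difference of \<open>f\<close> and the affine
  function of the unbounded components attains its maximum over the closure of \<open>P\<close>. The
  strong maximum principle (Hopf) excludes a maximum in the interior. At a
  boundary component one looks at the point farthest from the origin of a superlevel set of \<open>f\<close>:
  there the level set of \<open>f\<close> would have to bend the wrong way, because \<open>R \<ge> 0\<close> and \<open>H \<ge> 0\<close> make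
  its mean curvature nonnegative. Hence \<open>P\<close> is unbounded and the complementary
  components of \<open>P\<close> meeting the exterior are bounded. One of these contains a component of
  \<open>{H < 0}\<close>, which is unbounded by the same argument applied to \<open>- f\<close>: a contradiction.\<close>

section \<open>Calculus of \<open>C\<^sup>k\<close> functions\<close>

lemma frechet_derivative_eq:
  "(f has_derivative f') (at x) \<Longrightarrow> frechet_derivative f (at x) b = f' b"
  by (metis frechet_derivative_at)

lemma Ck_on_subset: "Ck_on k S f \<Longrightarrow> T \<subseteq> S \<Longrightarrow> Ck_on k T f"
  by (induction k arbitrary: f) (auto intro: continuous_on_subset)

lemma Ck_on_cong:
  assumes "open S" "\<And>x. x \<in> S \<Longrightarrow> f x = g x" "Ck_on k S f"
  shows "Ck_on k S g"
  using assms(2,3)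
proof (induction k arbitrary: f g)
  case 0
  then show ?case using continuous_on_cong[of S S f g] by auto
next
  case (Suc k)
  have d: "(g has_derivative frechet_derivative f (at x)) (at x)" if "x \<in> S" for x
  proof (rule has_derivative_transform_within_open[OF _ \<open>open S\<close> that])
    show "(f has_derivative frechet_derivative f (at x)) (at x)"
      using Suc.prems(2) that by (simp add: frechet_derivative_works)
  qed (rule Suc.prems(1))
  have "Ck_on k S (\<lambda>x. frechet_derivative g (at x) b)" if "b \<in> Basis" for b
  proof (rule Suc.IH)
    show "Ck_on k S (\<lambda>x. frechet_derivative f (at x) b)" using Suc.prems(2) that by simp
    show "frechet_derivative f (at x) b = frechet_derivative g (at x) b" if "x \<in> S" for x
      by (rule frechet_derivative_eq[OF d[OF that], symmetric])
  qed
  moreover have "\<forall>x\<in>S. g differentiable at x" using d by (blast intro: differentiableI)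
  ultimately show ?case by simp
qed

lemma Ck_on_SucI:
  assumes "open S" "\<And>x. x \<in> S \<Longrightarrow> (f has_derivative f' x) (at x)"
    "\<And>b. b \<in> Basis \<Longrightarrow> Ck_on k S (\<lambda>x. f' x b)"
  shows "Ck_on (Suc k) S f"
proof -
  have "Ck_on k S (\<lambda>x. frechet_derivative f (at x) b)" if "b \<in> Basis" for b
    by (rule Ck_on_cong[OF assms(1) _ assms(3)[OF that]])
      (rule frechet_derivative_eq[OF assms(2), symmetric])
  moreover have "\<forall>x\<in>S. f differentiable at x" using assms(2) by (blast intro: differentiableI)
  ultimately show ?thesis by simp
qed

lemma Ck_on_has_derivative:
  "Ck_on (Suc k) S f \<Longrightarrow> x \<in> S \<Longrightarrow> (f has_derivative frechet_derivative f (at x)) (at x)"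
  by (simp add: frechet_derivative_works)

lemma Ck_on_partial:
  "Ck_on (Suc k) S f \<Longrightarrow> b \<in> Basis \<Longrightarrow> Ck_on k S (\<lambda>x. frechet_derivative f (at x) b)"
  by simp

lemma Ck_on_continuous: "Ck_on k S f \<Longrightarrow> continuous_on S f"
  by (cases k) (auto intro!: continuous_at_imp_continuous_on differentiable_imp_continuous_within simp del: Ck_on.simps(2) simp: Ck_on.simps(2))

lemma Ck_on_SucD: "Ck_on (Suc k) S f \<Longrightarrow> Ck_on k S f"
proof (induction k arbitrary: f)
  case 0
  then show ?case using Ck_on_continuous[OF 0] by simp
next
  case (Suc k)
  then show ?case
    by (subst Ck_on.simps) (use Suc in simp)
qed

lemma Ck_on_le: "Ck_on k S f \<Longrightarrow> j \<le> k \<Longrightarrow> Ck_on j S f"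
  by (induction k) (auto simp: le_Suc_eq dest: Ck_on_SucD simp del: Ck_on.simps)

lemma Ck_on_const: "Ck_on k S (\<lambda>x. c)"
  by (induction k arbitrary: c) auto

lemma Ck_on_linear:
  assumes "bounded_linear L" shows "Ck_on k S L"
proof (cases k)
  case 0
  then show ?thesis using assms by (simp add: linear_continuous_on)
next
  case (Suc j)
  have d: "(L has_derivative L) (at x)" for x
    using assms by (rule bounded_linear_imp_has_derivative)
  then show ?thesis using Suc
    by (auto simp: Ck_on_const frechet_derivative_eq[OF d] intro: differentiableI)
qed

lemma Ck_on_bounded_linear:
  assumes L: "bounded_linear L" and "open S" "Ck_on k S f"
  shows "Ck_on k S (\<lambda>x. L (f x))"
  using assms(3)
proof (induction k arbitrary: f)
  case 0
  then show ?case
    using L by (simp add: bounded_linear.continuous_on)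
next
  case (Suc k)
  show ?case
  proof (rule Ck_on_SucI[OF \<open>open S\<close>])
    show "((\<lambda>x. L (f x)) has_derivative (\<lambda>v. L (frechet_derivative f (at x) v))) (at x)"
      if "x \<in> S" for x
      using bounded_linear.has_derivative[OF L Ck_on_has_derivative[OF Suc.prems that]] .
    show "Ck_on k S (\<lambda>x. L (frechet_derivative f (at x) b))" if "b \<in> Basis" for b
      by (intro Suc.IH Ck_on_partial[OF _ that] Suc.prems)
  qed
qed

lemma Ck_on_add:
  assumes "open S" "Ck_on k S f" "Ck_on k S g"
  shows "Ck_on k S (\<lambda>x. f x + g x)"
  using assms(2,3)
proof (induction k arbitrary: f g)
  case 0
  then show ?case by (simp add: continuous_on_add)
next
  case (Suc k)
  show ?case
  proof (rule Ck_on_SucI[OF \<open>open S\<close>])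
    show "((\<lambda>x. f x + g x) has_derivative
        (\<lambda>v. frechet_derivative f (at x) v + frechet_derivative g (at x) v)) (at x)"
      if "x \<in> S" for x
      using Suc.prems that by (intro has_derivative_add Ck_on_has_derivative)
    show "Ck_on k S (\<lambda>x. frechet_derivative f (at x) b + frechet_derivative g (at x) b)"
      if "b \<in> Basis" for b
      by (intro Suc.IH Ck_on_partial[OF _ that] Suc.prems)
  qed
qed

lemma Ck_on_sum:
  assumes "open S" "\<And>i. i \<in> I \<Longrightarrow> Ck_on k S (f i)"
  shows "Ck_on k S (\<lambda>x. \<Sum>i\<in>I. f i x)"
  using assms(2)
proof (induction I rule: infinite_finite_induct)
  case (insert i I)
  then show ?case by (simp add: Ck_on_add[OF \<open>open S\<close>])
qed (auto simp: Ck_on_const)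

lemma Ck_on_scaleR:
  fixes f :: "'a::euclidean_space \<Rightarrow> real"
  assumes "open S" "Ck_on k S f" "Ck_on k S g"
  shows "Ck_on k S (\<lambda>x. f x *\<^sub>R g x)"
  using assms(2,3)
proof (induction k arbitrary: f g)
  case 0
  then show ?case by (simp add: continuous_on_scaleR)
next
  case (Suc k)
  have fg: "Ck_on k S f" "Ck_on k S g" using Suc.prems by (blast intro: Ck_on_SucD)+
  show ?case
  proof (rule Ck_on_SucI[OF \<open>open S\<close>])
    show "((\<lambda>x. f x *\<^sub>R g x) has_derivative
        (\<lambda>v. f x *\<^sub>R frechet_derivative g (at x) v + frechet_derivative f (at x) v *\<^sub>R g x)) (at x)"
      if "x \<in> S" for x
      using Suc.prems that by (intro has_derivative_scaleR Ck_on_has_derivative)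
    show "Ck_on k S (\<lambda>x. f x *\<^sub>R frechet_derivative g (at x) b + frechet_derivative f (at x) b *\<^sub>R g x)"
      if "b \<in> Basis" for b
      using fg Ck_on_partial[OF Suc.prems(1) that] Ck_on_partial[OF Suc.prems(2) that]
      by (intro Ck_on_add[OF \<open>open S\<close>] Suc.IH)
  qed
qed

lemma Ck_on_mult:
  fixes f g :: "'a::euclidean_space \<Rightarrow> real"
  assumes "open S" "Ck_on k S f" "Ck_on k S g"
  shows "Ck_on k S (\<lambda>x. f x * g x)"
  using Ck_on_scaleR[OF assms] by simp

lemma Ck_on_minus:
  assumes "open S" "Ck_on k S f"
  shows "Ck_on k S (\<lambda>x. - f x)"
  using Ck_on_bounded_linear[OF bounded_linear_minus[OF bounded_linear_ident] assms] .

lemma Ck_on_diff: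
  assumes "open S" "Ck_on k S f" "Ck_on k S g"
  shows "Ck_on k S (\<lambda>x. f x - g x)"
  using Ck_on_add[OF assms(1,2) Ck_on_minus[OF assms(1,3)]] by simp

lemma Ck_on_inverse:
  fixes f :: "'a::euclidean_space \<Rightarrow> real"
  assumes "open S" "Ck_on k S f" "\<And>x. x \<in> S \<Longrightarrow> f x \<noteq> 0"
  shows "Ck_on k S (\<lambda>x. inverse (f x))"
  using assms(2)
proof (induction k)
  case 0
  then show ?case using assms by (simp add: continuous_on_inverse)
next
  case (Suc k)
  have IH: "Ck_on k S (\<lambda>x. inverse (f x))" by (rule Suc.IH[OF Ck_on_SucD[OF Suc.prems]])
  show ?case
  proof (rule Ck_on_SucI[OF \<open>open S\<close>])
    show "((\<lambda>x. inverse (f x)) has_derivative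
        (\<lambda>v. - (inverse (f x) * frechet_derivative f (at x) v * inverse (f x)))) (at x)"
      if "x \<in> S" for x
      by (rule Deriv.has_derivative_inverse[OF assms(3)[OF that] Ck_on_has_derivative[OF Suc.prems that]])
    show "Ck_on k S (\<lambda>x. - (inverse (f x) * frechet_derivative f (at x) b * inverse (f x)))"
      if "b \<in> Basis" for b
      by (intro Ck_on_minus Ck_on_mult \<open>open S\<close> IH Ck_on_partial[OF Suc.prems that])
  qed
qed

lemma linear_Basis_expansion:
  fixes L :: "'a::euclidean_space \<Rightarrow> 'b::real_normed_vector"
  assumes "linear L"
  shows "L v = (\<Sum>c\<in>Basis. (v \<bullet> c) *\<^sub>R L c)"
proof -
  have "L v = L (\<Sum>c\<in>Basis. (v \<bullet> c) *\<^sub>R c)" by (simp add: euclidean_representation)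
  then show ?thesis using assms by (simp add: linear_sum linear_scale)
qed

lemma Ck_on_compose:
  fixes h :: "'b::euclidean_space \<Rightarrow> 'c::real_normed_vector"
  assumes "open V" "Ck_on k U h" "Ck_on k V \<psi>" "\<psi> ` V \<subseteq> U"
  shows "Ck_on k V (\<lambda>y. h (\<psi> y))"
  using assms(2,3)
proof (induction k arbitrary: h)
  case 0
  then show ?case using assms by (auto intro: continuous_on_compose2)
next
  case (Suc k)
  have psi: "Ck_on k V \<psi>" using Suc.prems by (blast intro: Ck_on_SucD)+
  show ?case
  proof (rule Ck_on_SucI[OF \<open>open V\<close>])
    fix y assume y: "y \<in> V"
    then have hd: "(h has_derivative frechet_derivative h (at (\<psi> y))) (at (\<psi> y))"
      using Suc.prems assms(4) by (intro Ck_on_has_derivative) auto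
    have eq: "(\<lambda>v. frechet_derivative h (at (\<psi> y)) (frechet_derivative \<psi> (at y) v)) =
        (\<lambda>v. \<Sum>c\<in>Basis. (frechet_derivative \<psi> (at y) v \<bullet> c) *\<^sub>R frechet_derivative h (at (\<psi> y)) c)"
      by (rule ext, rule linear_Basis_expansion[OF has_derivative_linear[OF hd]])
    have "((\<lambda>y. h (\<psi> y)) has_derivative
        (\<lambda>v. frechet_derivative h (at (\<psi> y)) (frechet_derivative \<psi> (at y) v))) (at y)"
      using has_derivative_compose[OF Ck_on_has_derivative[OF Suc.prems(2) y] hd] .
    then show "((\<lambda>y. h (\<psi> y)) has_derivative
        (\<lambda>v. \<Sum>c\<in>Basis. (frechet_derivative \<psi> (at y) v \<bullet> c) *\<^sub>R frechet_derivative h (at (\<psi> y)) c)) (at y)"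
      by (simp only: eq)
  next
    fix b :: 'a assume b: "b \<in> Basis"
    show "Ck_on k V (\<lambda>y. \<Sum>c\<in>Basis. (frechet_derivative \<psi> (at y) b \<bullet> c) *\<^sub>R frechet_derivative h (at (\<psi> y)) c)"
    proof (intro Ck_on_sum Ck_on_scaleR \<open>open V\<close>)
      fix c :: 'b assume c: "c \<in> Basis"
      show "Ck_on k V (\<lambda>y. frechet_derivative \<psi> (at y) b \<bullet> c)"
        by (rule Ck_on_bounded_linear[OF bounded_linear_inner_left \<open>open V\<close> Ck_on_partial[OF Suc.prems(2) b]])
      show "Ck_on k V (\<lambda>y. frechet_derivative h (at (\<psi> y)) c)"
        by (rule Suc.IH[OF Ck_on_partial[OF Suc.prems(1) c] psi])
    qed
  qed
qed

lemma Ck_on_continuous_derivative: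
  assumes "Ck_on (Suc k) S f"
  shows "continuous_on S (\<lambda>x. frechet_derivative f (at x) v)"
proof -
  have "linear (frechet_derivative f (at x))" if "x \<in> S" for x
    using assms that by (simp add: linear_frechet_derivative)
  then have "\<And>x. x \<in> S \<Longrightarrow> frechet_derivative f (at x) v = (\<Sum>c\<in>Basis. (v \<bullet> c) *\<^sub>R frechet_derivative f (at x) c)"
    using linear_Basis_expansion by blast
  moreover have "continuous_on S (\<lambda>x. \<Sum>c\<in>Basis. (v \<bullet> c) *\<^sub>R frechet_derivative f (at x) c)"
    using assms by (intro continuous_intros) (auto intro: Ck_on_continuous)
  ultimately show ?thesis using continuous_on_cong by fastforce
qed

lemma Ck_on_derivative_bounded:
  assumes "Ck_on (Suc k) S f" "compact K" "K \<subseteq> S"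
  obtains B where "B > 0" "\<And>x v. x \<in> K \<Longrightarrow> norm (frechet_derivative f (at x) v) \<le> B * norm v"
proof -
  have "\<exists>B>0. \<forall>x\<in>K. norm (frechet_derivative f (at x) c) \<le> B" for c
  proof -
    have "compact ((\<lambda>x. frechet_derivative f (at x) c) ` K)"
      by (rule compact_continuous_image[OF
            continuous_on_subset[OF Ck_on_continuous_derivative[OF assms(1)] assms(3)] assms(2)])
    then obtain B where "B > 0" "\<forall>y\<in>(\<lambda>x. frechet_derivative f (at x) c) ` K. norm y \<le> B"
      using compact_imp_bounded bounded_pos by blast
    then show ?thesis by blast
  qed
  then obtain B where *: "\<forall>c. B c > 0 \<and> (\<forall>x\<in>K. norm (frechet_derivative f (at x) c) \<le> B c)"
    using choice[of "\<lambda>c B. B > 0 \<and> (\<forall>x\<in>K. norm (frechet_derivative f (at x) c) \<le> B)"] by blast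
  have B: "\<And>c. B c > 0" "\<And>c x. x \<in> K \<Longrightarrow> norm (frechet_derivative f (at x) c) \<le> B c"
    using * by blast+
  show ?thesis
  proof
    have "sum B Basis \<ge> 0" using B(1) by (intro sum_nonneg) (simp add: less_imp_le)
    then show "1 + sum B Basis > 0" by simp
    fix x v assume x: "x \<in> K"
    have lin: "linear (frechet_derivative f (at x))"
      using Ck_on_has_derivative[OF assms(1)] assms(3) x has_derivative_linear by blast
    have "norm (frechet_derivative f (at x) v) \<le> (\<Sum>c\<in>Basis. norm ((v \<bullet> c) *\<^sub>R frechet_derivative f (at x) c))"
      unfolding linear_Basis_expansion[OF lin, of v] by (rule norm_sum)
    also have "\<dots> \<le> (\<Sum>c\<in>Basis. norm v * B c)"
      using B(2)[OF x] by (intro sum_mono) (auto intro!: mult_mono simp: Basis_le_norm)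
    also have "\<dots> \<le> (1 + sum B Basis) * norm v"
      by (simp only: sum_distrib_left[symmetric]) (simp add: distrib_left mult.commute)
    finally show "norm (frechet_derivative f (at x) v) \<le> (1 + sum B Basis) * norm v" .
  qed
qed

declare Ck_on.simps(2) [simp del]

section \<open>The Morse--Sard theorem for real-valued functions\<close>

lemma negligible_image_of_flat:
  fixes \<phi> :: "'a::euclidean_space \<Rightarrow> real"
  assumes "bounded T"
    and flat: "\<And>\<epsilon>. \<epsilon> > 0 \<Longrightarrow> \<exists>\<delta>>0. \<forall>x\<in>T. \<forall>y\<in>T. norm (y - x) < \<delta> \<longrightarrow>
                 \<bar>\<phi> y - \<phi> x\<bar> \<le> \<epsilon> * norm (y - x) ^ DIM('a)"
  shows "negligible (\<phi> ` T)"
  unfolding negligible_outer_le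
proof (intro allI impI)
  fix e :: real assume "e > 0"
  define n where "n = DIM('a)"
  have n: "n > 0" by (simp add: n_def)
  obtain M0 where M0: "\<And>x. x \<in> T \<Longrightarrow> norm x \<le> M0" using \<open>bounded T\<close> bounded_iff by blast
  obtain M :: nat where M: "M \<ge> 1" "real M \<ge> M0"
    by (metis add.commute le_add1 linorder_not_le nle_le of_nat_le_iff order_trans real_arch_simple)
  define \<epsilon> where "\<epsilon> = e / (2 * (3 * real M * n) ^ n)"
  have pos: "(3 * real M * n) ^ n > 0" using M n by simp
  have "\<epsilon> > 0" using \<open>e > 0\<close> pos by (simp add: \<epsilon>_def)
  then obtain \<delta> where "\<delta> > 0" and \<delta>: "\<And>x y. x \<in> T \<Longrightarrow> y \<in> T \<Longrightarrow> norm (y - x) < \<delta> \<Longrightarrow>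
                 \<bar>\<phi> y - \<phi> x\<bar> \<le> \<epsilon> * norm (y - x) ^ n"
    using flat[OF \<open>\<epsilon> > 0\<close>] unfolding n_def by blast
  obtain N :: nat where N: "real N > n / \<delta>" using reals_Archimedean2 by blast
  then have "real N > 0" using \<open>\<delta> > 0\<close> n by (smt (verit) divide_nonneg_pos of_nat_0_le_iff)
  then have Nd: "n / real N < \<delta>" using N \<open>\<delta> > 0\<close> by (simp add: field_simps)
  define q where "q x = restrict (\<lambda>b::'a. \<lfloor>x \<bullet> b * real N\<rfloor>) Basis" for x
  have close: "norm (y - x) \<le> n / real N" if "q x = q y" for x y
  proof -
    have "norm (y - x) \<le> (\<Sum>b\<in>Basis. \<bar>(y - x) \<bullet> b\<bar>)" by (rule norm_le_l1)
    also have "\<dots> \<le> (\<Sum>b\<in>(Basis::'a set). 1 / real N)"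
    proof (rule sum_mono)
      fix b :: 'a assume "b \<in> Basis"
      then have "\<lfloor>x \<bullet> b * real N\<rfloor> = \<lfloor>y \<bullet> b * real N\<rfloor>"
        using fun_cong[OF that, of b] by (simp add: q_def)
      then have "\<bar>y \<bullet> b * real N - x \<bullet> b * real N\<bar> \<le> 1" by linarith
      moreover have "\<bar>y \<bullet> b * real N - x \<bullet> b * real N\<bar> = \<bar>(y - x) \<bullet> b\<bar> * real N"
        using \<open>real N > 0\<close> by (simp add: inner_diff_left abs_mult flip: left_diff_distrib)
      ultimately show "\<bar>(y - x) \<bullet> b\<bar> \<le> 1 / real N"
        using \<open>real N > 0\<close> by (simp add: field_simps)
    qed
    finally show ?thesis by (simp add: n_def)
  qed
  define I where "I = PiE (Basis::'a set) (\<lambda>_. {- int (M * N) .. int (M * N)})"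
  have finI: "finite I" unfolding I_def by (intro finite_PiE) auto
  have qI: "q ` T \<subseteq> I"
  proof
    fix c assume "c \<in> q ` T"
    then obtain x where x: "x \<in> T" "c = q x" by blast
    have "\<lfloor>x \<bullet> b * real N\<rfloor> \<in> {- int (M * N) .. int (M * N)}" if "b \<in> Basis" for b
    proof -
      have "\<bar>x \<bullet> b\<bar> \<le> real M" using Basis_le_norm[OF that, of x] M0[OF x(1)] M by linarith
      then have "\<bar>x \<bullet> b * real N\<bar> \<le> real M * real N"
        using \<open>real N > 0\<close> by (simp add: abs_mult)
      then have "x \<bullet> b * real N \<le> real_of_int (int (M * N))" "real_of_int (- int (M * N)) \<le> x \<bullet> b * real N"
        by auto
      then show ?thesis by (simp only: atLeastAtMost_iff le_floor_iff) (metis floor_mono floor_of_int)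
    qed
    then show "c \<in> I" unfolding I_def x q_def by auto
  qed
  have "card I = (2 * M * N + 1) ^ n"
  proof -
    have "2 * (int M * int N) + 1 = int (2 * M * N + 1)" by simp
    then have "nat (2 * (int M * int N) + 1) = 2 * M * N + 1" by (simp only: nat_int)
    then show ?thesis unfolding I_def n_def by (subst card_PiE) auto
  qed
  moreover have "2 * M * N + 1 \<le> 3 * M * N"
  proof -
    have "M * N \<ge> 1" using M \<open>real N > 0\<close> by (simp add: Suc_le_eq)
    then show ?thesis by simp
  qed
  ultimately have cardI: "card I \<le> (3 * M * N) ^ n"
    using power_mono[of "2 * M * N + 1" "3 * M * N" n] by simp
  have cardq: "real (card (q ` T)) \<le> (3 * real M * real N) ^ n"
  proof -
    have "card (q ` T) \<le> (3 * M * N) ^ n"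
      by (rule order_trans[OF card_mono[OF finI qI] cardI])
    then
    have "real (card (q ` T)) \<le> real ((3 * M * N) ^ n)" by (simp only: of_nat_le_iff)
    then show ?thesis by simp
  qed
  define rep where "rep c = (SOME x. x \<in> T \<and> q x = c)" for c
  have rep: "rep c \<in> T" "q (rep c) = c" if "c \<in> q ` T" for c
    using that someI_ex[of "\<lambda>x. x \<in> T \<and> q x = c"] unfolding rep_def by blast+
  define r where "r = \<epsilon> * (n / real N) ^ n"
  have "r \<ge> 0" using \<open>\<epsilon> > 0\<close> by (simp add: r_def)
  let ?K = "\<Union>c\<in>q ` T. {\<phi> (rep c) - r .. \<phi> (rep c) + r}"
  have finq: "finite (q ` T)" using finI qI finite_subset by blast
  show "\<exists>K. \<phi> ` T \<subseteq> K \<and> K \<in> lmeasurable \<and> measure lebesgue K \<le> e"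
  proof (intro exI conjI)
    show "\<phi> ` T \<subseteq> ?K"
    proof
      fix z assume "z \<in> \<phi> ` T"
      then obtain x where x: "x \<in> T" "z = \<phi> x" by blast
      let ?y = "rep (q x)"
      have y: "?y \<in> T" "q ?y = q x" using rep x by auto
      have le: "norm (x - ?y) \<le> n / real N" using close y by blast
      then have "\<bar>\<phi> x - \<phi> ?y\<bar> \<le> \<epsilon> * norm (x - ?y) ^ n" using \<delta>[OF y(1) x(1)] Nd by linarith
      also have "\<dots> \<le> r" unfolding r_def using le \<open>\<epsilon> > 0\<close> by (intro mult_left_mono power_mono) auto
      finally have "z \<in> {\<phi> ?y - r .. \<phi> ?y + r}" using x by auto
      then show "z \<in> ?K" using x by blast
    qed
    show "?K \<in> lmeasurable" using finq by (intro fmeasurable.finite_UN) auto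
    have "measure lebesgue ?K \<le> (\<Sum>c\<in>q ` T. measure lebesgue {\<phi> (rep c) - r .. \<phi> (rep c) + r})"
      using finq by (intro measure_UNION_le) auto
    also have "\<dots> = real (card (q ` T)) * (2 * r)" using \<open>r \<ge> 0\<close> by simp
    also have "\<dots> \<le> (3 * real M * real N) ^ n * (2 * r)"
      using cardq \<open>r \<ge> 0\<close> by (intro mult_right_mono) auto
    also have "\<dots> = 2 * \<epsilon> * (3 * real M * real N * (n / real N)) ^ n"
      unfolding r_def power_mult_distrib by simp
    also have "3 * real M * real N * (n / real N) = 3 * real M * n" using \<open>real N > 0\<close> by simp
    also have "2 * \<epsilon> * (3 * real M * n) ^ n = e"
      unfolding \<epsilon>_def using less_imp_neq[OF pos] by simp
    finally show "measure lebesgue ?K \<le> e" .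
  qed
qed

lemma replace_coordinate_chart:
  fixes h :: "'a::euclidean_space \<Rightarrow> real"
  assumes "open U" and h: "Ck_on (Suc k) U h" and "x0 \<in> U" "b \<in> Basis"
    and nz: "frechet_derivative h (at x0) b \<noteq> 0"
  obtains U' V \<Psi> where "open U'" "U' \<subseteq> U" "x0 \<in> U'" "open V"
    "homeomorphism U' V (\<lambda>x. x + (h x - x \<bullet> b) *\<^sub>R b) \<Psi>" "Ck_on (Suc k) V \<Psi>"
proof -
  let ?D = "\<lambda>x. frechet_derivative h (at x)"
  let ?f = "\<lambda>x. x + (h x - x \<bullet> b) *\<^sub>R b"
  define L where "L x v = v + (?D x v - v \<bullet> b) *\<^sub>R b" for x v
  define J where "J x w = w + ((w \<bullet> b - ?D x w) * inverse (?D x b)) *\<^sub>R b" for x w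
  have Dh: "(h has_derivative ?D x) (at x)" if "x \<in> U" for x
    using Ck_on_has_derivative[OF h that] .
  have bl: "bounded_linear (?D x)" if "x \<in> U" for x
    using Dh[OF that] by (rule has_derivative_bounded_linear)
  have blL: "bounded_linear (L x)" if "x \<in> U" for x
    unfolding L_def by (intro bounded_linear_intros bl that)
  have blJ: "bounded_linear (J x)" if "x \<in> U" for x
    unfolding J_def by (intro bounded_linear_intros bl that)
  have derf: "(?f has_derivative L x) (at x)" if "x \<in> U" for x
    unfolding L_def by (intro derivative_intros Dh that)
  have bb: "b \<bullet> b = 1" using \<open>b \<in> Basis\<close> by simp
  have D_lin: "?D x (v + s *\<^sub>R b) = ?D x v + s * ?D x b" if "x \<in> U" for x v s
    using bl[OF that] by (simp add: linear_simps)
  have JL: "J x (L x v) = v" if "x \<in> U" "?D x b \<noteq> 0" for x v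
    unfolding J_def L_def using that
    by (simp add: D_lin bb inner_add_left flip: scaleR_add_left)
  have LJ: "L x (J x v) = v" if "x \<in> U" "?D x b \<noteq> 0" for x v
    unfolding J_def L_def using that
    by (simp add: D_lin bb inner_add_left flip: scaleR_add_left) (simp add: field_simps)
  define f' where "f' x = Blinfun (L x)" for x
  have f': "blinfun_apply (f' x) = L x" if "x \<in> U" for x
    unfolding f'_def by (rule bounded_linear_Blinfun_apply[OF blL[OF that]])
  have cont: "continuous_on U f'"
  proof (rule continuous_on_blinfun_componentwise)
    fix i :: 'a assume "i \<in> Basis"
    have "continuous_on U (\<lambda>x. L x i)" unfolding L_def
      by (intro continuous_intros Ck_on_continuous_derivative[OF h])
    then show "continuous_on U (\<lambda>x. blinfun_apply (f' x) i)"
      using f' by (metis (no_types, lifting) continuous_on_cong)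
  qed
  have inv0: "Blinfun (J x0) o\<^sub>L f' x0 = id_blinfun"
    by (rule blinfun_eqI)
      (simp add: f'[OF \<open>x0 \<in> U\<close>] bounded_linear_Blinfun_apply[OF blJ[OF \<open>x0 \<in> U\<close>]] JL[OF \<open>x0 \<in> U\<close> nz])
  have derf': "(?f has_derivative blinfun_apply (f' x)) (at x)" if "x \<in> U" for x
    using derf f' that by simp
  obtain U' V g g' where g: "open U'" "U' \<subseteq> U" "x0 \<in> U'" "open V" "?f x0 \<in> V" "homeomorphism U' V ?f g"
    and dg: "\<And>y. y \<in> V \<Longrightarrow> (g has_derivative (g' y)) (at y)"
    and g': "\<And>y. y \<in> V \<Longrightarrow> g' y = inv (blinfun_apply (f'(g y)))"
    and bij: "\<And>y. y \<in> V \<Longrightarrow> bij (blinfun_apply (f'(g y)))"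
    by (rule inverse_function_theorem[OF \<open>open U\<close> derf' cont \<open>x0 \<in> U\<close> inv0]) (assumption, rule that)
  have gU: "g y \<in> U" if "y \<in> V" for y
    using g(2,6) that unfolding homeomorphism_def by blast
  have nzV: "?D (g y) b \<noteq> 0" if "y \<in> V" for y
  proof
    assume "?D (g y) b = 0"
    then have "L (g y) b = 0" unfolding L_def by (simp add: bb)
    moreover have "L (g y) 0 = 0" using blL[OF gU[OF that]] by (simp add: linear_simps)
    moreover have "inj (L (g y))" using bij[OF that] f'[OF gU[OF that]] by (simp add: bij_def)
    ultimately have "b = 0" by (metis injD)
    then show False using bb by simp
  qed
  have dg': "(g has_derivative J (g y)) (at y)" if "y \<in> V" for y
  proof -
    have "g' y = J (g y)"
    proof
      fix v
      show "g' y v = J (g y) v"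
        unfolding g'[OF that]
      proof (rule inv_f_eq)
        show "inj (blinfun_apply (f' (g y)))" using bij[OF that] by (rule bij_is_inj)
        show "blinfun_apply (f' (g y)) (J (g y) v) = v"
          using LJ[OF gU[OF that] nzV[OF that]] f'[OF gU[OF that]] by simp
      qed
    qed
    then show ?thesis using dg[OF that] by simp
  qed
  have "Ck_on j V g" if "j \<le> Suc k" for j
    using that
  proof (induction j)
    case 0
    then show ?case using g(6) unfolding homeomorphism_def by simp
  next
    case (Suc j)
    then have gj: "Ck_on j V g" and "j \<le> k" by auto
    have Dc: "Ck_on j V (\<lambda>y. ?D (g y) c)" if "c \<in> Basis" for c
      by (rule Ck_on_compose[OF \<open>open V\<close> Ck_on_le[OF Ck_on_partial[OF h that] \<open>j \<le> k\<close>] gj])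
        (use gU in blast)
    show ?case
      by (rule Ck_on_SucI[OF \<open>open V\<close> dg'], assumption, unfold J_def)
        (intro Ck_on_add Ck_on_const Ck_on_scaleR Ck_on_mult Ck_on_diff Ck_on_inverse Dc nzV
          \<open>open V\<close> \<open>b \<in> Basis\<close>)
  qed
  then show ?thesis using that[OF g(1-4,6)] by blast
qed

definition coord_space :: "'a::euclidean_space set \<Rightarrow> 'a set" where
  "coord_space S = {x. \<forall>c\<in>Basis - S. x \<bullet> c = 0}"

definition flat_along :: "nat \<Rightarrow> 'a::real_normed_vector set \<Rightarrow> 'a set \<Rightarrow> ('a \<Rightarrow> real) \<Rightarrow> bool" where
  "flat_along k T D u \<longleftrightarrow> (\<forall>\<epsilon>>0. \<exists>\<delta>>0. \<forall>x\<in>T. \<forall>y\<in>D. norm (y - x) < \<delta> \<longrightarrow>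
     \<bar>u y - u x\<bar> \<le> \<epsilon> * norm (y - x) ^ k)"

definition derivative_bounded_on :: "'a::real_normed_vector set \<Rightarrow> ('a \<Rightarrow> 'b::real_normed_vector) \<Rightarrow> bool" where
  "derivative_bounded_on D \<psi> \<longleftrightarrow>
     (\<exists>B. \<forall>z\<in>D. \<exists>\<psi>'. (\<psi> has_derivative \<psi>') (at z) \<and> (\<forall>v. norm (\<psi>' v) \<le> B * norm v))"

lemma flat_along_finite:
  assumes "finite S" "\<And>b. b \<in> S \<Longrightarrow> flat_along k T D (u b)" "\<epsilon> > 0"
  shows "\<exists>\<delta>>0. \<forall>b\<in>S. \<forall>x\<in>T. \<forall>y\<in>D. norm (y - x) < \<delta> \<longrightarrow> \<bar>u b y - u b x\<bar> \<le> \<epsilon> * norm (y - x) ^ k"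
  using assms(1,2)
proof (induction S rule: finite_induct)
  case empty
  then show ?case by (auto intro: exI[of _ 1])
next
  case (insert b S)
  obtain d1 where d1: "d1 > 0" "\<forall>c\<in>S. \<forall>x\<in>T. \<forall>y\<in>D. norm (y - x) < d1 \<longrightarrow> \<bar>u c y - u c x\<bar> \<le> \<epsilon> * norm (y - x) ^ k"
    using insert by auto
  obtain d2 where d2: "d2 > 0" "\<forall>x\<in>T. \<forall>y\<in>D. norm (y - x) < d2 \<longrightarrow> \<bar>u b y - u b x\<bar> \<le> \<epsilon> * norm (y - x) ^ k"
    using insert.prems[of b] \<open>\<epsilon> > 0\<close> unfolding flat_along_def by auto
  show ?case using d1 d2 by (intro exI[of _ "min d1 d2"]) auto
qed

text \<open>Integration along segments gains one order of flatness.\<close>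

lemma flat_along_Suc:
  fixes h :: "'b::euclidean_space \<Rightarrow> real" and \<psi> :: "'a::euclidean_space \<Rightarrow> 'b"
  assumes "convex D" "T \<subseteq> D" and tame: "derivative_bounded_on D \<psi>"
    and \<psi>D: "\<psi> ` D \<subseteq> U \<inter> coord_space S" and "S \<subseteq> Basis"
    and h: "\<And>z. z \<in> U \<Longrightarrow> (h has_derivative h' z) (at z)"
    and zero: "\<And>b x. b \<in> S \<Longrightarrow> x \<in> T \<Longrightarrow> h' (\<psi> x) b = 0"
    and flat: "\<And>b. b \<in> S \<Longrightarrow> flat_along k T D (\<lambda>y. h' (\<psi> y) b)"
  shows "flat_along (Suc k) T D (\<lambda>y. h (\<psi> y))"
  unfolding flat_along_def
proof (intro allI impI)
  fix \<epsilon> :: real assume "\<epsilon> > 0"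
  obtain B0 where B0: "\<forall>z\<in>D. \<exists>\<psi>'. (\<psi> has_derivative \<psi>') (at z) \<and> (\<forall>v. norm (\<psi>' v) \<le> B0 * norm v)"
    using tame unfolding derivative_bounded_on_def by blast
  define B where "B = max B0 1"
  have "B > 0" by (simp add: B_def)
  have "\<forall>z\<in>D. \<exists>\<psi>'. (\<psi> has_derivative \<psi>') (at z) \<and> (\<forall>v. norm (\<psi>' v) \<le> B * norm v)"
    using B0 unfolding B_def by (meson max.cobounded1 mult_right_mono norm_ge_zero order_trans)
  then obtain \<psi>' where \<psi>': "\<And>z. z \<in> D \<Longrightarrow> (\<psi> has_derivative \<psi>' z) (at z)"
    "\<And>z v. z \<in> D \<Longrightarrow> norm (\<psi>' z v) \<le> B * norm v" by metis
  have finS: "finite S" by (rule finite_subset[OF \<open>S \<subseteq> Basis\<close> finite_Basis])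
  define e where "e = \<epsilon> / (B * (card S + 1))"
  have "e > 0" using \<open>\<epsilon> > 0\<close> \<open>B > 0\<close> by (simp add: e_def)
  obtain \<delta> where "\<delta> > 0" and \<delta>: "\<And>b x y. b \<in> S \<Longrightarrow> x \<in> T \<Longrightarrow> y \<in> D \<Longrightarrow> norm (y - x) < \<delta> \<Longrightarrow>
      \<bar>h' (\<psi> y) b - h' (\<psi> x) b\<bar> \<le> e * norm (y - x) ^ k"
    using flat_along_finite[where u = "\<lambda>b y. h' (\<psi> y) b", OF finS flat \<open>e > 0\<close>] by blast
  show "\<exists>\<delta>>0. \<forall>x\<in>T. \<forall>y\<in>D. norm (y - x) < \<delta> \<longrightarrow> \<bar>h (\<psi> y) - h (\<psi> x)\<bar> \<le> \<epsilon> * norm (y - x) ^ Suc k"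
  proof (intro exI conjI ballI impI)
    show "\<delta> > 0" by fact
    fix x y assume x: "x \<in> T" and y: "y \<in> D" and d: "norm (y - x) < \<delta>"
    define w where "w = y - x"
    define z where "z t = x + t *\<^sub>R w" for t :: real
    have zD: "z t \<in> D" if "0 \<le> t" "t \<le> 1" for t
    proof -
      have "z t = (1 - t) *\<^sub>R x + t *\<^sub>R y" by (simp add: z_def w_def algebra_simps)
      then show ?thesis using \<open>convex D\<close> x y \<open>T \<subseteq> D\<close> that by (auto simp: convex_alt)
    qed
    have dz: "((\<lambda>t. \<psi> (z t)) has_derivative (\<lambda>s. \<psi>' (z t) (s *\<^sub>R w))) (at t within A)" if "0 \<le> t" "t \<le> 1" for t A
    proof -
      have "(z has_derivative (\<lambda>s. s *\<^sub>R w)) (at t within A)"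
        unfolding z_def by (auto intro!: derivative_eq_intros)
      then show ?thesis by (rule has_derivative_compose) (rule \<psi>'(1)[OF zD[OF that]])
    qed
    have dh: "((\<lambda>t. h (\<psi> (z t))) has_derivative (\<lambda>s. h' (\<psi> (z t)) (\<psi>' (z t) (s *\<^sub>R w)))) (at t within {0..1})"
      if "0 \<le> t" "t \<le> 1" for t
    proof -
      have "\<psi> (z t) \<in> U" using \<psi>D zD[OF that] by blast
      then show ?thesis by (rule has_derivative_compose[OF dz[OF that] h])
    qed
    obtain t where t: "0 < t" "t < 1"
      and mvt: "h (\<psi> (z 1)) - h (\<psi> (z 0)) = h' (\<psi> (z t)) (\<psi>' (z t) ((1 - 0) *\<^sub>R w))"
      using mvt_simple[OF zero_less_one dh] by auto
    let ?v = "\<psi>' (z t) w"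
    have t01: "0 \<le> t" "t \<le> 1" using t by auto
    have lin: "linear (\<psi>' (z t))" using \<psi>'(1)[OF zD[OF t01]] has_derivative_linear by blast
    have off: "?v \<bullet> c = 0" if c: "c \<in> Basis - S" for c
    proof -
      have "((\<lambda>t. \<psi> (z t) \<bullet> c) has_vector_derivative ?v \<bullet> c) (at t within cbox 0 1)"
        unfolding has_vector_derivative_def
        using has_derivative_inner_left[OF dz[OF t01], of c "cbox 0 1"] linear_scale[OF lin] by simp
      moreover have "((\<lambda>t. \<psi> (z t) \<bullet> c) has_vector_derivative 0) (at t within cbox 0 1)"
      proof (rule has_vector_derivative_transform[of t _ _ "\<lambda>_. 0"])
        show "\<psi> (z s) \<bullet> c = 0" if "s \<in> cbox 0 1" for s
          using \<psi>D zD[of s] that c unfolding coord_space_def by auto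
      qed (use t01 in auto)
      ultimately show ?thesis
        using vector_derivative_unique_within_closed_interval[of 0 1 t] t01 by auto
    qed
    have hl: "linear (h' (\<psi> (z t)))" using h \<psi>D zD[OF t01] has_derivative_linear by blast
    have "h' (\<psi> (z t)) ?v = (\<Sum>c\<in>Basis. (?v \<bullet> c) * h' (\<psi> (z t)) c)"
      by (simp only: linear_Basis_expansion[OF hl, of ?v] real_scaleR_def)
    also have "\<dots> = (\<Sum>c\<in>S. (?v \<bullet> c) * h' (\<psi> (z t)) c)"
      using off \<open>S \<subseteq> Basis\<close> by (intro sum.mono_neutral_right) auto
    finally have eq: "h' (\<psi> (z t)) ?v = (\<Sum>c\<in>S. (?v \<bullet> c) * h' (\<psi> (z t)) c)" .
    have zx: "norm (z t - x) \<le> norm w" using t by (simp add: z_def mult_left_le_one_le)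
    have "\<bar>h' (\<psi> (z t)) ?v\<bar> \<le> (\<Sum>c\<in>S. \<bar>(?v \<bullet> c) * h' (\<psi> (z t)) c\<bar>)"
      unfolding eq by (rule sum_abs)
    also have "\<dots> \<le> (\<Sum>c\<in>S. (B * norm w) * (e * norm w ^ k))"
    proof (rule sum_mono)
      fix c assume c: "c \<in> S"
      then have "\<bar>?v \<bullet> c\<bar> \<le> norm ?v" using Basis_le_norm \<open>S \<subseteq> Basis\<close> by blast
      then have 1: "\<bar>?v \<bullet> c\<bar> \<le> B * norm w" using \<psi>'(2)[OF zD[OF t01], of w] by linarith
      have "\<bar>h' (\<psi> (z t)) c\<bar> \<le> e * norm (z t - x) ^ k"
        using \<delta>[OF c x zD[OF t01]] zero[OF c x] zx d by (simp add: w_def)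
      also have "\<dots> \<le> e * norm w ^ k" using zx \<open>e > 0\<close> by (intro mult_left_mono power_mono) auto
      finally show "\<bar>(?v \<bullet> c) * h' (\<psi> (z t)) c\<bar> \<le> (B * norm w) * (e * norm w ^ k)"
        using 1 by (simp add: abs_mult mult_mono')
    qed
    also have "\<dots> = (B * card S * e) * norm w ^ Suc k" by simp
    also have "\<dots> \<le> \<epsilon> * norm w ^ Suc k"
    proof (rule mult_right_mono)
      have "B * card S * e = \<epsilon> * (card S / (card S + 1))" using \<open>B > 0\<close> by (simp add: e_def)
      also have "\<dots> \<le> \<epsilon> * 1" using \<open>\<epsilon> > 0\<close> by (intro mult_left_mono) auto
      finally show "B * card S * e \<le> \<epsilon>" by simp
    qed auto
    finally have "\<bar>h' (\<psi> (z t)) ?v\<bar> \<le> \<epsilon> * norm w ^ Suc k" .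
    then show "\<bar>h (\<psi> y) - h (\<psi> x)\<bar> \<le> \<epsilon> * norm (y - x) ^ Suc k"
      using mvt by (simp add: z_def w_def)
  qed
qed

definition flat_piece :: "nat \<Rightarrow> 'a::euclidean_space set \<Rightarrow> 'a set \<Rightarrow> 'a set \<Rightarrow>
    'a set \<times> 'a set \<times> ('a \<Rightarrow> 'a) \<Rightarrow> bool" where
  "flat_piece k S U A = (\<lambda>(T, D, \<psi>).
     T \<subseteq> D \<and> compact D \<and> convex D \<and> \<psi> ` D \<subseteq> U \<inter> coord_space S \<and> \<psi> ` T \<subseteq> A \<and>
     derivative_bounded_on D \<psi> \<and>
     (\<forall>h. Ck_on k U h \<longrightarrow> (\<forall>x\<in>A. h x = 0) \<longrightarrow> flat_along k T D (\<lambda>y. h (\<psi> y))))"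

definition piece_image :: "'a set \<times> 'a set \<times> ('a \<Rightarrow> 'a) \<Rightarrow> 'a set" where
  "piece_image = (\<lambda>(T, D, \<psi>). \<psi> ` T)"

lemma derivative_bounded_on_ident: "derivative_bounded_on D (\<lambda>x. x)"
  unfolding derivative_bounded_on_def by (rule exI[of _ 1]) (auto intro!: exI[of _ "\<lambda>x. x"])

lemma countable_subcover:
  fixes W :: "'a::second_countable_topology \<Rightarrow> 'a set"
  assumes "\<And>x. x \<in> A \<Longrightarrow> open (W x)" "\<And>x. x \<in> A \<Longrightarrow> x \<in> W x"
  obtains X where "countable X" "X \<subseteq> A" "A \<subseteq> \<Union> (W ` X)"
proof -
  obtain \<F> where \<F>: "\<F> \<subseteq> W ` A" "countable \<F>" "\<Union> \<F> = \<Union> (W ` A)"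
    using Lindelof[of "W ` A"] assms(1) by auto
  have "\<exists>X. countable X \<and> X \<subseteq> A \<and> \<F> = W ` X"
    using \<F>(1,2) by (subst countable_subset_image[symmetric]) simp
  then obtain X where X: "countable X" "X \<subseteq> A" "\<F> = W ` X" by (elim exE conjE) (rule that)
  show ?thesis
  proof (rule that[OF X(1,2)])
    show "A \<subseteq> \<Union> (W ` X)" using \<F>(3) assms(2) unfolding X(3)[symmetric] by auto
  qed
qed

lemma flat_pieces_0:
  fixes U :: "'a::euclidean_space set"
  assumes "open U" "A \<subseteq> U \<inter> coord_space S"
  shows "\<exists>\<C>. countable \<C> \<and> (\<forall>c\<in>\<C>. flat_piece 0 S U A c) \<and> A \<subseteq> \<Union> (piece_image ` \<C>)"
proof -
  have "\<forall>x\<in>U. \<exists>r>0. cball x r \<subseteq> U" using \<open>open U\<close> open_contains_cball by blast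
  then obtain r where r: "\<And>x. x \<in> U \<Longrightarrow> r x > 0" "\<And>x. x \<in> U \<Longrightarrow> cball x (r x) \<subseteq> U" by metis
  obtain X where X: "countable X" "X \<subseteq> U" "U \<subseteq> (\<Union>x\<in>X. ball x (r x))"
    by (rule countable_subcover[of U "\<lambda>x. ball x (r x)"]) (use r in auto)
  define P where "P x = (A \<inter> cball x (r x), cball x (r x) \<inter> coord_space S, \<lambda>x::'a. x)" for x
  have conv: "convex (coord_space S)" unfolding coord_space_def convex_def
    by (auto simp: inner_add_left)
  have "coord_space S = (\<Inter>c\<in>Basis - S. {x. c \<bullet> x = 0})" by (auto simp: coord_space_def inner_commute)
  then have closed: "closed (coord_space S)"
    by (simp only:) (intro closed_INT ballI closed_hyperplane)
  have "flat_piece 0 S U A (P x)" if "x \<in> X" for x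
  proof -
    have "flat_along 0 (A \<inter> cball x (r x)) (cball x (r x) \<inter> coord_space S) h" if h: "Ck_on 0 U h" for h
    proof -
      have "continuous_on (cball x (r x)) h"
        using h r(2) \<open>x \<in> X\<close> X(2) by (auto intro: continuous_on_subset)
      then have "uniformly_continuous_on (cball x (r x)) h"
        using compact_cball compact_uniformly_continuous by blast
      then have uc: "\<And>\<epsilon>. \<epsilon> > 0 \<Longrightarrow> \<exists>d>0. \<forall>u\<in>cball x (r x). \<forall>v\<in>cball x (r x). norm (v - u) < d \<longrightarrow> \<bar>h v - h u\<bar> < \<epsilon>"
        unfolding uniformly_continuous_on_def dist_norm by simp
      show ?thesis unfolding flat_along_def
      proof (intro allI impI)
        fix \<epsilon> :: real assume "\<epsilon> > 0"
        then obtain d where d: "d > 0" "\<And>u v. u \<in> cball x (r x) \<Longrightarrow> v \<in> cball x (r x) \<Longrightarrow> norm (v - u) < d \<Longrightarrow> \<bar>h v - h u\<bar> < \<epsilon>"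
          using uc by blast
        show "\<exists>\<delta>>0. \<forall>u\<in>A \<inter> cball x (r x). \<forall>v\<in>cball x (r x) \<inter> coord_space S.
            norm (v - u) < \<delta> \<longrightarrow> \<bar>h v - h u\<bar> \<le> \<epsilon> * norm (v - u) ^ 0"
        proof (intro exI[of _ d] conjI ballI impI)
          fix u v assume "u \<in> A \<inter> cball x (r x)" "v \<in> cball x (r x) \<inter> coord_space S" "norm (v - u) < d"
          then show "\<bar>h v - h u\<bar> \<le> \<epsilon> * norm (v - u) ^ 0" using d(2)[of u v] by simp
        qed (rule d(1))
      qed
    qed
    then show ?thesis unfolding flat_piece_def P_def
      using assms(2) r(2)[of x] that X(2)
      by (auto intro!: compact_Int_closed convex_Int conv closed derivative_bounded_on_ident)
  qed
  moreover have "A \<subseteq> \<Union> (piece_image ` P ` X)"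
  proof
    fix a assume a: "a \<in> A"
    then obtain x where "x \<in> X" "a \<in> ball x (r x)" using X(3) assms(2) by blast
    then show "a \<in> \<Union> (piece_image ` P ` X)" using a by (auto simp: piece_image_def P_def intro!: bexI[of _ x])
  qed
  ultimately show ?thesis using X(1) by (intro exI[of _ "P ` X"]) auto
qed

lemma flat_piece_compose:
  fixes \<Psi> :: "'a::euclidean_space \<Rightarrow> 'a"
  assumes c: "flat_piece k S' V A' (T, D, \<psi>)"
    and "open V" "open U" and \<Psi>: "Ck_on k V \<Psi>" "\<Psi> ` V \<subseteq> U" "derivative_bounded_on V \<Psi>"
    and S: "\<Psi> ` (V \<inter> coord_space S') \<subseteq> coord_space S" and A: "\<Psi> ` A' \<subseteq> A"
  shows "flat_piece k S U A (T, D, \<lambda>y. \<Psi> (\<psi> y))"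
proof -
  have c': "T \<subseteq> D" "compact D" "convex D" "\<psi> ` D \<subseteq> V \<inter> coord_space S'" "\<psi> ` T \<subseteq> A'"
    "derivative_bounded_on D \<psi>"
    and flat: "\<And>h. Ck_on k V h \<Longrightarrow> \<forall>x\<in>A'. h x = 0 \<Longrightarrow> flat_along k T D (\<lambda>y. h (\<psi> y))"
    using c unfolding flat_piece_def by auto
  obtain B1 where B1: "\<And>z. z \<in> V \<Longrightarrow> \<exists>\<psi>'. (\<Psi> has_derivative \<psi>') (at z) \<and> (\<forall>v. norm (\<psi>' v) \<le> B1 * norm v)"
    using \<Psi>(3) unfolding derivative_bounded_on_def by blast
  obtain B2 where B2: "\<And>z. z \<in> D \<Longrightarrow> \<exists>\<psi>'. (\<psi> has_derivative \<psi>') (at z) \<and> (\<forall>v. norm (\<psi>' v) \<le> B2 * norm v)"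
    using c'(6) unfolding derivative_bounded_on_def by blast
  have "derivative_bounded_on D (\<lambda>y. \<Psi> (\<psi> y))"
    unfolding derivative_bounded_on_def
  proof (intro exI[of _ "\<bar>B1\<bar> * B2"] ballI)
    fix z assume z: "z \<in> D"
    then have zV: "\<psi> z \<in> V" using c'(4) by blast
    obtain p1 where p1: "(\<Psi> has_derivative p1) (at (\<psi> z))" "\<And>v. norm (p1 v) \<le> B1 * norm v"
      using B1[OF zV] by blast
    obtain p2 where p2: "(\<psi> has_derivative p2) (at z)" "\<And>v. norm (p2 v) \<le> B2 * norm v"
      using B2[OF z] by blast
    have "norm (p1 (p2 v)) \<le> \<bar>B1\<bar> * B2 * norm v" for v
    proof -
      have "norm (p1 (p2 v)) \<le> B1 * norm (p2 v)" by (rule p1)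
      also have "\<dots> \<le> \<bar>B1\<bar> * norm (p2 v)" by (intro mult_right_mono) auto
      also have "\<dots> \<le> \<bar>B1\<bar> * (B2 * norm v)" using p2(2) by (intro mult_left_mono) auto
      finally show ?thesis by (simp add: mult.assoc)
    qed
    then show "\<exists>d. ((\<lambda>y. \<Psi> (\<psi> y)) has_derivative d) (at z) \<and>
        (\<forall>v. norm (d v) \<le> (\<bar>B1\<bar> * B2) * norm v)"
      using has_derivative_compose[OF p2(1) p1(1)] by blast
  qed
  moreover have "flat_along k T D (\<lambda>y. h (\<Psi> (\<psi> y)))" if "Ck_on k U h" "\<forall>x\<in>A. h x = 0" for h
    by (rule flat[of "\<lambda>y. h (\<Psi> y)"]) (use Ck_on_compose[OF \<open>open V\<close> that(1) \<Psi>(1,2)] that(2) A in auto)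
  moreover have "(\<lambda>y. \<Psi> (\<psi> y)) ` D \<subseteq> U \<inter> coord_space S"
    using c'(4) \<Psi>(2) S by blast
  moreover have "(\<lambda>y. \<Psi> (\<psi> y)) ` T \<subseteq> A" using c'(5) A by blast
  ultimately show ?thesis using c'(1-3) unfolding flat_piece_def by auto
qed

text \<open>The decomposition lemma of Kneser, Glaeser and Morse. A point of \<open>A\<close> at which some
  function vanishing on \<open>A\<close> has a nonzero derivative lies on a hypersurface containing \<open>A\<close>,
  which reduces the dimension; at the remaining points the derivatives of all such functions
  vanish as well, which reduces the order of differentiability.\<close>

lemma flat_pieces:
  fixes U :: "'a::euclidean_space set"
  assumes "S \<subseteq> Basis" "open U" "A \<subseteq> U \<inter> coord_space S"
  shows "\<exists>\<C>. countable \<C> \<and> (\<forall>c\<in>\<C>. flat_piece k S U A c) \<and> A \<subseteq> \<Union> (piece_image ` \<C>)"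
  using assms
proof (induction k arbitrary: S U A)
  case 0
  show ?case by (rule flat_pieces_0[OF 0(2,3)])
next
  case (Suc k)
  note IHk = Suc.IH
  show ?case using Suc.prems
  proof (induction "card S" arbitrary: S U A rule: less_induct)
    case less
    note IHS = less.hyps and S = less.prems(1) and U = less.prems(2) and A = less.prems(3)
    have finS: "finite S" by (rule finite_subset[OF S finite_Basis])
    define A0 where "A0 = {x\<in>A. \<forall>h :: 'a \<Rightarrow> real. Ck_on (Suc k) U h \<longrightarrow> (\<forall>x\<in>A. h x = 0) \<longrightarrow>
       (\<forall>b\<in>S. frechet_derivative h (at x) b = 0)}"
    have A0: "A0 \<subseteq> U \<inter> coord_space S" using A by (auto simp: A0_def)
    obtain \<C>0 where \<C>0: "countable \<C>0" "\<And>c. c \<in> \<C>0 \<Longrightarrow> flat_piece k S U A0 c" "A0 \<subseteq> \<Union> (piece_image ` \<C>0)"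
      using IHk[OF S U A0] by blast
    have piece0: "flat_piece (Suc k) S U A c" if c: "c \<in> \<C>0" for c
    proof -
      obtain T D \<psi> where cT: "c = (T, D, \<psi>)" by (cases c) auto
      have c': "T \<subseteq> D" "compact D" "convex D" "\<psi> ` D \<subseteq> U \<inter> coord_space S" "\<psi> ` T \<subseteq> A0"
        "derivative_bounded_on D \<psi>"
        and flat: "\<And>h. Ck_on k U h \<Longrightarrow> \<forall>x\<in>A0. h x = 0 \<Longrightarrow> flat_along k T D (\<lambda>y. h (\<psi> y))"
        using \<C>0(2)[OF c] unfolding flat_piece_def cT by auto
      have "flat_along (Suc k) T D (\<lambda>y. h (\<psi> y))" if h: "Ck_on (Suc k) U h" "\<forall>x\<in>A. h x = 0" for h
      proof (rule flat_along_Suc[OF c'(3,1,6,4) S Ck_on_has_derivative[OF h(1)]])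
        have zero: "frechet_derivative h (at x) b = 0" if "b \<in> S" "x \<in> A0" for b x
          using that h unfolding A0_def by simp
        show "frechet_derivative h (at (\<psi> x)) b = 0" if "b \<in> S" "x \<in> T" for b x
          by (rule zero) (use that c'(5) in auto)
        show "flat_along k T D (\<lambda>y. frechet_derivative h (at (\<psi> y)) b)" if "b \<in> S" for b
          by (rule flat[of "\<lambda>x. frechet_derivative h (at x) b"])
            (use Ck_on_partial[OF h(1)] zero that S in auto)
      qed
      moreover have "\<psi> ` T \<subseteq> A" using c'(5) by (auto simp: A0_def)
      ultimately show ?thesis unfolding flat_piece_def cT using c' by auto
    qed
    have local: "\<exists>W \<C>. open W \<and> x \<in> W \<and> countable \<C> \<and> (\<forall>c\<in>\<C>. flat_piece (Suc k) S U A c) \<and>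
        A \<inter> W \<subseteq> \<Union> (piece_image ` \<C>)" if x: "x \<in> A - A0" for x
    proof -
      obtain h :: "'a \<Rightarrow> real" and b where h: "Ck_on (Suc k) U h" "\<forall>x\<in>A. h x = 0" and b: "b \<in> S"
        and nz: "frechet_derivative h (at x) b \<noteq> 0"
        using x unfolding A0_def by blast
      have xU: "x \<in> U" and bB: "b \<in> Basis" using x A b S by auto
      let ?\<Phi> = "\<lambda>x. x + (h x - x \<bullet> b) *\<^sub>R b"
      obtain U' V \<Psi> where U': "open U'" "U' \<subseteq> U" "x \<in> U'" and "open V"
        and hom: "homeomorphism U' V ?\<Phi> \<Psi>" and \<Psi>: "Ck_on (Suc k) V \<Psi>"
        by (rule replace_coordinate_chart[OF U h(1) xU bB nz])
      have \<Phi>\<Psi>: "\<Psi> y \<in> U'" "?\<Phi> (\<Psi> y) = y" if "y \<in> V" for y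
        using hom that unfolding homeomorphism_def by blast+
      have \<Psi>\<Phi>: "?\<Phi> z \<in> V" "\<Psi> (?\<Phi> z) = z" if "z \<in> U'" for z
        using hom that unfolding homeomorphism_def by blast+
      obtain r where r: "r > 0" "cball (?\<Phi> x) r \<subseteq> V"
        using \<open>open V\<close> \<Psi>\<Phi>(1)[OF U'(3)] open_contains_cball by blast
      define V' where "V' = ball (?\<Phi> x) r"
      have V': "open V'" "V' \<subseteq> V" using r unfolding V'_def by auto
      define W where "W = U' \<inter> ?\<Phi> -` V'"
      have "continuous_on U' ?\<Phi>" using hom unfolding homeomorphism_def by blast
      then have W: "open W" unfolding W_def
        by (rule continuous_open_preimage[OF _ U'(1) V'(1)])
      have xW: "x \<in> W" using U'(3) r(1) by (simp add: W_def V'_def)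
      define A1 where "A1 = ?\<Phi> ` (A \<inter> W)"
      have bb: "b \<bullet> b = 1" using bB by simp
      have "A1 \<subseteq> V' \<inter> coord_space (S - {b})"
      proof
        fix y assume "y \<in> A1"
        then obtain z where z: "z \<in> A" "z \<in> W" "y = ?\<Phi> z" unfolding A1_def by blast
        have "y \<bullet> c = 0" if c: "c \<in> Basis - (S - {b})" for c
        proof (cases "c = b")
          case True
          then show ?thesis using z h(2) bb by (simp add: inner_diff_left)
        next
          case False
          then have "z \<bullet> c = 0" "b \<bullet> c = 0"
            using c z(1) A bB by (auto simp: coord_space_def inner_Basis)
          then show ?thesis using z by (simp add: inner_add_left)
        qed
        then show "y \<in> V' \<inter> coord_space (S - {b})" using z by (auto simp: W_def coord_space_def)
      qed
      moreover have "card (S - {b}) < card S" by (rule card_Diff1_less[OF finS b])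
      moreover have "S - {b} \<subseteq> Basis" using S by blast
      ultimately obtain \<C>1 where \<C>1: "countable \<C>1" "\<And>c. c \<in> \<C>1 \<Longrightarrow> flat_piece (Suc k) (S - {b}) V' A1 c"
        "A1 \<subseteq> \<Union> (piece_image ` \<C>1)"
        using IHS[OF _ _ V'(1), of "S - {b}" A1] by blast
      define G where "G = (\<lambda>(T, D, \<psi>). (T :: 'a set, D :: 'a set, \<lambda>y::'a. \<Psi> (\<psi> y)))"
      have \<Psi>V': "Ck_on (Suc k) V' \<Psi>" by (rule Ck_on_subset[OF \<Psi> V'(2)])
      obtain B where B: "B > 0" "\<And>y v. y \<in> cball (?\<Phi> x) r \<Longrightarrow> norm (frechet_derivative \<Psi> (at y) v) \<le> B * norm v"
        using Ck_on_derivative_bounded[OF \<Psi> compact_cball r(2)] by blast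
      have bdd: "derivative_bounded_on V' \<Psi>"
        unfolding derivative_bounded_on_def
      proof (intro exI ballI conjI allI)
        fix z v assume z: "z \<in> V'"
        show "(\<Psi> has_derivative frechet_derivative \<Psi> (at z)) (at z)"
          by (rule Ck_on_has_derivative[OF \<Psi>V' z])
        show "norm (frechet_derivative \<Psi> (at z) v) \<le> B * norm v"
          using B(2) z by (auto simp: V'_def)
      qed
      have "flat_piece (Suc k) S U A (G c)" if "c \<in> \<C>1" for c
      proof -
        obtain T D \<psi> where cT: "c = (T, D, \<psi>)" by (cases c) auto
        have "flat_piece (Suc k) S U A (T, D, \<lambda>y. \<Psi> (\<psi> y))"
        proof (rule flat_piece_compose[OF _ V'(1) U \<Psi>V' _ bdd])
          show "flat_piece (Suc k) (S - {b}) V' A1 (T, D, \<psi>)" using \<C>1(2)[OF that] cT by simp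
          show "\<Psi> ` V' \<subseteq> U" using \<Phi>\<Psi>(1) V'(2) U'(2) by blast
          show "\<Psi> ` A1 \<subseteq> A" using \<Psi>\<Phi>(2) by (auto simp: A1_def W_def)
          show "\<Psi> ` (V' \<inter> coord_space (S - {b})) \<subseteq> coord_space S"
          proof
            fix z assume "z \<in> \<Psi> ` (V' \<inter> coord_space (S - {b}))"
            then obtain y where y: "y \<in> V'" "y \<in> coord_space (S - {b})" "z = \<Psi> y" by blast
            have yz: "?\<Phi> z = y" using \<Phi>\<Psi>(2) y V'(2) by blast
            have "z \<bullet> c = 0" if c: "c \<in> Basis - S" for c
            proof -
              have "b \<bullet> c = 0" using c b bB by (auto simp: inner_Basis)
              then have "z \<bullet> c = y \<bullet> c" using arg_cong[OF yz, of "\<lambda>w. w \<bullet> c"]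
                by (simp add: inner_add_left)
              then show ?thesis using y(2) c by (simp add: coord_space_def)
            qed
            then show "z \<in> coord_space S" by (simp add: coord_space_def)
          qed
        qed
        then show ?thesis by (simp add: G_def cT)
      qed
      moreover have "A \<inter> W \<subseteq> \<Union> (piece_image ` G ` \<C>1)"
      proof
        fix z assume z: "z \<in> A \<inter> W"
        then have "?\<Phi> z \<in> A1" by (auto simp: A1_def)
        then obtain c where c: "c \<in> \<C>1" "?\<Phi> z \<in> piece_image c" using \<C>1(3) by blast
        obtain T D \<psi> where cT: "c = (T, D, \<psi>)" by (cases c) auto
        obtain t where t: "t \<in> T" "?\<Phi> z = \<psi> t" using c(2) unfolding cT piece_image_def by auto
        have "z = \<Psi> (\<psi> t)" using \<Psi>\<Phi>(2)[of z] z t(2) by (simp add: W_def)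
        then have "z \<in> piece_image (G c)" using t(1) by (auto simp: piece_image_def G_def cT)
        then show "z \<in> \<Union> (piece_image ` G ` \<C>1)" using c(1) by blast
      qed
      ultimately show ?thesis using W xW \<C>1(1)
        by (intro exI[of _ W] exI[of _ "G ` \<C>1"]) auto
    qed
    then have "\<forall>x\<in>A - A0. \<exists>p. open (fst p) \<and> x \<in> fst p \<and> countable (snd p) \<and>
        (\<forall>c\<in>snd p. flat_piece (Suc k) S U A c) \<and> A \<inter> fst p \<subseteq> \<Union> (piece_image ` snd p)" by simp
    from bchoice[OF this] obtain p where p: "\<forall>x\<in>A - A0. open (fst (p x)) \<and> x \<in> fst (p x) \<and> countable (snd (p x)) \<and>
        (\<forall>c\<in>snd (p x). flat_piece (Suc k) S U A c) \<and> A \<inter> fst (p x) \<subseteq> \<Union> (piece_image ` snd (p x))" by blast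
    obtain X where X: "countable X" "X \<subseteq> A - A0" "A - A0 \<subseteq> (\<Union>x\<in>X. fst (p x))"
      by (rule countable_subcover[of "A - A0" "\<lambda>x. fst (p x)"]) (use p in auto)
    show ?case
    proof (intro exI conjI ballI)
      show "countable (\<C>0 \<union> (\<Union>x\<in>X. snd (p x)))" using \<C>0(1) X(1,2) p by (intro countable_Un countable_UN) auto
      show "flat_piece (Suc k) S U A c" if "c \<in> \<C>0 \<union> (\<Union>x\<in>X. snd (p x))" for c
        using that piece0 p X(2) by blast
      show "A \<subseteq> \<Union> (piece_image ` (\<C>0 \<union> (\<Union>x\<in>X. snd (p x))))"
      proof
        fix a assume a: "a \<in> A"
        show "a \<in> \<Union> (piece_image ` (\<C>0 \<union> (\<Union>x\<in>X. snd (p x))))"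
        proof (cases "a \<in> A0")
          case True
          then show ?thesis using \<C>0(3) by blast
        next
          case False
          then obtain x where "x \<in> X" "a \<in> fst (p x)" using X(3) a by blast
          then have "a \<in> \<Union> (piece_image ` snd (p x))" using p X(2) a by blast
          then show ?thesis using \<open>x \<in> X\<close> by blast
        qed
      qed
    qed
  qed
qed

theorem Morse_Sard:
  fixes g :: "'a::euclidean_space \<Rightarrow> real"
  assumes "open E" and g: "Ck_on DIM('a) E g"
  shows "negligible (g ` {x\<in>E. \<forall>b\<in>Basis. frechet_derivative g (at x) b = 0})"
proof -
  define A where "A = {x\<in>E. \<forall>b\<in>Basis. frechet_derivative g (at x) b = 0}"
  obtain k where k: "DIM('a) = Suc k" using DIM_positive[where 'a='a] gr0_conv_Suc by blast
  have "A \<subseteq> E \<inter> coord_space Basis" by (auto simp: A_def coord_space_def)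
  then obtain \<C> where \<C>: "countable \<C>" "\<And>c. c \<in> \<C> \<Longrightarrow> flat_piece k Basis E A c" "A \<subseteq> \<Union> (piece_image ` \<C>)"
    using flat_pieces[OF subset_refl \<open>open E\<close>, of A k] by blast
  have "negligible (g ` piece_image c)" if c: "c \<in> \<C>" for c
  proof -
    obtain T D \<psi> where cT: "c = (T, D, \<psi>)" by (cases c) auto
    have c': "T \<subseteq> D" "compact D" "convex D" "\<psi> ` D \<subseteq> E \<inter> coord_space Basis" "\<psi> ` T \<subseteq> A"
      "derivative_bounded_on D \<psi>"
      and flat: "\<And>h. Ck_on k E h \<Longrightarrow> \<forall>x\<in>A. h x = 0 \<Longrightarrow> flat_along k T D (\<lambda>y. h (\<psi> y))"
      using \<C>(2)[OF c] unfolding flat_piece_def cT by auto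
    have gk: "Ck_on (Suc k) E g" using g k by simp
    have "flat_along (Suc k) T D (\<lambda>y. g (\<psi> y))"
    proof (rule flat_along_Suc[OF c'(3,1,6,4) subset_refl Ck_on_has_derivative[OF gk]])
      show "frechet_derivative g (at (\<psi> x)) b = 0" if "b \<in> Basis" "x \<in> T" for b x
        using that c'(5) unfolding A_def by blast
      show "flat_along k T D (\<lambda>y. frechet_derivative g (at (\<psi> y)) b)" if "b \<in> Basis" for b
        by (rule flat[of "\<lambda>x. frechet_derivative g (at x) b"])
          (use Ck_on_partial[OF gk] that in \<open>auto simp: A_def\<close>)
    qed
    then have fl: "\<exists>\<delta>>0. \<forall>x\<in>T. \<forall>y\<in>D. norm (y - x) < \<delta> \<longrightarrow>
        \<bar>g (\<psi> y) - g (\<psi> x)\<bar> \<le> \<epsilon> * norm (y - x) ^ Suc k" if "\<epsilon> > 0" for \<epsilon>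
      using that unfolding flat_along_def by blast
    have "negligible ((\<lambda>y. g (\<psi> y)) ` T)"
    proof (rule negligible_image_of_flat)
      show "bounded T" by (rule bounded_subset[OF compact_imp_bounded[OF c'(2)] c'(1)])
      show "\<exists>\<delta>>0. \<forall>x\<in>T. \<forall>y\<in>T. norm (y - x) < \<delta> \<longrightarrow>
          \<bar>g (\<psi> y) - g (\<psi> x)\<bar> \<le> \<epsilon> * norm (y - x) ^ DIM('a)" if "\<epsilon> > 0" for \<epsilon>
        unfolding k using fl[OF that] c'(1) by (meson subsetD)
    qed
    then show ?thesis by (simp add: piece_image_def cT image_image)
  qed
  then have "negligible (\<Union>c\<in>\<C>. g ` piece_image c)"
    using \<C>(1) by (intro negligible_countable_Union) auto
  then show ?thesis
    by (rule negligible_subset) (use \<C>(3) in \<open>unfold A_def[symmetric], blast\<close>)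
qed

section \<open>Curvature of a graph\<close>

lemma DERIV_along_line:
  assumes "(f has_derivative f') (at (c + s *\<^sub>R a))"
  shows "((\<lambda>s. f (c + s *\<^sub>R a)) has_real_derivative f' a) (at s)"
proof -
  have "((\<lambda>s. c + s *\<^sub>R a) has_derivative (\<lambda>t. t *\<^sub>R a)) (at s)"
    by (auto intro!: derivative_eq_intros)
  then have "((\<lambda>s. f (c + s *\<^sub>R a)) has_derivative (\<lambda>t. f' (t *\<^sub>R a))) (at s)"
    by (rule has_derivative_compose) (rule assms)
  moreover have "linear f'" using assms by (rule has_derivative_linear)
  ultimately show ?thesis
    unfolding has_field_derivative_def by (simp add: linear_scale mult_commute_abs)
qed

lemma mixed_difference_quotient:
  fixes f :: "'a::euclidean_space \<Rightarrow> real"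
  assumes f: "Ck_on 2 S f" and ab: "a \<in> Basis" "b \<in> Basis" and "r > 0"
    and S: "\<And>s t. 0 \<le> s \<Longrightarrow> s \<le> r \<Longrightarrow> 0 \<le> t \<Longrightarrow> t \<le> r \<Longrightarrow> x + s *\<^sub>R a + t *\<^sub>R b \<in> S"
  obtains s t where "0 \<le> s" "s \<le> r" "0 \<le> t" "t \<le> r"
    "f (x + r *\<^sub>R a + r *\<^sub>R b) - f (x + r *\<^sub>R a) - f (x + r *\<^sub>R b) + f x =
     r\<^sup>2 * frechet_derivative (\<lambda>y. frechet_derivative f (at y) a) (at (x + s *\<^sub>R a + t *\<^sub>R b)) b"
proof -
  let ?D = "\<lambda>y. frechet_derivative f (at y)"
  have f2: "Ck_on (Suc (Suc 0)) S f" using f by (simp add: numeral_2_eq_2)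
  have f1: "Ck_on (Suc 0) S (\<lambda>y. ?D y a)" by (rule Ck_on_partial[OF f2 ab(1)])
  let ?g = "\<lambda>s. f ((x + r *\<^sub>R b) + s *\<^sub>R a) - f (x + s *\<^sub>R a)"
  have "\<exists>s. 0 < s \<and> s < r \<and> ?g r - ?g 0 = (r - 0) * (?D ((x + r *\<^sub>R b) + s *\<^sub>R a) a - ?D (x + s *\<^sub>R a) a)"
  proof (rule MVT2[OF \<open>r > 0\<close>])
    fix s assume s: "0 \<le> s" "s \<le> r"
    have "x + r *\<^sub>R b + s *\<^sub>R a \<in> S" "x + s *\<^sub>R a \<in> S"
      using S[OF s, of r] S[OF s, of 0] \<open>r > 0\<close> by (auto simp: add_ac)
    then show "(?g has_real_derivative ?D ((x + r *\<^sub>R b) + s *\<^sub>R a) a - ?D (x + s *\<^sub>R a) a) (at s)"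
      by (intro DERIV_diff DERIV_along_line Ck_on_has_derivative[OF f2])
  qed
  then obtain s where s: "0 < s" "s < r"
    and gs: "?g r - ?g 0 = r * (?D ((x + r *\<^sub>R b) + s *\<^sub>R a) a - ?D (x + s *\<^sub>R a) a)" by auto
  have "\<exists>t. 0 < t \<and> t < r \<and> ?D ((x + s *\<^sub>R a) + r *\<^sub>R b) a - ?D ((x + s *\<^sub>R a) + 0 *\<^sub>R b) a =
      (r - 0) * frechet_derivative (\<lambda>y. ?D y a) (at ((x + s *\<^sub>R a) + t *\<^sub>R b)) b"
  proof (rule MVT2[OF \<open>r > 0\<close>])
    fix t assume t: "0 \<le> t" "t \<le> r"
    have "x + s *\<^sub>R a + t *\<^sub>R b \<in> S" using S[of s t] s t by auto
    then show "((\<lambda>t. ?D ((x + s *\<^sub>R a) + t *\<^sub>R b) a) has_real_derivative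
        frechet_derivative (\<lambda>y. ?D y a) (at ((x + s *\<^sub>R a) + t *\<^sub>R b)) b) (at t)"
      by (intro DERIV_along_line[where f = "\<lambda>y. ?D y a"] Ck_on_has_derivative[OF f1])
  qed
  then obtain t where t: "0 < t" "t < r"
    and ts: "?D ((x + s *\<^sub>R a) + r *\<^sub>R b) a - ?D (x + s *\<^sub>R a) a =
      r * frechet_derivative (\<lambda>y. ?D y a) (at ((x + s *\<^sub>R a) + t *\<^sub>R b)) b" by auto
  have e: "x + r *\<^sub>R b + s *\<^sub>R a = x + s *\<^sub>R a + r *\<^sub>R b" for s by (simp add: add_ac)
  have "f (x + r *\<^sub>R a + r *\<^sub>R b) - f (x + r *\<^sub>R a) - f (x + r *\<^sub>R b) + f x =
     r * (r * frechet_derivative (\<lambda>y. ?D y a) (at (x + s *\<^sub>R a + t *\<^sub>R b)) b)"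
    using gs unfolding e ts by simp
  then show ?thesis using that[of s t] s t by (simp add: power2_eq_square)
qed

lemma mixed_partials_commute:
  fixes f :: "'a::euclidean_space \<Rightarrow> real"
  assumes f: "Ck_on 2 S f" and "open S" "x \<in> S" and ab: "a \<in> Basis" "b \<in> Basis"
  shows "frechet_derivative (\<lambda>y. frechet_derivative f (at y) a) (at x) b =
         frechet_derivative (\<lambda>y. frechet_derivative f (at y) b) (at x) a"
proof (rule ccontr)
  let ?p = "\<lambda>y. frechet_derivative (\<lambda>y. frechet_derivative f (at y) a) (at y) b"
  let ?q = "\<lambda>y. frechet_derivative (\<lambda>y. frechet_derivative f (at y) b) (at y) a"
  assume ne: "?p x \<noteq> ?q x"
  have f2: "Ck_on (Suc (Suc 0)) S f" using f by (simp add: numeral_2_eq_2)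
  have "continuous_on S ?p" "continuous_on S ?q"
    by (rule Ck_on_continuous[OF Ck_on_partial[OF Ck_on_partial[OF f2 ab(1)] ab(2)]])
       (rule Ck_on_continuous[OF Ck_on_partial[OF Ck_on_partial[OF f2 ab(2)] ab(1)]])
  then have c: "continuous (at x) ?p" "continuous (at x) ?q"
    using \<open>open S\<close> \<open>x \<in> S\<close> by (simp_all add: continuous_on_eq_continuous_at)
  define e where "e = \<bar>?p x - ?q x\<bar> / 2"
  have "e > 0" using ne by (simp add: e_def)
  obtain d1 where d1: "d1 > 0" "\<And>y. dist y x < d1 \<Longrightarrow> dist (?p y) (?p x) < e"
    using c(1) \<open>e > 0\<close> unfolding continuous_at_eps_delta by blast
  obtain d2 where d2: "d2 > 0" "\<And>y. dist y x < d2 \<Longrightarrow> dist (?q y) (?q x) < e"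
    using c(2) \<open>e > 0\<close> unfolding continuous_at_eps_delta by blast
  obtain d3 where d3: "d3 > 0" "ball x d3 \<subseteq> S" using \<open>open S\<close> \<open>x \<in> S\<close> open_contains_ball by blast
  define r where "r = min d1 (min d2 d3) / 3"
  have r: "r > 0" "2 * r < d1" "2 * r < d2" "2 * r < d3" using d1 d2 d3 by (auto simp: r_def min_def)
  have near: "dist (x + s *\<^sub>R u + t *\<^sub>R v) x \<le> 2 * r"
    if "0 \<le> s" "s \<le> r" "0 \<le> t" "t \<le> r" "u \<in> Basis" "v \<in> Basis" for s t and u v :: 'a
  proof -
    have "dist (x + s *\<^sub>R u + t *\<^sub>R v) x = norm (s *\<^sub>R u + t *\<^sub>R v)" by (simp add: dist_norm add.assoc)
    also have "\<dots> \<le> norm (s *\<^sub>R u) + norm (t *\<^sub>R v)" by (rule norm_triangle_ineq)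
    also have "\<dots> = s + t" using that by simp
    finally show ?thesis using that by linarith
  qed
  have inS: "x + s *\<^sub>R u + t *\<^sub>R v \<in> S"
    if "0 \<le> s" "s \<le> r" "0 \<le> t" "t \<le> r" "u \<in> Basis" "v \<in> Basis" for s t and u v :: 'a
    using near[OF that] r d3(2) by (auto simp: dist_commute)
  obtain s t where st: "0 \<le> s" "s \<le> r" "0 \<le> t" "t \<le> r" and p:
    "f (x + r *\<^sub>R a + r *\<^sub>R b) - f (x + r *\<^sub>R a) - f (x + r *\<^sub>R b) + f x = r\<^sup>2 * ?p (x + s *\<^sub>R a + t *\<^sub>R b)"
    using mixed_difference_quotient[OF f ab r(1) inS[OF _ _ _ _ ab]] by blast
  obtain s' t' where st': "0 \<le> s'" "s' \<le> r" "0 \<le> t'" "t' \<le> r" and q: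
    "f (x + r *\<^sub>R b + r *\<^sub>R a) - f (x + r *\<^sub>R b) - f (x + r *\<^sub>R a) + f x = r\<^sup>2 * ?q (x + s' *\<^sub>R b + t' *\<^sub>R a)"
    using mixed_difference_quotient[OF f ab(2,1) r(1) inS[OF _ _ _ _ ab(2,1)]] by blast
  have "x + r *\<^sub>R b + r *\<^sub>R a = x + r *\<^sub>R a + r *\<^sub>R b" by (simp add: add_ac)
  then have "r\<^sup>2 * ?p (x + s *\<^sub>R a + t *\<^sub>R b) = r\<^sup>2 * ?q (x + s' *\<^sub>R b + t' *\<^sub>R a)"
    using p q by (simp only:)
  then have "?p (x + s *\<^sub>R a + t *\<^sub>R b) = ?q (x + s' *\<^sub>R b + t' *\<^sub>R a)" using r(1) by simp
  moreover have "dist (?p (x + s *\<^sub>R a + t *\<^sub>R b)) (?p x) < e" using near[OF st ab] r by (intro d1) auto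
  moreover have "dist (?q (x + s' *\<^sub>R b + t' *\<^sub>R a)) (?q x) < e" using near[OF st' ab(2,1)] r by (intro d2) auto
  moreover have "u = v \<Longrightarrow> dist u c < e \<Longrightarrow> dist v d < e \<Longrightarrow> \<bar>c - d\<bar> < 2 * e" for u v c d :: real
    unfolding dist_real_def by linarith
  ultimately have "\<bar>?p x - ?q x\<bar> < 2 * e" by blast
  then show False by (simp add: e_def)
qed

lemma axis_Basis: "axis i (1::real) \<in> Basis"
  by (simp add: axis_in_Basis_iff)

lemma Ck_on_pd: "Ck_on (Suc k) S f \<Longrightarrow> Ck_on k S (pd i f)"
  using Ck_on_partial[OF _ axis_Basis, of k S f i] by (simp add: pd_def[abs_def])

lemma pd_commute:
  assumes "Ck_on 2 S f" "open S" "x \<in> S"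
  shows "pd i (pd j f) x = pd j (pd i f) x"
  using mixed_partials_commute[OF assms axis_Basis axis_Basis, of j i] by (simp add: pd_def[abs_def])

lemma pd_eq: "(f has_derivative f') (at x) \<Longrightarrow> pd i f x = f' (axis i 1)"
  by (simp add: pd_def frechet_derivative_eq)

lemma pd_cong_open:
  assumes "open S" "x \<in> S" "\<And>y. y \<in> S \<Longrightarrow> f y = g y" "f differentiable at x"
  shows "pd i f x = pd i g x"
  using frechet_derivative_transform_within_open[OF assms(4,1,2,3)] by (simp add: pd_def)

lemma has_derivative_pd:
  assumes "f differentiable at x"
  shows "(f has_derivative (\<lambda>u. \<Sum>i\<in>UNIV. u $ i * pd i f x)) (at x)"
proof -
  have d: "(f has_derivative frechet_derivative f (at x)) (at x)"
    using assms frechet_derivative_works by blast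
  then have l: "linear (frechet_derivative f (at x))" by (rule has_derivative_linear)
  have "frechet_derivative f (at x) u = (\<Sum>i\<in>UNIV. u $ i * pd i f x)" for u
  proof -
    have "u = (\<Sum>i\<in>UNIV. u $ i *\<^sub>R axis i 1)" by (simp add: vec_eq_iff axis_def if_distrib cong: if_cong)
    then have "frechet_derivative f (at x) u = frechet_derivative f (at x) (\<Sum>i\<in>UNIV. u $ i *\<^sub>R axis i 1)" by simp
    then show ?thesis using l by (simp add: linear_sum linear_scale pd_def)
  qed
  then have "frechet_derivative f (at x) = (\<lambda>u. \<Sum>i\<in>UNIV. u $ i * pd i f x)" by blast
  then show ?thesis using d by simp
qed

lemma has_derivative_grad:
  assumes "f differentiable at x"
  shows "(f has_derivative (\<lambda>u. grad f x \<bullet> u)) (at x)"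
  using has_derivative_pd[OF assms] by (simp add: grad_def inner_vec_def mult.commute)

definition graph_W :: "(real^'n::finite \<Rightarrow> real) \<Rightarrow> real^'n \<Rightarrow> real" where
  "graph_W f x = 1 + (\<Sum>i\<in>UNIV. (pd i f x)\<^sup>2)"

lemma graph_W_eq: "graph_W f x = 1 + (norm (grad f x))\<^sup>2"
  by (simp add: graph_W_def grad_def norm_vec_def L2_set_def sum_nonneg)

lemma graph_W_ge_1: "graph_W f x \<ge> 1"
  by (simp add: graph_W_def sum_nonneg)

lemma matrix_inv_graph_metric:
  "matrix_inv (graph_metric f x) = (\<chi> i j. (if i = j then 1 else 0) - pd i f x * pd j f x / graph_W f x)"
    (is "_ = ?B")
proof -
  let ?v = "\<lambda>i. pd i f x" and ?W = "graph_W f x" and ?A = "graph_metric f x"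
  have W: "?W \<noteq> 0" using graph_W_ge_1[of f x] by linarith
  have s: "(\<Sum>k\<in>UNIV. ?v k * ?v k) = ?W - 1" by (simp add: graph_W_def power2_eq_square)
  have "(\<Sum>k\<in>UNIV. ?A $ i $ k * ?B $ k $ j) = (if i = j then 1 else 0)" for i j
  proof -
    have "(\<Sum>k\<in>UNIV. ?A $ i $ k * ?B $ k $ j) =
      (\<Sum>k\<in>UNIV. (if i = k then (if k = j then 1 else 0) else 0) - (if i = k then ?v k * ?v j / ?W else 0)
        + (if k = j then ?v i * ?v k else 0) - (?v i * ?v j / ?W) * (?v k * ?v k))"
      by (rule sum.cong) (auto simp: graph_metric_def algebra_simps)
    also have "\<dots> = (if i = j then 1 else 0) - ?v i * ?v j / ?W + ?v i * ?v j - (?v i * ?v j / ?W) * (?W - 1)"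
      by (simp only: sum.distrib sum_subtractf sum_distrib_left[symmetric] s) simp
    also have "\<dots> = (if i = j then 1 else 0)" using W by (simp add: field_simps)
    finally show ?thesis .
  qed
  then have AB: "?A ** ?B = mat 1"
    by (simp add: matrix_matrix_mult_def mat_def vec_eq_iff)
  then have BA: "?B ** ?A = mat 1" using matrix_left_right_inverse by blast
  have "matrix_inv ?A = matrix_inv ?A ** (?A ** ?B)" by (simp add: AB)
  also have "\<dots> = (matrix_inv ?A ** ?A) ** ?B" by (simp only: matrix_mul_assoc)
  also have "matrix_inv ?A ** ?A = mat 1"
    using someI_ex[of "\<lambda>B. ?A ** B = mat 1 \<and> B ** ?A = mat 1"] AB BA
    unfolding matrix_inv_def by blast
  finally show ?thesis by simp
qed

lemma pd_add: "f differentiable at x \<Longrightarrow> g differentiable at x \<Longrightarrow>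
    pd i (\<lambda>y. f y + g y) x = pd i f x + pd i g x"
  unfolding frechet_derivative_works using pd_eq[OF has_derivative_add] by (simp add: pd_def)

lemma pd_mult:
  fixes f g :: "real^'n::finite \<Rightarrow> real"
  assumes "f differentiable at x" "g differentiable at x"
  shows "pd i (\<lambda>y. f y * g y) x = pd i f x * g x + f x * pd i g x"
  using pd_eq[OF has_derivative_mult[OF assms[unfolded frechet_derivative_works]], of i]
  by (simp add: pd_def add.commute)

lemma pd_const [simp]: "pd i (\<lambda>y. c) x = 0"
  by (simp add: pd_def)

lemma pd_sum:
  fixes f :: "'a \<Rightarrow> real^'n::finite \<Rightarrow> real"
  assumes "\<And>a. a \<in> A \<Longrightarrow> f a differentiable at x"
  shows "pd i (\<lambda>y. \<Sum>a\<in>A. f a y) x = (\<Sum>a\<in>A. pd i (f a) x)"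
proof -
  have "((\<lambda>y. \<Sum>a\<in>A. f a y) has_derivative (\<lambda>v. \<Sum>a\<in>A. frechet_derivative (f a) (at x) v)) (at x)"
    using assms by (intro has_derivative_sum) (simp add: frechet_derivative_works)
  from pd_eq[OF this] show ?thesis by (simp add: pd_def)
qed

lemma pd_inverse:
  fixes f :: "real^'n::finite \<Rightarrow> real"
  assumes "f differentiable at x" "f x \<noteq> 0"
  shows "pd i (\<lambda>y. inverse (f y)) x = - pd i f x / (f x)\<^sup>2"
  using pd_eq[OF Deriv.has_derivative_inverse[OF assms(2) assms(1)[unfolded frechet_derivative_works]], of i]
  by (simp add: pd_def power2_eq_square divide_inverse mult_ac)

lemma differentiable_Ck: "Ck_on (Suc k) S f \<Longrightarrow> x \<in> S \<Longrightarrow> f differentiable at x"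
  using Ck_on_has_derivative differentiableI by blast

context
  fixes f :: "real^'n::finite \<Rightarrow> real" and S
  assumes f: "Ck_on 3 S f" and S: "open S"
begin

private lemma f': "Ck_on (Suc (Suc (Suc 0))) S f" "Ck_on 2 S f" "Ck_on 2 S (pd i f)"
proof -
  show 3: "Ck_on (Suc (Suc (Suc 0))) S f" using f by (simp add: numeral_3_eq_3)
  show "Ck_on 2 S f" using f by (rule Ck_on_le) simp
  show "Ck_on 2 S (pd i f)" using Ck_on_pd[OF 3] by (simp add: numeral_2_eq_2)
qed

private lemma diff_pd: "x \<in> S \<Longrightarrow> pd i f differentiable at x"
  using differentiable_Ck[OF Ck_on_pd[OF f'(1)]] .

private lemma diff_pd_pd: "x \<in> S \<Longrightarrow> pd j (pd i f) differentiable at x"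
  using differentiable_Ck[OF Ck_on_pd[OF Ck_on_pd[OF f'(1)]]] .

private lemma graph_W_mult: "graph_W f = (\<lambda>y. 1 + (\<Sum>l\<in>UNIV. pd l f y * pd l f y))"
  by (simp add: graph_W_def fun_eq_iff power2_eq_square)

private lemma diff_W: "x \<in> S \<Longrightarrow> graph_W f differentiable at x"
  unfolding graph_W_mult
  by (intro differentiable_add differentiable_const differentiable_sum differentiable_mult diff_pd ballI)
     auto

private lemma pd_W: "x \<in> S \<Longrightarrow> pd i (graph_W f) x = 2 * (\<Sum>l\<in>UNIV. pd l f x * pd i (pd l f) x)"
  unfolding graph_W_mult
  by (subst pd_add)
    (auto intro!: differentiable_add differentiable_const differentiable_sum differentiable_mult diff_pd
      simp: pd_sum pd_mult diff_pd sum.distrib sum_distrib_left mult.commute)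

private lemma hess_sym: "x \<in> S \<Longrightarrow> pd i (pd j f) x = pd j (pd i f) x"
  using pd_commute[OF f'(2) S] .

private lemma third_sym: "x \<in> S \<Longrightarrow> pd i (pd j (pd k f)) x = pd j (pd i (pd k f)) x"
  using pd_commute[OF f'(3) S] .

private lemma christoffel_graph:
  assumes x: "x \<in> S"
  shows "christoffel (graph_metric f) k i j x = pd k f x * pd j (pd i f) x * inverse (graph_W f x)"
proof -
  let ?v = "\<lambda>i. pd i f x" and ?h = "\<lambda>i j. pd j (pd i f) x" and ?W = "graph_W f x"
  have W: "?W \<noteq> 0" using graph_W_ge_1[of f x] by linarith
  have g: "pd i (\<lambda>y. graph_metric f y $ j $ l) x = ?h j i * ?v l + ?v j * ?h l i" for i j l
    unfolding graph_metric_def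
    by (simp, subst pd_add) (auto simp: pd_mult diff_pd x intro!: differentiable_mult)
  have e: "pd i (\<lambda>y. graph_metric f y $ j $ l) x + pd j (\<lambda>y. graph_metric f y $ i $ l) x
      - pd l (\<lambda>y. graph_metric f y $ i $ j) x = 2 * (?h i j * ?v l)" for l
    unfolding g using hess_sym[OF x, of i j] hess_sym[OF x, of i l] hess_sym[OF x, of j l]
    by (simp add: algebra_simps)
  have s: "(\<Sum>l\<in>UNIV. ?v l * ?v l) = ?W - 1" by (simp add: graph_W_def power2_eq_square)
  have "christoffel (graph_metric f) k i j x =
      (\<Sum>l\<in>UNIV. ((if k = l then 1 else 0) - ?v k * ?v l / ?W) * (2 * (?h i j * ?v l))) / 2"
    unfolding christoffel_def e by (simp add: matrix_inv_graph_metric)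
  also have "(\<Sum>l\<in>UNIV. ((if k = l then 1 else 0) - ?v k * ?v l / ?W) * (2 * (?h i j * ?v l))) =
      (\<Sum>l\<in>UNIV. (if k = l then 2 * ?h i j * ?v l else 0) - (2 * ?h i j * ?v k / ?W) * (?v l * ?v l))"
    by (rule sum.cong) (auto simp: algebra_simps)
  also have "\<dots> = 2 * ?h i j * ?v k - (2 * ?h i j * ?v k / ?W) * (?W - 1)"
    by (simp only: sum_subtractf sum_distrib_left[symmetric] s) simp
  also have "\<dots> / 2 = ?v k * ?h i j * inverse ?W" using W by (simp add: field_simps)
  finally show ?thesis .
qed

private lemma pd_christoffel_graph:
  assumes x: "x \<in> S"
  shows "pd m (christoffel (graph_metric f) k i j) x =
    (pd m (pd k f) x * pd j (pd i f) x + pd k f x * pd m (pd j (pd i f)) x) * inverse (graph_W f x)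
    - 2 * pd k f x * pd j (pd i f) x * (\<Sum>l\<in>UNIV. pd l f x * pd m (pd l f) x) / (graph_W f x)\<^sup>2"
proof -
  have W: "graph_W f y \<noteq> 0" for y using graph_W_ge_1[of f y] by linarith
  let ?c = "\<lambda>y. pd k f y * pd j (pd i f) y * inverse (graph_W f y)"
  have d: "(\<lambda>y. pd k f y * pd j (pd i f) y) differentiable at x"
    by (intro differentiable_mult diff_pd diff_pd_pd x)
  have di: "(\<lambda>y. inverse (graph_W f y)) differentiable at x"
    using diff_W[OF x] W by (intro differentiable_inverse) auto
  have "pd m (christoffel (graph_metric f) k i j) x = pd m ?c x"
    by (rule pd_cong_open[OF S x, symmetric])
      (simp_all add: christoffel_graph differentiable_mult[OF d di])
  also have "\<dots> = (pd m (pd k f) x * pd j (pd i f) x + pd k f x * pd m (pd j (pd i f)) x) * inverse (graph_W f x)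
    + pd k f x * pd j (pd i f) x * (- pd m (graph_W f) x / (graph_W f x)\<^sup>2)"
    by (simp only: pd_mult[OF d di] pd_mult[OF diff_pd[OF x] diff_pd_pd[OF x]] pd_inverse[OF diff_W[OF x] W])
  finally show ?thesis by (simp add: pd_W[OF x])
qed

private lemma ricci_graph:
  fixes v q and h :: "'n \<Rightarrow> 'n \<Rightarrow> real"
  assumes x: "x \<in> S"
  defines "v \<equiv> \<lambda>i. pd i f x" and "h \<equiv> \<lambda>i j. pd j (pd i f) x"
  defines "q \<equiv> \<lambda>i. \<Sum>j\<in>UNIV. h i j * v j"
  shows "ricci_curvature (graph_metric f) i j x =
    ((\<Sum>k\<in>UNIV. h k k) * h i j - (\<Sum>k\<in>UNIV. h k i * h k j)) / graph_W f x
    - (h i j * (\<Sum>k\<in>UNIV. v k * q k) - q i * q j) / (graph_W f x)\<^sup>2"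
proof -
  define W where "W = graph_W f x"
  have W: "W \<noteq> 0" using graph_W_ge_1[of f x] unfolding W_def by linarith
  have sym: "h i j = h j i" for i j unfolding h_def by (rule hess_sym[OF x])
  have qs: "(\<Sum>l\<in>UNIV. v l * pd m (pd l f) x) = q m" for m
    unfolding q_def by (rule sum.cong) (auto simp: h_def hess_sym[OF x, of m])
  have G: "christoffel (graph_metric f) k i j x = v k * h i j / W" for k i j
    by (simp add: christoffel_graph[OF x] v_def h_def W_def divide_inverse)
  have dG: "pd m (christoffel (graph_metric f) k i j) x =
     (h k m * h i j + v k * pd m (pd j (pd i f)) x) / W - 2 * v k * h i j * q m / W\<^sup>2" for m k i j
    unfolding pd_christoffel_graph[OF x] qs[unfolded v_def] by (simp add: v_def h_def W_def divide_inverse)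
  have quad: "(\<Sum>l\<in>UNIV. christoffel (graph_metric f) k k l x * christoffel (graph_metric f) l i j x
       - christoffel (graph_metric f) k j l x * christoffel (graph_metric f) l i k x)
     = (v k * q k * h i j - v k * q j * h i k) / W\<^sup>2" for k
  proof -
    have "(\<Sum>l\<in>UNIV. christoffel (graph_metric f) k k l x * christoffel (graph_metric f) l i j x
       - christoffel (graph_metric f) k j l x * christoffel (graph_metric f) l i k x)
      = (\<Sum>l\<in>UNIV. (v k * h i j / W\<^sup>2) * (h k l * v l) - (v k * h i k / W\<^sup>2) * (h j l * v l))"
      unfolding G by (rule sum.cong) (auto simp: power2_eq_square mult_ac)
    also have "\<dots> = (v k * h i j / W\<^sup>2) * q k - (v k * h i k / W\<^sup>2) * q j"
      by (simp only: sum_subtractf sum_distrib_left[symmetric] q_def)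
    finally show ?thesis by (simp add: diff_divide_distrib mult_ac)
  qed
  have t: "pd k (pd j (pd i f)) x = pd j (pd k (pd i f)) x" for k by (rule third_sym[OF x])
  have "ricci_curvature (graph_metric f) i j x =
    (\<Sum>k\<in>UNIV. (h k k * h i j - h k i * h k j) / W - (h i j * (v k * q k) - (v k * h i k) * q j) / W\<^sup>2)"
    unfolding ricci_curvature_def quad dG
    by (rule sum.cong) (use W in \<open>simp_all add: t sym[of _ i] field_simps power2_eq_square\<close>)
  also have "\<dots> = ((\<Sum>k\<in>UNIV. h k k) * h i j - (\<Sum>k\<in>UNIV. h k i * h k j)) / W
    - (h i j * (\<Sum>k\<in>UNIV. v k * q k) - (\<Sum>k\<in>UNIV. v k * h i k) * q j) / W\<^sup>2"
    by (simp only: sum_subtractf sum_divide_distrib[symmetric] sum_distrib_left[symmetric] sum_distrib_right[symmetric])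
  also have "(\<Sum>k\<in>UNIV. v k * h i k) = q i" by (simp add: q_def mult.commute)
  finally show ?thesis by (simp add: W_def)
qed

lemma graph_scalar_curvature_eq:
  fixes v q and h :: "'n \<Rightarrow> 'n \<Rightarrow> real"
  assumes x: "x \<in> S"
  defines "v \<equiv> \<lambda>i. pd i f x" and "h \<equiv> \<lambda>i j. pd j (pd i f) x"
  defines "q \<equiv> \<lambda>i. \<Sum>j\<in>UNIV. h i j * v j"
  shows "graph_scalar_curvature f x =
    ((\<Sum>k\<in>UNIV. h k k)\<^sup>2 - (\<Sum>i\<in>UNIV. \<Sum>j\<in>UNIV. (h i j)\<^sup>2)) / graph_W f x
    - 2 * ((\<Sum>k\<in>UNIV. h k k) * (\<Sum>k\<in>UNIV. v k * q k) - (\<Sum>k\<in>UNIV. (q k)\<^sup>2)) / (graph_W f x)\<^sup>2"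
proof -
  define W where "W = graph_W f x"
  have W: "W \<noteq> 0" using graph_W_ge_1[of f x] unfolding W_def by linarith
  define T where "T = (\<Sum>k\<in>UNIV. h k k)"
  define s where "s = (\<Sum>k\<in>UNIV. v k * q k)"
  define Q where "Q = (\<Sum>k\<in>UNIV. (q k)\<^sup>2)"
  define F where "F = (\<Sum>i\<in>UNIV. \<Sum>j\<in>UNIV. (h i j)\<^sup>2)"
  define R where "R i j = (T * h i j - (\<Sum>k\<in>UNIV. h k i * h k j)) / W - (h i j * s - q i * q j) / W\<^sup>2" for i j
  have ric: "ricci_curvature (graph_metric f) i j x = R i j" for i j
    unfolding R_def T_def s_def W_def using ricci_graph[OF x] unfolding v_def h_def q_def by blast
  have tr: "(\<Sum>i\<in>UNIV. R i i) = (T * T - F) / W - (T * s - Q) / W\<^sup>2"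
  proof -
    have "(\<Sum>i\<in>UNIV. \<Sum>k\<in>UNIV. h k i * h k i) = F"
      unfolding F_def by (subst sum.swap) (simp add: power2_eq_square)
    then show ?thesis
      unfolding R_def T_def Q_def
      by (simp add: sum_subtractf sum_divide_distrib[symmetric] sum_distrib_left[symmetric]
        sum_distrib_right[symmetric] power2_eq_square)
  qed
  have hv: "(\<Sum>i\<in>UNIV. \<Sum>j\<in>UNIV. v i * v j * h i j) = s"
    by (simp add: s_def q_def sum_distrib_left mult_ac)
  have hhv: "(\<Sum>i\<in>UNIV. \<Sum>j\<in>UNIV. v i * v j * (\<Sum>k\<in>UNIV. h k i * h k j)) = Q"
  proof -
    have "Q = (\<Sum>k\<in>UNIV. \<Sum>i\<in>UNIV. \<Sum>j\<in>UNIV. (h k i * v i) * (h k j * v j))"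
      by (simp add: Q_def q_def power2_eq_square sum_product)
    also have "\<dots> = (\<Sum>i\<in>UNIV. \<Sum>k\<in>UNIV. \<Sum>j\<in>UNIV. (h k i * v i) * (h k j * v j))"
      by (rule sum.swap)
    also have "\<dots> = (\<Sum>i\<in>UNIV. \<Sum>j\<in>UNIV. \<Sum>k\<in>UNIV. (h k i * v i) * (h k j * v j))"
      by (rule sum.cong[OF refl], rule sum.swap)
    finally show ?thesis by (simp add: sum_distrib_left mult_ac)
  qed
  have qv: "(\<Sum>i\<in>UNIV. \<Sum>j\<in>UNIV. v i * v j * (q i * q j)) = s * s"
    by (simp add: s_def sum_product mult_ac)
  have vv: "(\<Sum>i\<in>UNIV. \<Sum>j\<in>UNIV. v i * v j * R i j) = (T * s - Q) / W - (s * s - s * s) / W\<^sup>2"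
  proof -
    have "(\<Sum>i\<in>UNIV. \<Sum>j\<in>UNIV. v i * v j * R i j) = (\<Sum>i\<in>UNIV. \<Sum>j\<in>UNIV.
        (T * (v i * v j * h i j) - v i * v j * (\<Sum>k\<in>UNIV. h k i * h k j)) / W
        - (s * (v i * v j * h i j) - v i * v j * (q i * q j)) / W\<^sup>2)"
      unfolding R_def by (intro sum.cong refl) (use W in \<open>simp add: field_simps\<close>)
    also have "\<dots> = (T * s - Q) / W - (s * s - s * s) / W\<^sup>2"
      by (simp only: sum_subtractf sum_divide_distrib[symmetric] sum_distrib_left[symmetric] hv hhv qv)
    finally show ?thesis .
  qed
  have "graph_scalar_curvature f x = (\<Sum>i\<in>UNIV. \<Sum>j\<in>UNIV. ((if i = j then 1 else 0) - v i * v j / W) * R i j)"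
    by (simp add: graph_scalar_curvature_def scalar_curvature_def matrix_inv_graph_metric ric v_def W_def)
  also have "\<dots> = (\<Sum>i\<in>UNIV. \<Sum>j\<in>UNIV. (if i = j then R i j else 0) - v i * v j * R i j / W)"
    by (intro sum.cong refl) (auto simp: algebra_simps)
  also have "\<dots> = (\<Sum>i\<in>UNIV. R i i) - (\<Sum>i\<in>UNIV. \<Sum>j\<in>UNIV. v i * v j * R i j) / W"
    by (simp add: sum_subtractf sum_divide_distrib[symmetric])
  also have "\<dots> = (T\<^sup>2 - F) / W - 2 * (T * s - Q) / W\<^sup>2"
    unfolding tr vv using W by (simp add: field_simps power2_eq_square)
  finally show ?thesis unfolding T_def F_def W_def s_def Q_def .
qed

end

lemma norm_projected_hessian:
  fixes v :: "'n::finite \<Rightarrow> real" and h :: "'n \<Rightarrow> 'n \<Rightarrow> real"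
  assumes sym: "\<And>i j. h i j = h j i"
  defines "q \<equiv> \<lambda>i. \<Sum>j\<in>UNIV. h i j * v j"
  defines "m \<equiv> \<Sum>i\<in>UNIV. (v i)\<^sup>2" and "s \<equiv> \<Sum>i\<in>UNIV. v i * q i"
  shows "(\<Sum>i\<in>UNIV. \<Sum>j\<in>UNIV. (h i j - \<kappa> * v i * q j - \<kappa> * q i * v j + \<kappa>\<^sup>2 * s * v i * v j)\<^sup>2) =
    (\<Sum>i\<in>UNIV. \<Sum>j\<in>UNIV. (h i j)\<^sup>2) - 2 * (2 * \<kappa> - \<kappa>\<^sup>2 * m) * (\<Sum>i\<in>UNIV. (q i)\<^sup>2)
      + (2 * \<kappa> - \<kappa>\<^sup>2 * m)\<^sup>2 * s\<^sup>2"
proof -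
  define Q where "Q = (\<Sum>i\<in>UNIV. (q i)\<^sup>2)"
  have dd: "(\<Sum>i\<in>UNIV. \<Sum>j\<in>UNIV. c * a i j) = c * (\<Sum>i\<in>UNIV. \<Sum>j\<in>UNIV. a i j)"
    for c and a :: "'n \<Rightarrow> 'n \<Rightarrow> real"
    by (simp add: sum_distrib_left)
  have s1: "(\<Sum>i\<in>UNIV. \<Sum>j\<in>UNIV. (v i)\<^sup>2 * (q j)\<^sup>2) = m * Q"
    by (simp add: m_def Q_def sum_product)
  have s2: "(\<Sum>i\<in>UNIV. \<Sum>j\<in>UNIV. (q i)\<^sup>2 * (v j)\<^sup>2) = m * Q"
    by (simp add: m_def Q_def sum_product[symmetric])
  have s3: "(\<Sum>i\<in>UNIV. \<Sum>j\<in>UNIV. (v i * q i) * (v j * q j)) = s * s"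
    unfolding s_def sum_product ..
  have s4: "(\<Sum>i\<in>UNIV. \<Sum>j\<in>UNIV. (v i)\<^sup>2 * (v j)\<^sup>2) = m * m"
    unfolding m_def sum_product ..
  have s5: "(\<Sum>i\<in>UNIV. \<Sum>j\<in>UNIV. h i j * (q i * v j)) = Q"
    unfolding Q_def power2_eq_square by (rule sum.cong) (auto simp: q_def sum_distrib_left mult_ac)
  have s6: "(\<Sum>i\<in>UNIV. \<Sum>j\<in>UNIV. h i j * (v i * q j)) = Q"
    unfolding s5[symmetric] by (subst sum.swap, intro sum.cong refl) (simp add: sym mult.commute)
  have s7: "(\<Sum>i\<in>UNIV. \<Sum>j\<in>UNIV. h i j * (v i * v j)) = s"
    unfolding s_def by (rule sum.cong) (auto simp: q_def sum_distrib_left mult_ac)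
  have s8: "(\<Sum>i\<in>UNIV. \<Sum>j\<in>UNIV. (v i)\<^sup>2 * (v j * q j)) = m * s"
    unfolding m_def s_def sum_product ..
  have s9: "(\<Sum>i\<in>UNIV. \<Sum>j\<in>UNIV. (v i * q i) * (v j)\<^sup>2) = s * m"
    unfolding m_def s_def sum_product ..
  have "(\<Sum>i\<in>UNIV. \<Sum>j\<in>UNIV. (h i j - \<kappa> * v i * q j - \<kappa> * q i * v j + \<kappa>\<^sup>2 * s * v i * v j)\<^sup>2) =
    (\<Sum>i\<in>UNIV. \<Sum>j\<in>UNIV. (h i j)\<^sup>2 + \<kappa>\<^sup>2 * ((v i)\<^sup>2 * (q j)\<^sup>2) + \<kappa>\<^sup>2 * ((q i)\<^sup>2 * (v j)\<^sup>2)
      + 2 * \<kappa>\<^sup>2 * ((v i * q i) * (v j * q j)) + \<kappa>^4 * s\<^sup>2 * ((v i)\<^sup>2 * (v j)\<^sup>2)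
      - 2 * \<kappa> * (h i j * (v i * q j)) - 2 * \<kappa> * (h i j * (q i * v j)) + 2 * \<kappa>\<^sup>2 * s * (h i j * (v i * v j))
      - 2 * \<kappa>^3 * s * ((v i)\<^sup>2 * (v j * q j)) - 2 * \<kappa>^3 * s * ((v i * q i) * (v j)\<^sup>2))"
    by (intro sum.cong refl) (simp add: power2_eq_square power3_eq_cube power4_eq_xxxx algebra_simps)
  also have "\<dots> = (\<Sum>i\<in>UNIV. \<Sum>j\<in>UNIV. (h i j)\<^sup>2) + \<kappa>\<^sup>2 * (m * Q) + \<kappa>\<^sup>2 * (m * Q)
      + 2 * \<kappa>\<^sup>2 * (s * s) + \<kappa>^4 * s\<^sup>2 * (m * m)
      - 2 * \<kappa> * Q - 2 * \<kappa> * Q + 2 * \<kappa>\<^sup>2 * s * s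
      - 2 * \<kappa>^3 * s * (m * s) - 2 * \<kappa>^3 * s * (s * m)"
    by (simp only: sum.distrib sum_subtractf dd s1 s2 s3 s4 s5 s6 s7 s8 s9)
  also have "\<dots> = (\<Sum>i\<in>UNIV. \<Sum>j\<in>UNIV. (h i j)\<^sup>2) - 2 * (2 * \<kappa> - \<kappa>\<^sup>2 * m) * Q
      + (2 * \<kappa> - \<kappa>\<^sup>2 * m)\<^sup>2 * s\<^sup>2"
    by (simp add: power2_eq_square power3_eq_cube power4_eq_xxxx algebra_simps)
  finally show ?thesis unfolding Q_def .
qed

text \<open>The matrix \<open>I - \<kappa> v v\<^sup>T\<close> with this \<open>\<kappa>\<close> is the square root of the inverse metric.\<close>

definition root_coeff :: "real \<Rightarrow> real" where
  "root_coeff m = 1 / (sqrt (1 + m) * (sqrt (1 + m) + 1))"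

lemma root_coeff:
  assumes "m \<ge> 0"
  shows "2 * root_coeff m - (root_coeff m)\<^sup>2 * m = 1 / (1 + m)" "1 - root_coeff m * m = 1 / sqrt (1 + m)"
proof -
  define w where "w = sqrt (1 + m)"
  have w: "w \<ge> 1" "w * w = 1 + m" using assms by (auto simp: w_def)
  have m: "m = w * w - 1" using w by simp
  have "w \<noteq> 0" "w + 1 \<noteq> 0" using w(1) by auto
  have rc: "root_coeff m = 1 / (w * (w + 1))" by (simp add: root_coeff_def w_def)
  have "1 - 1 / (w * (w + 1)) * (w * w - 1) = 1 / w"
    using \<open>w \<noteq> 0\<close> \<open>w + 1 \<noteq> 0\<close> by (simp add: divide_simps) (simp add: algebra_simps)
  then show "1 - root_coeff m * m = 1 / sqrt (1 + m)"
    by (simp only: rc m[symmetric] w_def[symmetric])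
  then have k: "root_coeff m * m = 1 - 1 / w" by (simp add: w_def)
  have "2 * root_coeff m - (root_coeff m)\<^sup>2 * m = root_coeff m * (2 - root_coeff m * m)"
    by (simp add: power2_eq_square algebra_simps)
  also have "\<dots> = 1 / (w * (w + 1)) * (1 + 1 / w)" unfolding k by (simp add: root_coeff_def w_def)
  also have "\<dots> = 1 / (w * w)" using \<open>w \<noteq> 0\<close> \<open>w + 1 \<noteq> 0\<close> by (simp add: divide_simps)
  finally show "2 * root_coeff m - (root_coeff m)\<^sup>2 * m = 1 / (1 + m)" using w(2) by simp
qed

text \<open>Here \<open>T\<close>, \<open>F\<close>, \<open>Q\<close> and \<open>s\<close> stand for the trace of the Hessian \<open>h\<close>, \<open>|h|\<^sup>2\<close>, \<open>|h v|\<^sup>2\<close> and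
  \<open>h(v,v)\<close>. In terms of the second fundamental form \<open>A\<close>, the hypothesis reads
  \<open>H\<^sup>2 - |A|\<^sup>2 \<ge> 0\<close>.\<close>

lemma nonneg_scalar_curvature_algebra:
  fixes v :: "'n::finite \<Rightarrow> real" and h :: "'n \<Rightarrow> 'n \<Rightarrow> real"
  assumes sym: "\<And>i j. h i j = h j i"
  defines "q \<equiv> \<lambda>i. \<Sum>j\<in>UNIV. h i j * v j"
  defines "m \<equiv> \<Sum>i\<in>UNIV. (v i)\<^sup>2" and "s \<equiv> \<Sum>i\<in>UNIV. v i * q i"
  defines "T \<equiv> \<Sum>i\<in>UNIV. h i i" and "F \<equiv> \<Sum>i\<in>UNIV. \<Sum>j\<in>UNIV. (h i j)\<^sup>2" and "Q \<equiv> \<Sum>i\<in>UNIV. (q i)\<^sup>2"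
  assumes R: "(T\<^sup>2 - F) / (1 + m) - 2 * (T * s - Q) / (1 + m)\<^sup>2 \<ge> 0"
  shows "T - s / (1 + m) = 0 \<Longrightarrow> h i j = 0"
    and "T - s / (1 + m) > 0 \<Longrightarrow> s \<le> m * T"
proof -
  define W where "W = 1 + m"
  have m0: "m \<ge> 0" unfolding m_def by (simp add: sum_nonneg)
  then have W: "W > 0" by (simp add: W_def)
  define \<kappa> where "\<kappa> = root_coeff m"
  have \<kappa>: "2 * \<kappa> - \<kappa>\<^sup>2 * m = 1 / W" "1 - \<kappa> * m = 1 / sqrt W"
    using root_coeff[OF m0] by (auto simp: \<kappa>_def W_def)
  have \<kappa>2: "(1 - \<kappa> * m)\<^sup>2 = 1 / W" unfolding \<kappa>(2) using W by (simp add: power_divide)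
  define B where "B i j = h i j - \<kappa> * v i * q j - \<kappa> * q i * v j + \<kappa>\<^sup>2 * s * v i * v j" for i j
  define N where "N = (\<Sum>i\<in>UNIV. \<Sum>j\<in>UNIV. (B i j)\<^sup>2)"
  have N: "N = F - 2 * (1 / W) * Q + (1 / W)\<^sup>2 * s\<^sup>2"
    using norm_projected_hessian[where h = h and v = v and \<kappa> = \<kappa>, OF sym] unfolding N_def B_def F_def Q_def \<kappa>(1)[symmetric] s_def q_def m_def .
  have "W * ((T\<^sup>2 - F) / W - 2 * (T * s - Q) / W\<^sup>2) = (T - s / W)\<^sup>2 - N"
    unfolding N using W by (simp add: field_simps power2_eq_square)
  moreover have "W * ((T\<^sup>2 - F) / W - 2 * (T * s - Q) / W\<^sup>2) \<ge> 0"
    using R W by (simp add: W_def)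
  ultimately have NH: "N \<le> (T - s / W)\<^sup>2" by simp
  have Bv: "(\<Sum>j\<in>UNIV. B i j * v j) = (1 - \<kappa> * m) * (q i - \<kappa> * s * v i)" for i
  proof -
    have "(\<Sum>j\<in>UNIV. B i j * v j) = (\<Sum>j\<in>UNIV. h i j * v j - (\<kappa> * v i) * (v j * q j)
        - (\<kappa> * q i) * (v j)\<^sup>2 + (\<kappa>\<^sup>2 * s * v i) * (v j)\<^sup>2)"
      by (rule sum.cong) (auto simp: B_def power2_eq_square algebra_simps)
    also have "\<dots> = q i - (\<kappa> * v i) * s - (\<kappa> * q i) * m + (\<kappa>\<^sup>2 * s * v i) * m"
      by (simp only: sum.distrib sum_subtractf sum_distrib_left[symmetric] q_def s_def m_def)
    finally show ?thesis by (simp add: power2_eq_square algebra_simps)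
  qed
  have vBv: "(\<Sum>i\<in>UNIV. v i * (\<Sum>j\<in>UNIV. B i j * v j)) = s / W"
  proof -
    have "(\<Sum>i\<in>UNIV. v i * (\<Sum>j\<in>UNIV. B i j * v j)) =
        (\<Sum>i\<in>UNIV. (1 - \<kappa> * m) * (v i * q i) - (1 - \<kappa> * m) * \<kappa> * s * (v i)\<^sup>2)"
      unfolding Bv by (rule sum.cong) (auto simp: power2_eq_square algebra_simps)
    also have "\<dots> = (1 - \<kappa> * m) * s - (1 - \<kappa> * m) * \<kappa> * s * m"
      by (simp only: sum_subtractf sum_distrib_left[symmetric] s_def m_def)
    also have "\<dots> = (1 - \<kappa> * m)\<^sup>2 * s" by (simp add: power2_eq_square algebra_simps)
    finally show ?thesis by (simp add: \<kappa>2)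
  qed
  show "h i j = 0" if "T - s / (1 + m) = 0"
  proof -
    have "N \<le> 0" using NH that by (simp add: W_def)
    then have "(\<Sum>i\<in>UNIV. \<Sum>j\<in>UNIV. (B i j)\<^sup>2) = 0"
      unfolding N_def by (smt (verit) sum_nonneg zero_le_power2)
    then have B0: "B i j = 0" for i j
      by (simp add: sum_nonneg_eq_0_iff sum_nonneg)
    then have "s = 0" using vBv W by simp
    have k0: "1 - \<kappa> * m \<noteq> 0" using \<kappa>(2) W by simp
    have q0: "q i = 0" for i using Bv[of i] B0 k0 \<open>s = 0\<close> by simp
    show ?thesis using B0[of i j] q0 \<open>s = 0\<close> by (simp add: B_def)
  qed
  show "s \<le> m * T" if "T - s / (1 + m) > 0"
  proof (cases "m = 0")
    case True
    then have "v i = 0" for i unfolding m_def by (simp add: sum_nonneg_eq_0_iff)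
    then show ?thesis using True by (simp add: s_def)
  next
    case False
    then have m: "m > 0" using m0 by simp
    have "(s / W)\<^sup>2 \<le> m\<^sup>2 * N"
    proof -
      define p where "p i = (\<Sum>j\<in>UNIV. B i j * v j)" for i
      have "(s / W)\<^sup>2 \<le> m * (\<Sum>i\<in>UNIV. (p i)\<^sup>2)"
        unfolding vBv[symmetric] m_def p_def[symmetric] by (rule Cauchy_Schwarz_ineq_sum)
      also have "\<dots> \<le> m * (\<Sum>i\<in>UNIV. (\<Sum>j\<in>UNIV. (B i j)\<^sup>2) * m)"
        unfolding p_def m_def using m0
        by (intro mult_left_mono sum_mono Cauchy_Schwarz_ineq_sum) (auto simp: m_def)
      also have "\<dots> = m\<^sup>2 * N" by (simp add: N_def sum_distrib_right[symmetric] power2_eq_square)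
      finally show ?thesis .
    qed
    also have "\<dots> \<le> m\<^sup>2 * (T - s / W)\<^sup>2" using NH by (intro mult_left_mono) auto
    finally have "(s / W)\<^sup>2 \<le> (m * (T - s / W))\<^sup>2" by (simp add: power_mult_distrib)
    then have "s / W \<le> m * (T - s / W)"
    proof (rule power2_le_imp_le)
      show "0 \<le> m * (T - s / W)" using mult_pos_pos[OF m that] by (simp add: W_def)
    qed
    then have "s / W * W \<le> m * (T - s / W) * W" using W by (intro mult_right_mono) auto
    moreover have "s / W * W = s" using W by simp
    moreover have "m * (T - s / W) * W = m * T * W - m * (s / W * W)" by (simp only: algebra_simps)
    ultimately have "s + m * s \<le> m * T * W" by simp
    then have "s * W \<le> m * T * W" by (simp add: W_def algebra_simps)
    then show ?thesis using W by (simp only: mult_le_cancel_right_pos)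
  qed
qed

lemma inner_matrix_sum: "u \<bullet> (A *v w) = (\<Sum>i\<in>UNIV. u $ i * (\<Sum>j\<in>UNIV. A $ i $ j * w $ j))"
  for A :: "real^'n^'m"
  by (simp add: inner_vec_def matrix_vector_mult_def)

lemma power2_norm_sum: "(norm v)\<^sup>2 = (\<Sum>i\<in>UNIV. (v $ i)\<^sup>2)" for v :: "real^'n"
  by (simp add: norm_vec_def L2_set_def sum_nonneg)

lemma graph_mean_curvature_eq:
  "graph_mean_curvature f x =
    (trace (hess f x) - grad f x \<bullet> (hess f x *v grad f x) / graph_W f x) / sqrt (graph_W f x)"
proof -
  let ?W = "graph_W f x"
  have "graph_mean_curvature f x = (\<Sum>i\<in>UNIV. \<Sum>j\<in>UNIV.
      ((if i = j then hess f x $ i $ j else 0) - pd i f x * (hess f x $ i $ j * pd j f x) / ?W) / sqrt ?W)"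
    unfolding graph_mean_curvature_def graph_W_eq[symmetric]
    by (intro sum.cong refl) (auto simp: left_diff_distrib right_diff_distrib diff_divide_distrib mult_ac)
  also have "\<dots> = ((\<Sum>i\<in>UNIV. hess f x $ i $ i)
      - (\<Sum>i\<in>UNIV. \<Sum>j\<in>UNIV. pd i f x * (hess f x $ i $ j * pd j f x)) / ?W) / sqrt ?W"
    by (simp only: sum_divide_distrib[symmetric] sum_subtractf) simp
  finally show ?thesis
    by (simp add: trace_def inner_matrix_sum grad_def sum_distrib_left)
qed

lemma nonneg_scalar_curvature_hess:
  fixes f :: "real^'n::finite \<Rightarrow> real"
  assumes f: "Ck_on 3 S f" and S: "open S" and x: "x \<in> S" and R: "graph_scalar_curvature f x \<ge> 0"
  shows "graph_mean_curvature f x = 0 \<Longrightarrow> hess f x = 0"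
    and "graph_mean_curvature f x > 0 \<Longrightarrow>
      grad f x \<bullet> (hess f x *v grad f x) \<le> (norm (grad f x))\<^sup>2 * trace (hess f x)"
proof -
  let ?W = "graph_W f x"
  let ?s = "grad f x \<bullet> (hess f x *v grad f x)"
  have W: "?W > 0" using graph_W_ge_1[of f x] by linarith
  have sym: "pd j (pd i f) x = pd i (pd j f) x" for i j
    by (rule pd_commute[OF Ck_on_le[OF f] S x]) simp
  have s: "?s = (\<Sum>i\<in>UNIV. pd i f x * (\<Sum>j\<in>UNIV. pd j (pd i f) x * pd j f x))"
    by (simp add: inner_matrix_sum hess_def grad_def)
  have T: "trace (hess f x) = (\<Sum>i\<in>UNIV. pd i (pd i f) x)" by (simp add: trace_def hess_def)
  note alg = nonneg_scalar_curvature_algebra[where v = "\<lambda>i. pd i f x" and h = "\<lambda>i j. pd j (pd i f) x",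
      OF sym, folded graph_W_def, folded s T, OF R[unfolded graph_scalar_curvature_eq[OF f S x], folded s T]]
  show "hess f x = 0" if "graph_mean_curvature f x = 0"
  proof -
    have "trace (hess f x) - ?s / ?W = 0" using that W unfolding graph_mean_curvature_eq by simp
    then have "pd j (pd i f) x = 0" for i j by (rule alg(1))
    then show ?thesis by (simp add: hess_def vec_eq_iff)
  qed
  show "?s \<le> (norm (grad f x))\<^sup>2 * trace (hess f x)" if "graph_mean_curvature f x > 0"
  proof -
    have "trace (hess f x) - ?s / ?W > 0" using that W unfolding graph_mean_curvature_eq
      by (simp add: zero_less_divide_iff)
    then have "?s \<le> (\<Sum>i\<in>UNIV. (pd i f x)\<^sup>2) * trace (hess f x)" by (rule alg(2))
    then show ?thesis by (simp add: power2_norm_sum grad_def)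
  qed
qed

lemma axis_inner: "axis i 1 \<bullet> w = w $ i" "w \<bullet> axis i 1 = w $ i" for w :: "real^'n"
  by (simp_all add: inner_axis inner_axis')

lemma trace_congruence:
  fixes A :: "real^'n::finite^'n" and v :: "real^'n" and \<kappa> :: real
  defines "u \<equiv> \<lambda>i. axis i 1 - (\<kappa> * v $ i) *\<^sub>R v"
  shows "(\<Sum>i\<in>UNIV. u i \<bullet> (A *v u i)) =
    trace A - (2 * \<kappa> - \<kappa>\<^sup>2 * (norm v)\<^sup>2) * (v \<bullet> (A *v v))"
proof -
  define m where "m = (norm v)\<^sup>2"
  define s where "s = v \<bullet> (A *v v)"
  note ax = axis_inner
  have m: "(\<Sum>i\<in>UNIV. (v $ i)\<^sup>2) = m" by (simp add: m_def power2_norm_sum)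
  have "(\<Sum>i\<in>UNIV. u i \<bullet> (A *v u i)) = (\<Sum>i\<in>UNIV. A $ i $ i - \<kappa> * (v $ i * (A *v v) $ i)
      - \<kappa> * (v $ i * (v \<bullet> (A *v axis i 1))) + (\<kappa>\<^sup>2 * s) * (v $ i)\<^sup>2)"
  proof (rule sum.cong[OF refl])
    fix i
    have "(A *v axis i 1) $ i = A $ i $ i"
      by (simp add: matrix_vector_mult_def axis_def if_distrib cong: if_cong)
    then show "u i \<bullet> (A *v u i) = A $ i $ i - \<kappa> * (v $ i * (A *v v) $ i)
      - \<kappa> * (v $ i * (v \<bullet> (A *v axis i 1))) + (\<kappa>\<^sup>2 * s) * (v $ i)\<^sup>2"
      unfolding u_def s_def
      by (simp add: matrix_vector_mult_diff_distrib matrix_vector_mult_scaleR inner_diff_left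
        inner_diff_right ax power2_eq_square algebra_simps)
  qed
  also have "\<dots> = trace A - \<kappa> * s - \<kappa> * s + (\<kappa>\<^sup>2 * s) * m"
  proof -
    have 1: "(\<Sum>i\<in>UNIV. v $ i * (A *v v) $ i) = s" by (simp add: s_def inner_vec_def)
    have "(\<Sum>i\<in>UNIV. v $ i * (v \<bullet> (A *v axis i 1))) = (\<Sum>i\<in>UNIV. v \<bullet> (A *v (v $ i *\<^sub>R axis i 1)))"
      by (simp add: matrix_vector_mult_scaleR)
    also have "\<dots> = v \<bullet> (A *v (\<Sum>i\<in>UNIV. v $ i *\<^sub>R axis i 1))"
      by (simp add: linear_sum[OF matrix_vector_mul_linear] inner_sum_right)
    also have "(\<Sum>i\<in>UNIV. v $ i *\<^sub>R axis i 1) = v"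
      by (simp add: vec_eq_iff axis_def if_distrib cong: if_cong)
    finally have 2: "(\<Sum>i\<in>UNIV. v $ i * (v \<bullet> (A *v axis i 1))) = s" by (simp add: s_def)
    show ?thesis
      by (simp only: sum.distrib sum_subtractf sum_distrib_left[symmetric] 1 2 m trace_def)
  qed
  also have "\<dots> = trace A - (2 * \<kappa> - \<kappa>\<^sup>2 * m) * s" by (simp add: algebra_simps)
  finally show ?thesis by (simp add: m_def s_def)
qed

lemma trace_inverse_metric_le:
  fixes A :: "real^'n::finite^'n" and v y :: "real^'n"
  assumes le: "\<And>u. u \<bullet> (A *v u) \<le> a * (norm u)\<^sup>2 - b * (y \<bullet> u)\<^sup>2" and ab: "a \<ge> 0" "b \<ge> 0"
  shows "trace A - v \<bullet> (A *v v) / (1 + (norm v)\<^sup>2) \<le> a * CARD('n) - b * (norm y)\<^sup>2 / (1 + (norm v)\<^sup>2)"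
proof -
  define m where "m = (norm v)\<^sup>2"
  define s where "s = v \<bullet> (A *v v)"
  define \<kappa> where "\<kappa> = root_coeff m"
  have \<kappa>: "2 * \<kappa> - \<kappa>\<^sup>2 * m = 1 / (1 + m)" using root_coeff[of m] by (simp add: \<kappa>_def m_def)
  define u where "u i = axis i 1 - (\<kappa> * v $ i) *\<^sub>R v" for i
  have m: "(\<Sum>i\<in>UNIV. (v $ i)\<^sup>2) = m" by (simp add: m_def power2_norm_sum)
  note ax = axis_inner
  have lhs: "(\<Sum>i\<in>UNIV. u i \<bullet> (A *v u i)) = trace A - s / (1 + m)"
    using trace_congruence[of \<kappa> v A] \<kappa> by (simp add: u_def m_def s_def)
  have "(\<Sum>i\<in>UNIV. (norm (u i))\<^sup>2) = (\<Sum>i\<in>(UNIV::'n set). 1 - (2 * \<kappa>) * (v $ i)\<^sup>2 + (\<kappa>\<^sup>2 * m) * (v $ i)\<^sup>2)"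
    unfolding u_def m_def power2_norm_eq_inner
    by (rule sum.cong) (auto simp: inner_diff_left inner_diff_right ax power2_eq_square algebra_simps)
  also have "\<dots> = CARD('n) - (2 * \<kappa>) * m + (\<kappa>\<^sup>2 * m) * m"
    by (simp only: sum.distrib sum_subtractf sum_distrib_left[symmetric] m) simp
  also have "\<dots> = CARD('n) - (2 * \<kappa> - \<kappa>\<^sup>2 * m) * m" by (simp add: algebra_simps)
  also have "\<dots> \<le> CARD('n)" unfolding \<kappa> by (simp add: m_def)
  finally have nu: "(\<Sum>i\<in>UNIV. (norm (u i))\<^sup>2) \<le> CARD('n)" .
  have "(\<Sum>i\<in>UNIV. (y \<bullet> u i)\<^sup>2) = (\<Sum>i\<in>UNIV. (y $ i)\<^sup>2 - (2 * \<kappa> * (y \<bullet> v)) * (y $ i * v $ i)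
      + (\<kappa>\<^sup>2 * (y \<bullet> v)\<^sup>2) * (v $ i)\<^sup>2)"
    unfolding u_def
    by (rule sum.cong) (auto simp: inner_diff_right ax power2_eq_square algebra_simps)
  also have "\<dots> = (norm y)\<^sup>2 - (2 * \<kappa> * (y \<bullet> v)) * (y \<bullet> v) + (\<kappa>\<^sup>2 * (y \<bullet> v)\<^sup>2) * m"
  proof -
    have 1: "(\<Sum>i\<in>UNIV. y $ i * v $ i) = y \<bullet> v" by (simp add: inner_vec_def)
    show ?thesis
      by (simp only: sum.distrib sum_subtractf sum_distrib_left[symmetric] m 1 power2_norm_sum)
  qed
  also have "\<dots> = (norm y)\<^sup>2 - (2 * \<kappa> - \<kappa>\<^sup>2 * m) * (y \<bullet> v)\<^sup>2"
    by (simp add: power2_eq_square algebra_simps)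
  also have "\<dots> = (norm y)\<^sup>2 - (y \<bullet> v)\<^sup>2 / (1 + m)" unfolding \<kappa> by simp
  finally have yu: "(\<Sum>i\<in>UNIV. (y \<bullet> u i)\<^sup>2) = (norm y)\<^sup>2 - (y \<bullet> v)\<^sup>2 / (1 + m)" .
  have m0: "m \<ge> 0" by (simp add: m_def)
  have "(y \<bullet> v)\<^sup>2 \<le> (norm y)\<^sup>2 * m"
    using Cauchy_Schwarz_ineq[of y v] by (simp add: m_def power2_norm_eq_inner)
  then have "(y \<bullet> v)\<^sup>2 / (1 + m) \<le> (norm y)\<^sup>2 * m / (1 + m)" using m0 by (intro divide_right_mono) auto
  moreover have "(norm y)\<^sup>2 - (norm y)\<^sup>2 * m / (1 + m) = (norm y)\<^sup>2 / (1 + m)"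
    using m0 by (simp add: field_simps)
  ultimately have yu': "(norm y)\<^sup>2 / (1 + m) \<le> (\<Sum>i\<in>UNIV. (y \<bullet> u i)\<^sup>2)" using yu by linarith
  have "trace A - s / (1 + m) \<le> (\<Sum>i\<in>UNIV. a * (norm (u i))\<^sup>2 - b * (y \<bullet> u i)\<^sup>2)"
    unfolding lhs[symmetric] by (rule sum_mono) (rule le)
  also have "\<dots> = a * (\<Sum>i\<in>UNIV. (norm (u i))\<^sup>2) - b * (\<Sum>i\<in>UNIV. (y \<bullet> u i)\<^sup>2)"
    by (simp add: sum_subtractf sum_distrib_left)
  also have "\<dots> \<le> a * CARD('n) - b * ((norm y)\<^sup>2 / (1 + m))"
    by (intro diff_mono mult_left_mono nu yu' ab)
  finally show ?thesis by (simp add: s_def m_def)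
qed

lemma Ck_on_has_derivative_grad:
  "Ck_on (Suc k) S f \<Longrightarrow> x \<in> S \<Longrightarrow> (f has_derivative (\<lambda>u. grad f x \<bullet> u)) (at x)"
  by (rule has_derivative_grad[OF differentiable_Ck])

lemma has_derivative_grad_hess:
  fixes f :: "real^'n::finite \<Rightarrow> real"
  assumes f: "Ck_on 2 S f" and x: "x \<in> S"
  shows "(grad f has_derivative (\<lambda>u. hess f x *v u)) (at x)"
proof (subst has_derivative_componentwise_within, intro ballI)
  fix b :: "real^'n" assume "b \<in> Basis"
  then obtain i where b: "b = axis i 1" by (auto simp: Basis_vec_def)
  have "Ck_on (Suc (Suc 0)) S f" using f by (simp add: numeral_2_eq_2)
  then have "(pd i f has_derivative (\<lambda>u. grad (pd i f) x \<bullet> u)) (at x)"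
    using Ck_on_has_derivative_grad[OF Ck_on_pd x] by blast
  moreover have ib: "w \<bullet> b = w $ i" for w by (simp add: b inner_axis)
  moreover have "grad (pd i f) x \<bullet> u = (hess f x *v u) $ i" for u
    by (simp add: inner_vec_def grad_def hess_def matrix_vector_mult_def)
  moreover have "(\<lambda>y. grad f y $ i) = pd i f" by (simp add: grad_def)
  ultimately show "((\<lambda>y. grad f y \<bullet> b) has_derivative (\<lambda>u. (hess f x *v u) \<bullet> b)) (at x)"
    by (simp only: ib)
qed

lemma continuous_on_grad_hess:
  fixes f :: "real^'n::finite \<Rightarrow> real"
  assumes f: "Ck_on 2 S f"
  shows "continuous_on S (grad f)" "continuous_on S (hess f)"
proof -
  have f2: "Ck_on (Suc (Suc 0)) S f" using f by (simp add: numeral_2_eq_2)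
  show "continuous_on S (grad f)" unfolding grad_def
    by (intro continuous_on_vec_lambda Ck_on_continuous[OF Ck_on_pd[OF f2]])
  show "continuous_on S (hess f)" unfolding hess_def
    by (intro continuous_on_vec_lambda Ck_on_continuous[OF Ck_on_pd[OF Ck_on_pd[OF f2]]])
qed

lemma continuous_on_graph_mean_curvature:
  fixes f :: "real^'n::finite \<Rightarrow> real"
  assumes f: "Ck_on 2 S f"
  shows "continuous_on S (graph_mean_curvature f)"
proof -
  note c = continuous_on_grad_hess[OF f]
  have "1 + (norm (grad f x))\<^sup>2 > 0" for x by (simp add: add_pos_nonneg)
  then have W: "1 + (norm (grad f x))\<^sup>2 \<noteq> 0" "sqrt (1 + (norm (grad f x))\<^sup>2) \<noteq> 0" for x
    by (simp_all add: less_imp_neq[symmetric])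
  have v: "continuous_on S (\<lambda>x. pd i f x)" for i
    using continuous_on_component[OF c(1), of i] by (simp add: grad_def)
  show ?thesis unfolding graph_mean_curvature_def[abs_def]
    by (intro continuous_intros c v continuous_on_component ballI W)
qed

lemma grad_hess_minus:
  fixes f :: "real^'n::finite \<Rightarrow> real"
  assumes f: "Ck_on 2 S f" and S: "open S" and x: "x \<in> S"
  shows "grad (\<lambda>y. - f y) x = - grad f x" "hess (\<lambda>y. - f y) x = - hess f x"
proof -
  have f2: "Ck_on (Suc (Suc 0)) S f" using f by (simp add: numeral_2_eq_2)
  have m: "pd i (\<lambda>y. - g y) y = - pd i g y" if "g differentiable at y" for g :: "real^'n \<Rightarrow> real" and i y
    using pd_eq[OF has_derivative_minus[OF that[unfolded frechet_derivative_works]]] by (simp add: pd_def)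
  have p: "pd i (\<lambda>y. - f y) y = - pd i f y" if "y \<in> S" for i y
    by (rule m[OF differentiable_Ck[OF f2 that]])
  show "grad (\<lambda>y. - f y) x = - grad f x" by (simp add: grad_def vec_eq_iff p[OF x])
  have "pd j (pd i (\<lambda>y. - f y)) x = - pd j (pd i f) x" for i j
  proof -
    have d: "pd i f differentiable at x" by (rule differentiable_Ck[OF Ck_on_pd[OF f2] x])
    have "pd j (pd i (\<lambda>y. - f y)) x = pd j (\<lambda>y. - pd i f y) x"
      using pd_cong_open[OF S x, of "\<lambda>y. - pd i f y" "pd i (\<lambda>y. - f y)" j] p d
      by (simp add: differentiable_minus)
    then show ?thesis using m[OF d] by simp
  qed
  then show "hess (\<lambda>y. - f y) x = - hess f x" by (simp add: hess_def vec_eq_iff)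
qed

lemma graph_mean_curvature_minus:
  fixes f :: "real^'n::finite \<Rightarrow> real"
  assumes "Ck_on 2 S f" "open S" "x \<in> S"
  shows "graph_mean_curvature (\<lambda>y. - f y) x = - graph_mean_curvature f x"
  unfolding graph_mean_curvature_eq graph_W_eq grad_hess_minus[OF assms]
  by (simp add: trace_def sum_negf inner_matrix_sum diff_divide_distrib)

section \<open>The graph near its boundary\<close>

lemma has_derivative_over_graph:
  fixes G :: "(real^'n::finite) \<times> real \<Rightarrow> real"
  assumes G: "(G has_derivative G') (at (x, f x))" and f: "f differentiable at x"
  shows "(\<lambda>x. G (x, f x)) differentiable at x"
    "pd j (\<lambda>x. G (x, f x)) x = G' (axis j 1, 0) + pd j f x * G' (0, 1)"
proof -
  have d: "((\<lambda>x. G (x, f x)) has_derivative (\<lambda>u. G' (u, frechet_derivative f (at x) u))) (at x)"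
    by (rule has_derivative_compose[OF has_derivative_Pair[OF has_derivative_ident
        f[unfolded frechet_derivative_works]] G])
  then show "(\<lambda>x. G (x, f x)) differentiable at x" by (rule differentiableI)
  have lin: "linear G'" using G by (rule has_derivative_linear)
  have "G' (axis j 1, pd j f x) = G' ((axis j 1, 0) + pd j f x *\<^sub>R (0, 1))" by simp
  also have "\<dots> = G' (axis j 1, 0) + G' (pd j f x *\<^sub>R (0, 1))" by (rule linear_add[OF lin])
  also have "G' (pd j f x *\<^sub>R (0, 1)) = pd j f x * G' (0, 1)"
    using linear_scale[OF lin, of "pd j f x" "(0, 1)"] by simp
  finally show "pd j (\<lambda>x. G (x, f x)) x = G' (axis j 1, 0) + pd j f x * G' (0, 1)"
    using pd_eq[OF d, of j] by (simp add: pd_def)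
qed

lemma implicit_derivatives:
  fixes F :: "(real^'n::finite) \<times> real \<Rightarrow> real" and a A
  assumes F: "Ck_on 2 U F" and f: "Ck_on 2 S f" and S: "open S" and x: "x \<in> S"
    and zero: "\<And>x. x \<in> S \<Longrightarrow> (x, f x) \<in> U \<and> F (x, f x) = 0"
  defines "a \<equiv> \<lambda>i z. frechet_derivative F (at z) (axis i 1, 0)"
    and "c \<equiv> \<lambda>z. frechet_derivative F (at z) (0, 1)"
  shows "a i (x, f x) + c (x, f x) * pd i f x = 0"
    and "frechet_derivative (a i) (at (x, f x)) (axis j 1, 0)
      + frechet_derivative (a i) (at (x, f x)) (0, 1) * pd j f x
      + (frechet_derivative c (at (x, f x)) (axis j 1, 0)
          + frechet_derivative c (at (x, f x)) (0, 1) * pd j f x) * pd i f x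
      + c (x, f x) * pd j (pd i f) x = 0"
proof -
  have F2: "Ck_on (Suc (Suc 0)) U F" using F by (simp add: numeral_2_eq_2)
  have f2: "Ck_on (Suc (Suc 0)) S f" using f by (simp add: numeral_2_eq_2)
  have ai: "Ck_on (Suc 0) U (a i)" for i unfolding a_def
    by (rule Ck_on_partial[OF F2]) (simp add: Basis_prod_def axis_Basis)
  have c: "Ck_on (Suc 0) U c" unfolding c_def
    by (rule Ck_on_partial[OF F2]) (simp add: Basis_prod_def)
  have z: "(\<lambda>x. F (x, f x)) differentiable at x \<and> pd i (\<lambda>x. F (x, f x)) x = 0 \<and>
     a i (x, f x) + c (x, f x) * pd i f x = 0" if x: "x \<in> S" for i x
  proof -
    note d = has_derivative_over_graph[OF Ck_on_has_derivative[OF F2 conjunct1[OF zero[OF x]]] differentiable_Ck[OF f2 x]]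
    have "pd i (\<lambda>x. F (x, f x)) x = pd i (\<lambda>x. 0) x"
      by (rule pd_cong_open[OF S x _ d(1)]) (use zero in auto)
    then show ?thesis using d(1) d(2)[of i] by (simp add: a_def c_def mult.commute)
  qed
  show "a i (x, f x) + c (x, f x) * pd i f x = 0" using z[OF x] by blast
  have xU: "(x, f x) \<in> U" using zero[OF x] by blast
  note da = has_derivative_over_graph[OF Ck_on_has_derivative[OF ai xU] differentiable_Ck[OF f2 x]]
  note dc = has_derivative_over_graph[OF Ck_on_has_derivative[OF c xU] differentiable_Ck[OF f2 x]]
  have dp: "pd i f differentiable at x" by (rule differentiable_Ck[OF Ck_on_pd[OF f2] x])
  have dcp: "(\<lambda>x. c (x, f x) * pd i f x) differentiable at x" by (intro differentiable_mult dc(1) dp)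
  have "pd j (\<lambda>x. a i (x, f x) + c (x, f x) * pd i f x) x = pd j (\<lambda>x. 0) x"
    by (rule pd_cong_open[OF S x]) (use z in \<open>auto intro!: differentiable_add da(1) dcp\<close>)
  then have "pd j (\<lambda>x. a i (x, f x)) x + (pd j (\<lambda>x. c (x, f x)) x * pd i f x + c (x, f x) * pd j (pd i f) x) = 0"
    by (simp add: pd_add[OF da(1) dcp] pd_mult[OF dc(1) dp])
  then show "frechet_derivative (a i) (at (x, f x)) (axis j 1, 0)
      + frechet_derivative (a i) (at (x, f x)) (0, 1) * pd j f x
      + (frechet_derivative c (at (x, f x)) (axis j 1, 0)
          + frechet_derivative c (at (x, f x)) (0, 1) * pd j f x) * pd i f x
      + c (x, f x) * pd j (pd i f) x = 0"
    unfolding da(2) dc(2) by (simp add: algebra_simps)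
qed

lemma mean_curvature_implicit_algebra:
  fixes a p :: "'n::finite \<Rightarrow> real" and A h :: "'n \<Rightarrow> 'n \<Rightarrow> real"
  assumes c: "c \<noteq> 0" and p: "\<And>i. a i + c * p i = 0"
    and h: "\<And>i j. A i j + Az i * p j + (Ca j + Cc * p j) * p i + c * h i j = 0"
  defines "W \<equiv> 1 + (\<Sum>i\<in>UNIV. (p i)\<^sup>2)" and "m \<equiv> (\<Sum>i\<in>UNIV. (a i)\<^sup>2) + c\<^sup>2"
  shows "(\<Sum>i\<in>UNIV. \<Sum>j\<in>UNIV. ((if i = j then 1 else 0) - p i * p j / W) * (h i j / sqrt W)) =
    - sgn c * ((\<Sum>i\<in>UNIV. \<Sum>j\<in>UNIV. ((if i = j then 1 else 0) - a i * a j / m) * A i j)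
      - (\<Sum>i\<in>UNIV. (Az i + Ca i) * a i) * c / m + Cc * (\<Sum>i\<in>UNIV. (a i)\<^sup>2) / m) / sqrt m"
proof -
  have ap: "a i = - (c * p i)" for i using p[of i] by linarith
  define n where "n = (\<Sum>i\<in>UNIV. (p i)\<^sup>2)"
  have n0: "n \<ge> 0" by (simp add: n_def sum_nonneg)
  have W: "W > 0" using n0 by (simp add: W_def n_def)
  have aa: "(\<Sum>i\<in>UNIV. (a i)\<^sup>2) = c\<^sup>2 * n" by (simp add: ap n_def power_mult_distrib sum_distrib_left)
  have m: "m = c\<^sup>2 * W" by (simp add: m_def aa W_def n_def[symmetric] algebra_simps)
  have sm: "sqrt m = \<bar>c\<bar> * sqrt W" by (simp add: m real_sqrt_mult)
  have c2: "c\<^sup>2 \<noteq> 0" using c by simp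
  have P: "a i * a j / m = p i * p j / W" for i j
    using c W by (simp add: ap m power2_eq_square)
  define X where "X i j = A i j + Az i * p j + Ca j * p i + Cc * (p i * p j)" for i j
  have ch: "c * h i j = - X i j" for i j using h[of i j] by (simp add: X_def algebra_simps)
  have hs: "h i j / sqrt W = - sgn c * (X i j / sqrt m)" for i j
  proof -
    have "h i j = - X i j / c" using ch[of i j] c by (simp add: field_simps)
    moreover have "1 / c = sgn c / \<bar>c\<bar>" using c by (simp add: sgn_if)
    ultimately have "h i j = - X i j * (sgn c / \<bar>c\<bar>)" by (metis divide_inverse mult.right_neutral times_divide_eq_right)
    then show ?thesis by (simp add: sm)
  qed
  let ?P = "\<lambda>i j. (if i = j then 1 else 0) - p i * p j / W"
  have Pp: "(\<Sum>j\<in>UNIV. ?P i j * p j) = p i / W" for i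
  proof -
    have "(\<Sum>j\<in>UNIV. ?P i j * p j) = (\<Sum>j\<in>UNIV. (if i = j then p j else 0) - (p i / W) * (p j)\<^sup>2)"
      by (rule sum.cong) (auto simp: power2_eq_square left_diff_distrib)
    also have "\<dots> = p i - (p i / W) * n" by (simp only: sum_subtractf sum_distrib_left[symmetric] n_def) simp
    also have "\<dots> = p i / W" using W by (simp add: field_simps W_def n_def[symmetric])
    finally show ?thesis .
  qed
  have sym: "?P i j = ?P j i" for i j by (simp add: mult.commute)
  have "(\<Sum>i\<in>UNIV. \<Sum>j\<in>UNIV. ?P i j * X i j) = (\<Sum>i\<in>UNIV. \<Sum>j\<in>UNIV. ?P i j * A i j + Az i * (?P i j * p j)
      + Ca j * (?P j i * p i) + Cc * p i * (?P i j * p j))"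
    unfolding X_def by (intro sum.cong refl, subst (3) sym) (simp add: distrib_left mult_ac)
  also have "\<dots> = (\<Sum>i\<in>UNIV. \<Sum>j\<in>UNIV. ?P i j * A i j) + (\<Sum>i\<in>UNIV. \<Sum>j\<in>UNIV. Az i * (?P i j * p j))
      + (\<Sum>j\<in>UNIV. \<Sum>i\<in>UNIV. Ca j * (?P j i * p i)) + (\<Sum>i\<in>UNIV. \<Sum>j\<in>UNIV. Cc * p i * (?P i j * p j))"
    by (simp only: sum.distrib, subst sum.swap[of "\<lambda>i j. Ca j * (?P j i * p i)"]) simp
  also have "\<dots> = (\<Sum>i\<in>UNIV. \<Sum>j\<in>UNIV. ?P i j * A i j) + (\<Sum>i\<in>UNIV. Az i * (p i / W))
      + (\<Sum>i\<in>UNIV. Ca i * (p i / W)) + (\<Sum>i\<in>UNIV. Cc * p i * (p i / W))"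
    by (simp only: sum_distrib_left[symmetric] Pp)
  also have "\<dots> = (\<Sum>i\<in>UNIV. \<Sum>j\<in>UNIV. ?P i j * A i j) - (\<Sum>i\<in>UNIV. (Az i + Ca i) * a i) * c / m
      + Cc * (\<Sum>i\<in>UNIV. (a i)\<^sup>2) / m"
  proof -
    have e: "p i / W = - (a i * c / m)" for i using c W by (simp add: ap m power2_eq_square)
    have "(\<Sum>i\<in>UNIV. Az i * (p i / W)) + (\<Sum>i\<in>UNIV. Ca i * (p i / W)) = - ((\<Sum>i\<in>UNIV. (Az i + Ca i) * a i) * c / m)"
      unfolding e by (simp add: sum.distrib[symmetric] sum_distrib_right sum_divide_distrib sum_negf[symmetric])
        (intro sum.cong refl, simp add: algebra_simps add_divide_distrib)
    moreover have "(\<Sum>i\<in>UNIV. Cc * p i * (p i / W)) = Cc * (\<Sum>i\<in>UNIV. (a i)\<^sup>2) / m"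
    proof -
      have "(\<Sum>i\<in>UNIV. Cc * p i * (p i / W)) = Cc / W * n"
        unfolding n_def sum_distrib_left by (intro sum.cong refl) (simp add: power2_eq_square)
      then show ?thesis unfolding aa using c2 W by (simp add: m)
    qed
    ultimately show ?thesis by linarith
  qed
  finally have K: "(\<Sum>i\<in>UNIV. \<Sum>j\<in>UNIV. ?P i j * X i j) =
    (\<Sum>i\<in>UNIV. \<Sum>j\<in>UNIV. ?P i j * A i j) - (\<Sum>i\<in>UNIV. (Az i + Ca i) * a i) * c / m + Cc * (\<Sum>i\<in>UNIV. (a i)\<^sup>2) / m" .
  have "(\<Sum>i\<in>UNIV. \<Sum>j\<in>UNIV. ?P i j * (h i j / sqrt W)) = (\<Sum>i\<in>UNIV. \<Sum>j\<in>UNIV. (- sgn c / sqrt m) * (?P i j * X i j))"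
    unfolding hs by (intro sum.cong refl) (simp add: algebra_simps)
  also have "\<dots> = (- sgn c / sqrt m) * (\<Sum>i\<in>UNIV. \<Sum>j\<in>UNIV. ?P i j * X i j)"
    by (simp only: sum_distrib_left)
  finally show ?thesis unfolding K P by simp
qed

definition half_chart :: "(real^'n::finite) set \<Rightarrow> (real^'n \<Rightarrow> real) \<Rightarrow> real^'n \<Rightarrow>
    ((real^'n) \<times> real) set \<Rightarrow> ((real^'n) \<times> real) set \<Rightarrow>
    ((real^'n) \<times> real \<Rightarrow> (real^'n) \<times> real) \<Rightarrow> ((real^'n) \<times> real \<Rightarrow> (real^'n) \<times> real) \<Rightarrow>
    (real^'n) \<times> real \<Rightarrow> (real^'n) \<times> real \<Rightarrow> bool" where
  "half_chart \<Omega> f p U V \<Phi> \<Psi> e d \<longleftrightarrow>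
     (p, f p) \<in> U \<and> Ck_diffeomorphism 2 U V \<Phi> \<Psi> \<and> e \<in> Basis \<and> d \<in> Basis \<and> e \<noteq> d \<and>
     \<Phi> (p, f p) \<bullet> e = 0 \<and> \<Phi> (p, f p) \<bullet> d = 0 \<and>
     (\<forall>y\<in>V. y \<bullet> e = 0 \<longrightarrow> y \<bullet> d > 0 \<longrightarrow> fst (\<Psi> y) \<in> - closure \<Omega> \<and> snd (\<Psi> y) = f (fst (\<Psi> y))) \<and>
     (\<forall>y\<in>V. y \<bullet> e = 0 \<longrightarrow> y \<bullet> d = 0 \<longrightarrow> fst (\<Psi> y) \<in> frontier \<Omega> \<and> snd (\<Psi> y) = f (fst (\<Psi> y))) \<and>
     (\<forall>x\<in>- closure \<Omega>. (x, f x) \<in> U \<longrightarrow> \<Phi> (x, f x) \<bullet> e = 0 \<and> \<Phi> (x, f x) \<bullet> d > 0) \<and>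
     (\<forall>x\<in>frontier \<Omega>. (x, f x) \<in> U \<longrightarrow> \<Phi> (x, f x) \<bullet> e = 0 \<and> \<Phi> (x, f x) \<bullet> d = 0)"

lemma Compl_open_eq: "open \<Omega> \<Longrightarrow> - \<Omega> = - closure \<Omega> \<union> frontier \<Omega>"
  using closure_subset[of \<Omega>] by (auto simp: frontier_def interior_open)

lemma half_chart_exists:
  assumes "open \<Omega>" and p: "p \<in> frontier \<Omega>"
    and hyp: "Ck_hypersurface_with_boundary 2 (graph_over (- \<Omega>) f) (graph_over (frontier \<Omega>) f)"
  obtains U V \<Phi> \<Psi> e d where "half_chart \<Omega> f p U V \<Phi> \<Psi> e d"
proof -
  let ?M = "graph_over (- \<Omega>) f" and ?B = "graph_over (frontier \<Omega>) f"
  have M: "- \<Omega> = - closure \<Omega> \<union> frontier \<Omega>" by (rule Compl_open_eq[OF \<open>open \<Omega>\<close>])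
  have dis: "- closure \<Omega> \<inter> frontier \<Omega> = {}" by (auto simp: frontier_def)
  have pB: "(p, f p) \<in> ?B" using p by (simp add: graph_over_def)
  obtain U V \<Phi> \<Psi> e d where e: "e \<in> Basis" and d: "d \<in> Basis - {e}" and pU: "(p, f p) \<in> U"
    and dif: "Ck_diffeomorphism 2 U V \<Phi> \<Psi>"
    and imM: "\<Phi> ` (?M \<inter> U) = V \<inter> {y. y \<bullet> e = 0 \<and> y \<bullet> d \<ge> 0}"
    and imB: "\<Phi> ` (?B \<inter> U) = V \<inter> {y. y \<bullet> e = 0 \<and> y \<bullet> d = 0}"
    using hyp pB unfolding Ck_hypersurface_with_boundary_def by blast
  have hom: "\<And>z. z \<in> U \<Longrightarrow> \<Psi> (\<Phi> z) = z" using dif unfolding Ck_diffeomorphism_def homeomorphism_def by blast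
  have gM: "z \<in> ?M \<longleftrightarrow> fst z \<in> - \<Omega> \<and> snd z = f (fst z)" for z
    by (cases z) (auto simp: graph_over_def)
  have gB: "z \<in> ?B \<longleftrightarrow> fst z \<in> frontier \<Omega> \<and> snd z = f (fst z)" for z
    by (cases z) (auto simp: graph_over_def)
  have onM: "\<Psi> y \<in> ?M \<inter> U \<and> \<Phi> (\<Psi> y) = y" if "y \<in> V" "y \<bullet> e = 0" "y \<bullet> d \<ge> 0" for y
  proof -
    have "y \<in> \<Phi> ` (?M \<inter> U)" unfolding imM using that by blast
    then show ?thesis using hom by force
  qed
  have onB: "\<Psi> y \<in> ?B \<inter> U" if "y \<in> V" "y \<bullet> e = 0" "y \<bullet> d = 0" for y
  proof -
    have "y \<in> \<Phi> ` (?B \<inter> U)" unfolding imB using that by blast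
    then show ?thesis using hom by force
  qed
  have PB: "\<Phi> z \<bullet> e = 0 \<and> \<Phi> z \<bullet> d = 0" if "z \<in> ?B" "z \<in> U" for z
    using imB that by blast
  have PM: "\<Phi> z \<in> V \<and> \<Phi> z \<bullet> e = 0 \<and> \<Phi> z \<bullet> d \<ge> 0" if "z \<in> ?M" "z \<in> U" for z
    using imM that by blast
  have 1: "fst (\<Psi> y) \<in> - closure \<Omega> \<and> snd (\<Psi> y) = f (fst (\<Psi> y))" if y: "y \<in> V" "y \<bullet> e = 0" "y \<bullet> d > 0" for y
  proof -
    have m: "\<Psi> y \<in> ?M" "\<Psi> y \<in> U" "\<Phi> (\<Psi> y) = y" using onM[of y] y by auto
    have "\<Psi> y \<notin> ?B" using PB[of "\<Psi> y"] m y by auto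
    then show ?thesis using m(1) M unfolding gM gB by blast
  qed
  have 2: "fst (\<Psi> y) \<in> frontier \<Omega> \<and> snd (\<Psi> y) = f (fst (\<Psi> y))" if y: "y \<in> V" "y \<bullet> e = 0" "y \<bullet> d = 0" for y
    using onB[OF y] gB by blast
  have 3: "\<Phi> (x, f x) \<bullet> e = 0 \<and> \<Phi> (x, f x) \<bullet> d > 0" if x: "x \<in> - closure \<Omega>" "(x, f x) \<in> U" for x
  proof -
    have xM: "(x, f x) \<in> ?M" "(x, f x) \<notin> ?B" using x M dis by (auto simp: graph_over_def)
    note pm = PM[OF xM(1) x(2)]
    have "\<Phi> (x, f x) \<bullet> d \<noteq> 0"
    proof
      assume "\<Phi> (x, f x) \<bullet> d = 0"
      then have "\<Psi> (\<Phi> (x, f x)) \<in> ?B" using onB pm by blast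
      then show False using hom[OF x(2)] xM(2) by simp
    qed
    then show ?thesis using pm by simp
  qed
  have 4: "\<Phi> (x, f x) \<bullet> e = 0 \<and> \<Phi> (x, f x) \<bullet> d = 0" if "x \<in> frontier \<Omega>" "(x, f x) \<in> U" for x
    using PB[of "(x, f x)"] that by (simp add: graph_over_def)
  have "half_chart \<Omega> f p U V \<Phi> \<Psi> e d"
    unfolding half_chart_def using pU dif e d PB[OF pB pU] 1 2 3 4 by blast
  then show ?thesis by (rule that)
qed

locale vertical_graph =
  fixes \<Omega> :: "(real^'n::finite) set" and f :: "real^'n \<Rightarrow> real"
  assumes open_\<Omega>: "open \<Omega>"
    and cont: "continuous_on (- \<Omega>) f"
    and C2: "Ck_on 2 (- closure \<Omega>) f"
    and const: "\<And>C. C \<in> components (frontier \<Omega>) \<Longrightarrow> f constant_on C"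
    and vertical: "\<And>p. p \<in> frontier \<Omega> \<Longrightarrow>
           filterlim (\<lambda>x. norm (grad f x)) at_top (at p within - closure \<Omega>)"
    and hypersurface: "Ck_hypersurface_with_boundary 2 (graph_over (- \<Omega>) f) (graph_over (frontier \<Omega>) f)"
begin

lemma open_E: "open (- closure \<Omega>)" by auto

lemma graph_neighbourhood:
  assumes p: "p \<in> frontier \<Omega>" and N: "open N" "(p, f p) \<in> N"
  obtains G where "open G" "p \<in> G" "\<And>x. x \<in> G \<Longrightarrow> x \<in> - \<Omega> \<Longrightarrow> (x, f x) \<in> N"
proof -
  have "continuous_on (- \<Omega>) (\<lambda>x. (x, f x))" by (intro continuous_intros cont)
  then obtain G where G: "open G" "G \<inter> - \<Omega> = (\<lambda>x. (x, f x)) -` N \<inter> - \<Omega>"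
    using N(1) unfolding continuous_on_open_invariant by blast
  have "p \<in> - \<Omega>" using p Compl_open_eq[OF open_\<Omega>] by blast
  then have "p \<in> G" using G(2) N(2) by blast
  then show ?thesis using that[OF G(1)] G(2) by blast
qed

text \<open>Near a boundary point the graph is the image of a half ball \<open>D\<close>, whose edge \<open>D0\<close>
  parametrizes the boundary.\<close>

lemma half_ball:
  assumes ch: "half_chart \<Omega> f p U V \<Phi> \<Psi> e d" and p: "p \<in> frontier \<Omega>"
    and r: "r > 0" "ball (\<Phi> (p, f p)) r \<subseteq> V"
  defines "D \<equiv> ball (\<Phi> (p, f p)) r \<inter> {y. y \<bullet> e = 0 \<and> y \<bullet> d > 0}"
    and "D0 \<equiv> ball (\<Phi> (p, f p)) r \<inter> {y. y \<bullet> e = 0 \<and> y \<bullet> d = 0}"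
  obtains G where "open G" "p \<in> G"
    "\<And>x. x \<in> G \<Longrightarrow> x \<in> - closure \<Omega> \<Longrightarrow> (x, f x) \<in> U \<and> \<Phi> (x, f x) \<in> D \<and> \<Psi> (\<Phi> (x, f x)) = (x, f x)"
    "\<And>x. x \<in> G \<Longrightarrow> x \<in> frontier \<Omega> \<Longrightarrow> (x, f x) \<in> U \<and> \<Phi> (x, f x) \<in> D0 \<and> \<Psi> (\<Phi> (x, f x)) = (x, f x)"
proof -
  have dif: "Ck_diffeomorphism 2 U V \<Phi> \<Psi>" and pU: "(p, f p) \<in> U" using ch unfolding half_chart_def by blast+
  have U: "open U" "continuous_on U \<Phi>" "\<And>z. z \<in> U \<Longrightarrow> \<Psi> (\<Phi> z) = z"
    using dif unfolding Ck_diffeomorphism_def homeomorphism_def by blast+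
  define N where "N = U \<inter> \<Phi> -` ball (\<Phi> (p, f p)) r"
  have "open N" unfolding N_def by (rule continuous_open_preimage[OF U(2,1) open_ball])
  moreover have "(p, f p) \<in> N" using pU r by (simp add: N_def)
  ultimately obtain G where G: "open G" "p \<in> G" "\<And>x. x \<in> G \<Longrightarrow> x \<in> - \<Omega> \<Longrightarrow> (x, f x) \<in> N"
    using graph_neighbourhood[OF p] by blast
  have M: "- \<Omega> = - closure \<Omega> \<union> frontier \<Omega>" by (rule Compl_open_eq[OF open_\<Omega>])
  show ?thesis
  proof (rule that[OF G(1,2)])
    fix x assume x: "x \<in> G" "x \<in> - closure \<Omega>"
    then have n: "(x, f x) \<in> N" using G(3) M by blast
    then have "(x, f x) \<in> U" by (simp add: N_def)
    moreover have "\<Phi> (x, f x) \<bullet> e = 0 \<and> \<Phi> (x, f x) \<bullet> d > 0"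
      using ch x(2) \<open>(x, f x) \<in> U\<close> unfolding half_chart_def by blast
    ultimately show "(x, f x) \<in> U \<and> \<Phi> (x, f x) \<in> D \<and> \<Psi> (\<Phi> (x, f x)) = (x, f x)"
      using n U(3) unfolding N_def D_def by blast
  next
    fix x assume x: "x \<in> G" "x \<in> frontier \<Omega>"
    then have n: "(x, f x) \<in> N" using G(3) M by blast
    then have "(x, f x) \<in> U" by (simp add: N_def)
    moreover have "\<Phi> (x, f x) \<bullet> e = 0 \<and> \<Phi> (x, f x) \<bullet> d = 0"
      using ch x(2) \<open>(x, f x) \<in> U\<close> unfolding half_chart_def by blast
    ultimately show "(x, f x) \<in> U \<and> \<Phi> (x, f x) \<in> D0 \<and> \<Psi> (\<Phi> (x, f x)) = (x, f x)"
      using n U(3) unfolding N_def D0_def by blast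
  qed
qed

lemma chart_ball:
  assumes ch: "half_chart \<Omega> f p U V \<Phi> \<Psi> e d"
  obtains r where "r > 0" "ball (\<Phi> (p, f p)) r \<subseteq> V"
proof -
  have "(p, f p) \<in> U" "open V" "\<Phi> ` U = V"
    using ch unfolding half_chart_def Ck_diffeomorphism_def homeomorphism_def by simp_all
  then have "\<Phi> (p, f p) \<in> V" by blast
  show ?thesis by (rule openE[OF \<open>open V\<close> \<open>\<Phi> (p, f p) \<in> V\<close>]) (rule that)
qed

lemma connected_half_ball:
  fixes y0 e d :: "'b::euclidean_space"
  shows "connected (ball y0 r \<inter> {y. y \<bullet> e = 0 \<and> y \<bullet> d > 0})"
    "connected (ball y0 r \<inter> {y. y \<bullet> e = 0 \<and> y \<bullet> d = 0})"
proof -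
  have "{y. y \<bullet> e = 0 \<and> y \<bullet> d > 0} = {y. e \<bullet> y = 0} \<inter> {y. d \<bullet> y > 0}"
    "{y. y \<bullet> e = 0 \<and> y \<bullet> d = 0} = {y. e \<bullet> y = 0} \<inter> {y. d \<bullet> y = 0}" by (auto simp: inner_commute)
  then show "connected (ball y0 r \<inter> {y. y \<bullet> e = 0 \<and> y \<bullet> d > 0})"
    "connected (ball y0 r \<inter> {y. y \<bullet> e = 0 \<and> y \<bullet> d = 0})"
    by (auto intro!: convex_connected convex_Int convex_hyperplane convex_halfspace_gt)
qed

lemma frontier_approachable:
  assumes p: "p \<in> frontier \<Omega>" and "open G" "p \<in> G"
  shows "G \<inter> - closure \<Omega> \<noteq> {}"
proof -
  obtain U V \<Phi> \<Psi> e d where ch: "half_chart \<Omega> f p U V \<Phi> \<Psi> e d"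
    using half_chart_exists[OF open_\<Omega> p hypersurface] .
  obtain r where r: "r > 0" "ball (\<Phi> (p, f p)) r \<subseteq> V" using chart_ball[OF ch] .
  define y0 where "y0 = \<Phi> (p, f p)"
  have ed: "e \<in> Basis" "d \<in> Basis" "e \<noteq> d" "y0 \<bullet> e = 0" "y0 \<bullet> d = 0" and dif: "Ck_diffeomorphism 2 U V \<Phi> \<Psi>"
    and pU: "(p, f p) \<in> U"
    using ch unfolding half_chart_def y0_def by blast+
  have V: "open V" "continuous_on V \<Psi>" "\<Psi> y0 = (p, f p)"
    using dif pU unfolding Ck_diffeomorphism_def homeomorphism_def y0_def by blast+
  have y0V: "y0 \<in> V" using r by (auto simp: y0_def)
  have "isCont \<Psi> y0" using V(1,2) y0V continuous_on_eq_continuous_at by blast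
  then have "((\<lambda>t. fst (\<Psi> (y0 + t *\<^sub>R d))) \<longlongrightarrow> fst (\<Psi> (y0 + 0 *\<^sub>R d))) (at_right 0)"
    by (intro tendsto_intros isCont_tendsto_compose[of _ \<Psi>]) auto
  then have 1: "\<forall>\<^sub>F t in at_right 0. fst (\<Psi> (y0 + t *\<^sub>R d)) \<in> G"
    using V(3) \<open>open G\<close> \<open>p \<in> G\<close> by (intro topological_tendstoD) auto
  have 2: "\<forall>\<^sub>F t in at_right (0::real). 0 < t \<and> t < r"
    using eventually_at_right_real[OF r(1)] by simp
  obtain t where t: "fst (\<Psi> (y0 + t *\<^sub>R d)) \<in> G" "0 < t" "t < r"
    using eventually_happens[OF eventually_conj[OF 1 2]] trivial_limit_at_right_real by auto
  have "y0 + t *\<^sub>R d \<in> V" using r(2) t ed(2) by (intro subsetD[OF r(2)]) (auto simp: y0_def dist_norm)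
  moreover have "(y0 + t *\<^sub>R d) \<bullet> e = 0" "(y0 + t *\<^sub>R d) \<bullet> d > 0"
    using ed t by (auto simp: inner_add_left inner_Basis)
  ultimately have "fst (\<Psi> (y0 + t *\<^sub>R d)) \<in> - closure \<Omega>"
    using ch unfolding half_chart_def by blast
  then show ?thesis using t by blast
qed

lemma at_frontier_neq_bot: "p \<in> frontier \<Omega> \<Longrightarrow> at p within - closure \<Omega> \<noteq> bot"
proof -
  assume p: "p \<in> frontier \<Omega>"
  have "p islimpt - closure \<Omega>"
  proof (rule islimptI)
    fix G assume "p \<in> G" "open G"
    then obtain y where "y \<in> G" "y \<in> - closure \<Omega>" using frontier_approachable[OF p] by blast
    moreover have "y \<noteq> p" using \<open>y \<in> - closure \<Omega>\<close> p by (auto simp: frontier_def)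
    ultimately show "\<exists>y\<in>- closure \<Omega>. y \<in> G \<and> y \<noteq> p" by blast
  qed
  then show ?thesis by (simp add: trivial_limit_within)
qed

lemma connected_E:
  assumes "connected (graph_over (- \<Omega>) f)"
  shows "connected (- closure \<Omega>)"
proof (rule ccontr)
  assume "\<not> connected (- closure \<Omega>)"
  then obtain E1 E2 where E: "open E1" "open E2" "E1 \<inter> E2 \<inter> - closure \<Omega> = {}" "- closure \<Omega> \<subseteq> E1 \<union> E2"
    "E1 \<inter> - closure \<Omega> \<noteq> {}" "E2 \<inter> - closure \<Omega> \<noteq> {}"
    unfolding connected_def by blast
  let ?E1 = "E1 \<inter> - closure \<Omega>" and ?E2 = "E2 \<inter> - closure \<Omega>"
  have "- \<Omega> = fst ` graph_over (- \<Omega>) f" by (auto simp: graph_over_def image_image)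
  then have con: "connected (- \<Omega>)"
    using connected_continuous_image[OF continuous_on_fst[OF continuous_on_id] assms] by simp
  have M: "- \<Omega> = - closure \<Omega> \<union> frontier \<Omega>" by (rule Compl_open_eq[OF open_\<Omega>])
  have cover: "- \<Omega> \<subseteq> closure ?E1 \<union> closure ?E2"
  proof
    fix x assume x: "x \<in> - \<Omega>"
    have "x \<in> closure (- closure \<Omega>)"
    proof (cases "x \<in> frontier \<Omega>")
      case True
      show ?thesis unfolding closure_iff_nhds_not_empty
        using frontier_approachable[OF True] by blast
    next
      case False
      then show ?thesis using x M closure_subset by blast
    qed
    moreover have "- closure \<Omega> = ?E1 \<union> ?E2" using E(4) by blast
    ultimately show "x \<in> closure ?E1 \<union> closure ?E2" by (metis closure_Un)
  qed
  have sub: "closure ?E1 \<subseteq> - \<Omega>" "closure ?E2 \<subseteq> - \<Omega>"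
    using closure_subset[of \<Omega>] open_\<Omega> by (intro closure_minimal; auto)+
  have "closure ?E1 \<inter> - \<Omega> \<noteq> {}" "closure ?E2 \<inter> - \<Omega> \<noteq> {}"
    using sub E(5,6) closure_subset[of ?E1] closure_subset[of ?E2] by blast+
  then have "closure ?E1 \<inter> closure ?E2 \<inter> - \<Omega> \<noteq> {}"
    using con cover unfolding connected_closed by (metis closed_closure)
  then obtain p where p: "p \<in> closure ?E1" "p \<in> closure ?E2" "p \<in> - \<Omega>" by blast
  have opn: "open ?E1" "open ?E2" using E(1,2) open_E by auto
  have pf: "p \<in> frontier \<Omega>"
  proof (rule ccontr)
    assume "p \<notin> frontier \<Omega>"
    then have "p \<in> ?E1 \<or> p \<in> ?E2" using p(3) M E(4) by blast
    then show False
    proof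
      assume "p \<in> ?E1"
      then have "?E1 \<inter> ?E2 \<noteq> {}"
        using p(2) open_Int_closure_eq_empty[OF opn(1), of ?E2] by (metis IntI empty_iff)
      then show False using E(3) by blast
    next
      assume "p \<in> ?E2"
      then have "?E2 \<inter> ?E1 \<noteq> {}"
        using p(1) open_Int_closure_eq_empty[OF opn(2), of ?E1] by (metis IntI empty_iff)
      then show False using E(3) by blast
    qed
  qed
  obtain U V \<Phi> \<Psi> e d where ch: "half_chart \<Omega> f p U V \<Phi> \<Psi> e d"
    using half_chart_exists[OF open_\<Omega> pf hypersurface] .
  obtain r where r: "r > 0" "ball (\<Phi> (p, f p)) r \<subseteq> V" using chart_ball[OF ch] .
  let ?D = "ball (\<Phi> (p, f p)) r \<inter> {y. y \<bullet> e = 0 \<and> y \<bullet> d > 0}"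
  obtain G where G: "open G" "p \<in> G" "\<And>x. x \<in> G \<Longrightarrow> x \<in> - closure \<Omega> \<Longrightarrow> (x, f x) \<in> U \<and>
      \<Phi> (x, f x) \<in> ball (\<Phi> (p, f p)) r \<inter> {y. y \<bullet> e = 0 \<and> y \<bullet> d > 0} \<and> \<Psi> (\<Phi> (x, f x)) = (x, f x)"
    "\<And>x. x \<in> G \<Longrightarrow> x \<in> frontier \<Omega> \<Longrightarrow> (x, f x) \<in> U \<and>
      \<Phi> (x, f x) \<in> ball (\<Phi> (p, f p)) r \<inter> {y. y \<bullet> e = 0 \<and> y \<bullet> d = 0} \<and> \<Psi> (\<Phi> (x, f x)) = (x, f x)"
      by (rule half_ball[OF ch pf r]) (rule that)
  define I where "I = (\<lambda>y. fst (\<Psi> y)) ` ?D"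
  have "continuous_on V \<Psi>" using ch unfolding half_chart_def Ck_diffeomorphism_def homeomorphism_def by blast
  then have "continuous_on ?D (\<lambda>y. fst (\<Psi> y))"
    by (intro continuous_on_fst) (rule continuous_on_subset, use r in auto)
  then have conI: "connected I" unfolding I_def
    using connected_half_ball(1) by (rule connected_continuous_image)
  have IE: "I \<subseteq> - closure \<Omega>"
  proof
    fix x assume "x \<in> I"
    then obtain y where "y \<in> V" "y \<bullet> e = 0" "y \<bullet> d > 0" "x = fst (\<Psi> y)" using r(2) by (auto simp: I_def)
    then show "x \<in> - closure \<Omega>" using ch unfolding half_chart_def by blast
  qed
  have OI: "G \<inter> - closure \<Omega> \<subseteq> I"
  proof
    fix x assume "x \<in> G \<inter> - closure \<Omega>"
    then have y: "\<Phi> (x, f x) \<in> ?D" "\<Psi> (\<Phi> (x, f x)) = (x, f x)" using G(3)[of x] by blast+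
    have "x = fst (\<Psi> (\<Phi> (x, f x)))" unfolding y(2) by simp
    then show "x \<in> I" unfolding I_def using y(1) by (rule image_eqI)
  qed
  have "G \<inter> ?E1 \<noteq> {}" "G \<inter> ?E2 \<noteq> {}"
    using p(1,2) G(2) open_Int_closure_eq_empty[OF G(1), of ?E1] open_Int_closure_eq_empty[OF G(1), of ?E2]
    by (metis IntI empty_iff)+
  then have "E1 \<inter> I \<noteq> {}" "E2 \<inter> I \<noteq> {}" using OI by blast+
  moreover have "E1 \<inter> E2 \<inter> I = {}" "I \<subseteq> E1 \<union> E2" using E(3,4) IE by blast+
  ultimately show False using conI E(1,2) unfolding connected_def by blast
qed

lemma tendsto_graph_point:
  assumes p: "p \<in> frontier \<Omega>" and \<phi>: "continuous_on U \<phi>" "open U" "(p, f p) \<in> U"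
  shows "((\<lambda>x. \<phi> (x, f x)) \<longlongrightarrow> \<phi> (p, f p)) (at p within - closure \<Omega>)"
proof -
  have M: "- \<Omega> = - closure \<Omega> \<union> frontier \<Omega>" by (rule Compl_open_eq[OF open_\<Omega>])
  have "(f \<longlongrightarrow> f p) (at p within - \<Omega>)" using cont p M by (auto simp: continuous_on_def)
  then have "(f \<longlongrightarrow> f p) (at p within - closure \<Omega>)" by (rule tendsto_within_subset) (use M in blast)
  then have "((\<lambda>x. (x, f x)) \<longlongrightarrow> (p, f p)) (at p within - closure \<Omega>)"
    by (intro tendsto_Pair tendsto_ident_at)
  moreover have "isCont \<phi> (p, f p)" using \<phi> continuous_on_eq_continuous_at by blast
  ultimately show ?thesis by (rule isCont_tendsto_compose[rotated])
qed

context
  fixes p U V \<Phi> \<Psi> e d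
  assumes p: "p \<in> frontier \<Omega>" and ch: "half_chart \<Omega> f p U V \<Phi> \<Psi> e d"
begin

private abbreviation "F \<equiv> \<lambda>z. \<Phi> z \<bullet> e"
private abbreviation "a \<equiv> \<lambda>i z. frechet_derivative F (at z) (axis i 1, 0)"
private abbreviation "c \<equiv> \<lambda>z. frechet_derivative F (at z) (0, 1)"

private lemma UV:
  "open U" "open V" "(p, f p) \<in> U" "Ck_on 2 U \<Phi>" "Ck_on 2 V \<Psi>"
  "\<And>z. z \<in> U \<Longrightarrow> \<Phi> z \<in> V \<and> \<Psi> (\<Phi> z) = z" "\<And>y. y \<in> V \<Longrightarrow> \<Psi> y \<in> U \<and> \<Phi> (\<Psi> y) = y"
  "e \<in> Basis" "d \<in> Basis" "e \<noteq> d"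
proof -
  have dif: "Ck_diffeomorphism 2 U V \<Phi> \<Psi>"
    and 1: "(p, f p) \<in> U" "e \<in> Basis" "d \<in> Basis" "e \<noteq> d"
    using ch unfolding half_chart_def by simp_all
  have hom: "homeomorphism U V \<Phi> \<Psi>" and 2: "open U" "open V" "Ck_on 2 U \<Phi>" "Ck_on 2 V \<Psi>"
    using dif unfolding Ck_diffeomorphism_def by simp_all
  have 3: "\<Phi> z \<in> V \<and> \<Psi> (\<Phi> z) = z" if "z \<in> U" for z
    using hom that unfolding homeomorphism_def by blast
  have 4: "\<Psi> y \<in> U \<and> \<Phi> (\<Psi> y) = y" if "y \<in> V" for y
    using hom that unfolding homeomorphism_def by blast
  show "open U" "open V" "(p, f p) \<in> U" "Ck_on 2 U \<Phi>" "Ck_on 2 V \<Psi>"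
    "\<And>z. z \<in> U \<Longrightarrow> \<Phi> z \<in> V \<and> \<Psi> (\<Phi> z) = z" "\<And>y. y \<in> V \<Longrightarrow> \<Psi> y \<in> U \<and> \<Phi> (\<Psi> y) = y"
    "e \<in> Basis" "d \<in> Basis" "e \<noteq> d"
    by (fact 1 2 3 4)+
qed

private lemma F2: "Ck_on (Suc (Suc 0)) U F"
  using Ck_on_bounded_linear[OF bounded_linear_inner_left UV(1,4)] by (simp add: numeral_2_eq_2)

private lemma a1: "Ck_on (Suc 0) U (a i)"
  by (rule Ck_on_partial[OF F2]) (simp add: Basis_prod_def axis_Basis)

private lemma c1: "Ck_on (Suc 0) U c"
  by (rule Ck_on_partial[OF F2]) (simp add: Basis_prod_def)

private lemma nonzero_normal:
  assumes z: "z \<in> U" shows "(\<Sum>i\<in>UNIV. (a i z)\<^sup>2) + (c z)\<^sup>2 > 0"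
proof (rule ccontr)
  assume "\<not> ?thesis"
  moreover have "(\<Sum>i\<in>UNIV. (a i z)\<^sup>2) \<ge> 0" by (simp add: sum_nonneg)
  ultimately have "(\<Sum>i\<in>UNIV. (a i z)\<^sup>2) = 0" and c0: "c z = 0"
    by (smt (verit) zero_le_power2 power_eq_0_iff)+
  then have a0: "a i z = 0" for i by (simp add: sum_nonneg_eq_0_iff)
  have DF: "(F has_derivative frechet_derivative F (at z)) (at z)" by (rule Ck_on_has_derivative[OF F2 z])
  have zero: "frechet_derivative F (at z) v = 0" for v
  proof -
    have "frechet_derivative F (at z) b = 0" if "b \<in> Basis" for b
    proof -
      have "b = (0, 1) \<or> (\<exists>i. b = (axis i 1, 0))" using that by (auto simp: Basis_prod_def Basis_vec_def)
      then show ?thesis using a0 c0 by blast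
    qed
    then show ?thesis
      using linear_Basis_expansion[OF has_derivative_linear[OF DF], of v] by simp
  qed
  have y: "\<Phi> z \<in> V" "\<Psi> (\<Phi> z) = z" using UV(6)[OF z] by blast+
  have P: "(\<Psi> has_derivative frechet_derivative \<Psi> (at (\<Phi> z))) (at (\<Phi> z))"
    using UV(5) y(1) by (intro Ck_on_has_derivative) (simp_all add: numeral_2_eq_2)
  have "((\<lambda>y. F (\<Psi> y)) has_derivative (\<lambda>v. frechet_derivative F (at z) (frechet_derivative \<Psi> (at (\<Phi> z)) v))) (at (\<Phi> z))"
    by (rule has_derivative_compose[OF P]) (use DF y in simp)
  then have 1: "((\<lambda>y. F (\<Psi> y)) has_derivative (\<lambda>v. 0)) (at (\<Phi> z))" by (simp only: zero)
  have "((\<lambda>y. y \<bullet> e) has_derivative (\<lambda>v. 0)) (at (\<Phi> z))"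
    by (rule has_derivative_transform_within_open[OF 1 UV(2) y(1)]) (use UV(7) in auto)
  moreover have "((\<lambda>y. y \<bullet> e) has_derivative (\<lambda>v. v \<bullet> e)) (at (\<Phi> z))"
    by (intro bounded_linear_imp_has_derivative bounded_linear_inner_left)
  ultimately have "(\<lambda>v::(real^'n) \<times> real. 0) = (\<lambda>v. v \<bullet> e)" by (rule has_derivative_unique)
  then have "e \<bullet> e = 0" by (metis)
  then show False using UV(8) by (simp add: inner_Basis)
qed

private definition "S = {x \<in> - closure \<Omega>. (x, f x) \<in> U}"

private lemma S: "open S" "\<And>x. x \<in> S \<Longrightarrow> (x, f x) \<in> U \<and> F (x, f x) = 0" "Ck_on 2 S f"
proof -
  have "continuous_on (- closure \<Omega>) (\<lambda>x. (x, f x))"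
    by (intro continuous_intros continuous_on_subset[OF cont]) (use closure_subset in auto)
  then have "open (- closure \<Omega> \<inter> (\<lambda>x. (x, f x)) -` U)"
    by (rule continuous_open_preimage[OF _ open_E UV(1)])
  moreover have "- closure \<Omega> \<inter> (\<lambda>x. (x, f x)) -` U = S" by (auto simp: S_def)
  ultimately show "open S" by simp
  show "(x, f x) \<in> U \<and> F (x, f x) = 0" if "x \<in> S" for x
    using that ch unfolding S_def half_chart_def by blast
  show "Ck_on 2 S f" by (rule Ck_on_subset[OF C2]) (auto simp: S_def)
qed

private lemma grad_eq: "x \<in> S \<Longrightarrow> a i (x, f x) + c (x, f x) * pd i f x = 0"
  by (rule implicit_derivatives(1)[OF _ S(3,1) _ S(2)]) (use F2 in \<open>simp_all add: numeral_2_eq_2\<close>)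

private lemma c_nonzero: assumes x: "x \<in> S" shows "c (x, f x) \<noteq> 0"
proof
  assume "c (x, f x) = 0"
  moreover from this have "a i (x, f x) = 0" for i using grad_eq[OF x, of i] by simp
  ultimately show False using nonzero_normal[of "(x, f x)"] S(2)[OF x] by simp
qed

private lemma vertical_tangent: "c (p, f p) = 0"
proof (rule ccontr)
  assume c0: "c (p, f p) \<noteq> 0"
  let ?l = "sqrt (\<Sum>i\<in>UNIV. (a i (p, f p))\<^sup>2) / \<bar>c (p, f p)\<bar>"
  have "((\<lambda>x. sqrt (\<Sum>i\<in>UNIV. (a i (x, f x))\<^sup>2) / \<bar>c (x, f x)\<bar>) \<longlongrightarrow> ?l) (at p within - closure \<Omega>)"
    by (intro tendsto_intros tendsto_graph_point[OF p _ UV(1,3)] Ck_on_continuous[OF a1] Ck_on_continuous[OF c1])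
      (use c0 in simp)
  moreover have "\<forall>\<^sub>F x in at p within - closure \<Omega>.
      sqrt (\<Sum>i\<in>UNIV. (a i (x, f x))\<^sup>2) / \<bar>c (x, f x)\<bar> = norm (grad f x)"
  proof -
    obtain r where r: "r > 0" "ball (\<Phi> (p, f p)) r \<subseteq> V" using chart_ball[OF ch] .
    obtain G where G: "open G" "p \<in> G" "\<And>x. x \<in> G \<Longrightarrow> x \<in> - closure \<Omega> \<Longrightarrow> (x, f x) \<in> U \<and>
      \<Phi> (x, f x) \<in> ball (\<Phi> (p, f p)) r \<inter> {y. y \<bullet> e = 0 \<and> y \<bullet> d > 0} \<and> \<Psi> (\<Phi> (x, f x)) = (x, f x)"
    "\<And>x. x \<in> G \<Longrightarrow> x \<in> frontier \<Omega> \<Longrightarrow> (x, f x) \<in> U \<and>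
      \<Phi> (x, f x) \<in> ball (\<Phi> (p, f p)) r \<inter> {y. y \<bullet> e = 0 \<and> y \<bullet> d = 0} \<and> \<Psi> (\<Phi> (x, f x)) = (x, f x)"
      by (rule half_ball[OF ch p r]) (rule that)
    have "\<forall>\<^sub>F x in at p within - closure \<Omega>. x \<in> G \<and> x \<in> - closure \<Omega>"
      using G(1,2) by (auto simp: eventually_at_topological)
    then show ?thesis
    proof (rule eventually_mono)
      fix x assume "x \<in> G \<and> x \<in> - closure \<Omega>"
      then have x: "x \<in> S" using G(3) by (auto simp: S_def)
      have "a i (x, f x) = - (c (x, f x) * grad f x $ i)" for i
        using grad_eq[OF x, of i] by (simp add: grad_def)
      then have "(\<Sum>i\<in>UNIV. (a i (x, f x))\<^sup>2) = (c (x, f x))\<^sup>2 * (norm (grad f x))\<^sup>2"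
        by (simp add: power2_norm_sum power_mult_distrib sum_distrib_left)
      then have "sqrt (\<Sum>i\<in>UNIV. (a i (x, f x))\<^sup>2) = \<bar>c (x, f x)\<bar> * norm (grad f x)"
        by (simp add: real_sqrt_mult)
      then show "sqrt (\<Sum>i\<in>UNIV. (a i (x, f x))\<^sup>2) / \<bar>c (x, f x)\<bar> = norm (grad f x)"
        using c_nonzero[OF x] by simp
    qed
  qed
  ultimately have "((\<lambda>x. norm (grad f x)) \<longlongrightarrow> ?l) (at p within - closure \<Omega>)"
    by (rule Lim_transform_eventually)
  moreover have "filterlim (\<lambda>x. norm (grad f x)) at_infinity (at p within - closure \<Omega>)"
    by (rule filterlim_at_top_imp_at_infinity[OF vertical[OF p]])
  ultimately show False
    using not_tendsto_and_filterlim_at_infinity[OF at_frontier_neq_bot[OF p]] by blast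
qed

private lemma mean_curvature_limit_chart:
  "\<exists>l. (graph_mean_curvature f \<longlongrightarrow> l) (at p within - closure \<Omega>)"
proof -
  obtain r where r: "r > 0" "ball (\<Phi> (p, f p)) r \<subseteq> V" using chart_ball[OF ch] .
  let ?D = "ball (\<Phi> (p, f p)) r \<inter> {y. y \<bullet> e = 0 \<and> y \<bullet> d > 0}"
  obtain G where G: "open G" "p \<in> G" "\<And>x. x \<in> G \<Longrightarrow> x \<in> - closure \<Omega> \<Longrightarrow> (x, f x) \<in> U \<and>
      \<Phi> (x, f x) \<in> ball (\<Phi> (p, f p)) r \<inter> {y. y \<bullet> e = 0 \<and> y \<bullet> d > 0} \<and> \<Psi> (\<Phi> (x, f x)) = (x, f x)"
    "\<And>x. x \<in> G \<Longrightarrow> x \<in> frontier \<Omega> \<Longrightarrow> (x, f x) \<in> U \<and>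
      \<Phi> (x, f x) \<in> ball (\<Phi> (p, f p)) r \<inter> {y. y \<bullet> e = 0 \<and> y \<bullet> d = 0} \<and> \<Psi> (\<Phi> (x, f x)) = (x, f x)"
      by (rule half_ball[OF ch p r]) (rule that)
  have "\<exists>\<sigma>. \<forall>y\<in>?D. sgn (c (\<Psi> y)) = \<sigma>"
  proof -
    have DV: "?D \<subseteq> V" using r(2) by blast
    have "continuous_on ?D (\<lambda>y. c (\<Psi> y))"
    proof (rule continuous_on_compose2[OF Ck_on_continuous[OF c1]])
      show "continuous_on ?D \<Psi>" by (rule continuous_on_subset[OF Ck_on_continuous[OF UV(5)] DV])
      show "\<Psi> ` ?D \<subseteq> U" using UV(7) DV by blast
    qed
    then have con: "connected ((\<lambda>y. c (\<Psi> y)) ` ?D)"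
      using connected_half_ball(1) by (rule connected_continuous_image)
    have "c (\<Psi> y) \<noteq> 0" if y: "y \<in> ?D" for y
    proof -
      have "fst (\<Psi> y) \<in> - closure \<Omega> \<and> snd (\<Psi> y) = f (fst (\<Psi> y))"
        using ch y DV unfolding half_chart_def by blast
      then have e: "\<Psi> y = (fst (\<Psi> y), f (fst (\<Psi> y)))" "fst (\<Psi> y) \<in> - closure \<Omega>"
        by (metis prod.collapse, blast)
      moreover have "\<Psi> y \<in> U" using UV(7) y DV by blast
      ultimately have "fst (\<Psi> y) \<in> S" by (simp add: S_def)
      from c_nonzero[OF this] show ?thesis using e(1) by simp
    qed
    then have "0 \<notin> (\<lambda>y. c (\<Psi> y)) ` ?D" by force
    then have "sgn u = sgn v" if "u \<in> (\<lambda>y. c (\<Psi> y)) ` ?D" "v \<in> (\<lambda>y. c (\<Psi> y)) ` ?D" for u v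
      using connectedD_interval[OF con that, of 0] connectedD_interval[OF con that(2,1), of 0] that
      by (auto simp: sgn_if not_less)
    then show ?thesis by blast
  qed
  then obtain \<sigma> where \<sigma>: "\<And>y. y \<in> ?D \<Longrightarrow> sgn (c (\<Psi> y)) = \<sigma>" by blast
  define A where "A i j z = frechet_derivative (a i) (at z) (axis j 1, 0)" for i j z
  define Az where "Az i z = frechet_derivative (a i) (at z) (0, 1)" for i z
  define Ca where "Ca j z = frechet_derivative c (at z) (axis j 1, 0)" for j z
  define Cc where "Cc z = frechet_derivative c (at z) (0, 1)" for z
  define m where "m z = (\<Sum>i\<in>UNIV. (a i z)\<^sup>2) + (c z)\<^sup>2" for z
  define K where "K z = ((\<Sum>i\<in>UNIV. \<Sum>j\<in>UNIV. ((if i = j then 1 else 0) - a i z * a j z / m z) * A i j z)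
      - (\<Sum>i\<in>UNIV. (Az i z + Ca i z) * a i z) * c z / m z + Cc z * (\<Sum>i\<in>UNIV. (a i z)\<^sup>2) / m z)" for z
  have H: "graph_mean_curvature f x = - sgn (c (x, f x)) * K (x, f x) / sqrt (m (x, f x))" if x: "x \<in> S" for x
    unfolding graph_mean_curvature_def graph_W_eq[symmetric] graph_W_def K_def m_def hess_def
  proof (simp only: vec_lambda_beta, rule mean_curvature_implicit_algebra[OF c_nonzero[OF x] grad_eq[OF x]])
    fix i j
    show "A i j (x, f x) + Az i (x, f x) * pd j f x + (Ca j (x, f x) + Cc (x, f x) * pd j f x) * pd i f x
        + c (x, f x) * pd j (pd i f) x = 0"
      unfolding A_def Az_def Ca_def Cc_def
      by (rule implicit_derivatives(2)[OF _ S(3,1) x S(2)]) (use F2 in \<open>simp_all add: numeral_2_eq_2\<close>)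
  qed
  have ac: "continuous_on U (a i)" "continuous_on U c" for i
    by (rule Ck_on_continuous[OF a1], rule Ck_on_continuous[OF c1])
  have AC: "continuous_on U (A i j)" "continuous_on U (Az i)" "continuous_on U (Ca j)" "continuous_on U Cc" for i j
    unfolding A_def Az_def Ca_def Cc_def
    by (rule Ck_on_continuous_derivative[OF a1] Ck_on_continuous_derivative[OF c1])+
  have m0: "m z \<noteq> 0" "sqrt (m z) \<noteq> 0" if "z \<in> U" for z
    using nonzero_normal[OF that] by (auto simp: m_def)
  have "continuous_on U m" unfolding m_def by (intro continuous_intros ac)
  then have "continuous_on U (\<lambda>z. - \<sigma> * K z / sqrt (m z))"
    unfolding K_def by (intro continuous_intros ac AC ballI m0)
  from tendsto_graph_point[OF p this UV(1,3)]
  have "((\<lambda>x. - \<sigma> * K (x, f x) / sqrt (m (x, f x))) \<longlongrightarrow> - \<sigma> * K (p, f p) / sqrt (m (p, f p))) (at p within - closure \<Omega>)" .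
  moreover have "\<forall>\<^sub>F x in at p within - closure \<Omega>. - \<sigma> * K (x, f x) / sqrt (m (x, f x)) = graph_mean_curvature f x"
  proof -
    have "\<forall>\<^sub>F x in at p within - closure \<Omega>. x \<in> G \<and> x \<in> - closure \<Omega>"
      using G(1,2) by (auto simp: eventually_at_topological)
    then show ?thesis
    proof (rule eventually_mono)
      fix x assume x: "x \<in> G \<and> x \<in> - closure \<Omega>"
      then have "x \<in> S" using G(3) by (auto simp: S_def)
      moreover have "sgn (c (x, f x)) = \<sigma>" using \<sigma>[of "\<Phi> (x, f x)"] G(3)[of x] x by simp
      ultimately show "- \<sigma> * K (x, f x) / sqrt (m (x, f x)) = graph_mean_curvature f x" by (simp add: H)
    qed
  qed
  ultimately show ?thesis using Lim_transform_eventually by blast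
qed

private lemma boundary_sign_chart:
  "\<exists>G. open G \<and> p \<in> G \<and> G \<inter> frontier \<Omega> \<subseteq> connected_component_set (frontier \<Omega>) p \<and>
     ((\<forall>x\<in>G \<inter> - closure \<Omega>. f x > f p) \<or> (\<forall>x\<in>G \<inter> - closure \<Omega>. f x < f p))"
proof -
  define y0 where "y0 = \<Phi> (p, f p)"
  have y0: "y0 \<bullet> e = 0" "y0 \<bullet> d = 0" "y0 \<in> V" "\<Psi> y0 = (p, f p)"
    using ch UV(6)[OF UV(3)] unfolding half_chart_def y0_def by auto
  define z where "z y = snd (\<Psi> y)" for y
  have P2: "Ck_on (Suc (Suc 0)) V \<Psi>" using UV(5) by (simp add: numeral_2_eq_2)
  define z' where "z' y v = snd (frechet_derivative \<Psi> (at y) v)" for y v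
  have zd: "(z has_derivative z' y) (at y)" if "y \<in> V" for y
    unfolding z_def z'_def by (intro derivative_intros Ck_on_has_derivative[OF P2 that])
  have z'cont: "continuous_on V (\<lambda>y. z' y v)" for v
    unfolding z'_def by (intro continuous_on_snd Ck_on_continuous_derivative[OF P2])
  have linz: "linear (z' y0)" using zd[OF y0(3)] by (rule has_derivative_linear)
  obtain r where r: "r > 0" "ball y0 r \<subseteq> V" using chart_ball[OF ch] unfolding y0_def .
  define D0 where "D0 r = ball y0 r \<inter> {y. y \<bullet> e = 0 \<and> y \<bullet> d = 0}" for r
  have fst_conn: "(\<lambda>y. fst (\<Psi> y)) ` D0 r \<subseteq> connected_component_set (frontier \<Omega>) p"
  proof (rule connected_component_maximal)
    show "p \<in> (\<lambda>y. fst (\<Psi> y)) ` D0 r" using y0 r by (intro image_eqI[of _ _ y0]) (auto simp: D0_def)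
    have "continuous_on (D0 r) (\<lambda>y. fst (\<Psi> y))"
      by (intro continuous_on_fst continuous_on_subset[OF Ck_on_continuous[OF P2]]) (use r in \<open>auto simp: D0_def\<close>)
    then show "connected ((\<lambda>y. fst (\<Psi> y)) ` D0 r)" unfolding D0_def
      using connected_half_ball(2) by (rule connected_continuous_image)
    show "(\<lambda>y. fst (\<Psi> y)) ` D0 r \<subseteq> frontier \<Omega>"
    proof
      fix x assume "x \<in> (\<lambda>y. fst (\<Psi> y)) ` D0 r"
      then obtain y where "y \<in> V" "y \<bullet> e = 0" "y \<bullet> d = 0" "x = fst (\<Psi> y)" using r(2) by (auto simp: D0_def)
      then show "x \<in> frontier \<Omega>" using ch unfolding half_chart_def by blast
    qed
  qed
  have zc: "z y = f p" if y: "y \<in> D0 r" for y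
  proof -
    have "f constant_on connected_component_set (frontier \<Omega>) p"
      by (rule const) (simp add: componentsI p)
    moreover have "fst (\<Psi> y) \<in> connected_component_set (frontier \<Omega>) p" using fst_conn y by blast
    moreover have "p \<in> connected_component_set (frontier \<Omega>) p" using p by simp
    ultimately have "f (fst (\<Psi> y)) = f p" unfolding constant_on_def by metis
    moreover have "snd (\<Psi> y) = f (fst (\<Psi> y))"
      using ch y r(2) unfolding half_chart_def D0_def by blast
    ultimately show ?thesis by (simp add: z_def)
  qed
  have tang: "z' y0 b = 0" if b: "b \<in> Basis" "b \<noteq> e" "b \<noteq> d" for b
  proof -
    have "(z has_derivative z' y0) (at (y0 + 0 *\<^sub>R b))" using zd[OF y0(3)] by simp
    from DERIV_along_line[OF this] have 1: "((\<lambda>s. z (y0 + s *\<^sub>R b)) has_real_derivative z' y0 b) (at 0)" .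
    have "((\<lambda>s. z (y0 + s *\<^sub>R b)) has_real_derivative 0) (at 0)"
    proof (rule has_field_derivative_transform_within[where d = r and f = "\<lambda>_. f p"])
      show "f p = z (y0 + s *\<^sub>R b)" if "dist s 0 < r" for s
        using that b y0 UV(8,9) by (intro zc[symmetric]) (auto simp: D0_def dist_norm inner_add_left inner_Basis)
    qed (use r in auto)
    with 1 show ?thesis by (rule DERIV_unique)
  qed
  have "z' y0 d \<noteq> 0"
  proof
    assume d0: "z' y0 d = 0"
    define v where "v = frechet_derivative \<Phi> (at (p, f p)) (0, 1)"
    have Phi: "(\<Phi> has_derivative frechet_derivative \<Phi> (at (p, f p))) (at (p, f p))"
      using UV(3,4) by (intro Ck_on_has_derivative) (simp_all add: numeral_2_eq_2)
    have "(F has_derivative (\<lambda>u. frechet_derivative \<Phi> (at (p, f p)) u \<bullet> e)) (at (p, f p))"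
      by (rule has_derivative_inner_left[OF Phi])
    from frechet_derivative_eq[OF this, of "(0, 1)"] have "v \<bullet> e = 0"
      using vertical_tangent by (simp add: v_def)
    have "z' y0 v = (\<Sum>b\<in>Basis. (v \<bullet> b) *\<^sub>R z' y0 b)" by (rule linear_Basis_expansion[OF linz])
    also have "\<dots> = 0"
    proof (rule sum.neutral, intro ballI)
      fix b :: "(real^'n) \<times> real" assume "b \<in> Basis"
      then show "(v \<bullet> b) *\<^sub>R z' y0 b = 0" using tang[of b] d0 \<open>v \<bullet> e = 0\<close> by (cases "b = e"; cases "b = d") auto
    qed
    finally have "z' y0 v = 0" .
    have "(z has_derivative z' y0) (at (\<Phi> (p, f p)))" using zd[OF y0(3)] by (simp add: y0_def)
    from has_derivative_compose[OF Phi this]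
    have 1: "((\<lambda>w. z (\<Phi> w)) has_derivative (\<lambda>u. z' y0 (frechet_derivative \<Phi> (at (p, f p)) u))) (at (p, f p))" .
    have "(snd has_derivative (\<lambda>u. z' y0 (frechet_derivative \<Phi> (at (p, f p)) u))) (at (p, f p))"
      by (rule has_derivative_transform_within_open[OF 1 UV(1,3)]) (use UV(6) in \<open>auto simp: z_def\<close>)
    moreover have "(snd has_derivative (snd :: (real^'n) \<times> real \<Rightarrow> real)) (at (p, f p))"
      by (intro bounded_linear_imp_has_derivative bounded_linear_snd)
    ultimately have "(\<lambda>u. z' y0 (frechet_derivative \<Phi> (at (p, f p)) u)) = snd" by (rule has_derivative_unique)
    then have "z' y0 v = 1" unfolding v_def by (metis snd_conv)
    then show False using \<open>z' y0 v = 0\<close> by simp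
  qed
  define \<sigma> where "\<sigma> = sgn (z' y0 d)"
  have \<sigma>: "\<sigma> * z' y0 d > 0" "\<sigma> = 1 \<or> \<sigma> = -1" using \<open>z' y0 d \<noteq> 0\<close> by (auto simp: \<sigma>_def sgn_if)
  have "isCont (\<lambda>y. \<sigma> * z' y d) y0"
    using z'cont UV(2) y0(3) continuous_on_eq_continuous_at by (intro continuous_intros) blast
  then obtain r1 where r1: "r1 > 0" "\<And>y. dist y y0 < r1 \<Longrightarrow> dist (\<sigma> * z' y d) (\<sigma> * z' y0 d) < \<sigma> * z' y0 d"
    using \<sigma>(1) unfolding continuous_at_eps_delta by blast
  define \<rho> where "\<rho> = min r r1"
  have \<rho>: "\<rho> > 0" "\<rho> \<le> r" "\<rho> \<le> r1" using r r1 by (auto simp: \<rho>_def)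
  have pos: "\<sigma> * z' y d > 0" if "y \<in> ball y0 \<rho>" for y
    using r1(2)[of y] that \<rho> by (auto simp: dist_commute dist_real_def)
  have up: "\<sigma> * (z y - f p) > 0" if y: "y \<in> ball y0 \<rho>" "y \<bullet> e = 0" "y \<bullet> d > 0" for y
  proof -
    define t where "t = y \<bullet> d"
    have t: "t > 0" using y by (simp add: t_def)
    define q where "q s = (y - t *\<^sub>R d) + s *\<^sub>R d" for s
    have dd: "d \<bullet> d = 1" "d \<bullet> e = 0" using UV(8,9,10) by (auto simp: inner_Basis)
    have qb: "q s \<in> ball y0 \<rho>" if "0 \<le> s" "s \<le> t" for s
    proof -
      define u where "u = y - t *\<^sub>R d - y0"
      have ud: "u \<bullet> d = 0" using dd y0 by (simp add: u_def t_def inner_diff_left)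
      have n: "(norm (u + s *\<^sub>R d))\<^sup>2 = (norm u)\<^sup>2 + s\<^sup>2" for s
        unfolding power2_norm_eq_inner using ud dd
        by (simp add: inner_add_left inner_add_right inner_commute[of d u] power2_eq_square[of s])
      have "(norm (u + s *\<^sub>R d))\<^sup>2 \<le> (norm (u + t *\<^sub>R d))\<^sup>2"
        unfolding n using that by (simp add: power_mono)
      then have "norm (u + s *\<^sub>R d) \<le> norm (u + t *\<^sub>R d)" by (rule power2_le_imp_le) simp
      moreover have "u + s *\<^sub>R d = q s - y0" "u + t *\<^sub>R d = y - y0" by (auto simp: u_def q_def)
      ultimately have "dist (q s) y0 \<le> dist y y0" by (simp add: dist_norm)
      then show ?thesis using y(1) by (simp add: dist_commute)
    qed
    have "\<exists>s. 0 < s \<and> s < t \<and> z (q t) - z (q 0) = (t - 0) * z' (q s) d"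
    proof (rule MVT2[OF t])
      fix s assume "0 \<le> s" "s \<le> t"
      then have "q s \<in> V" using qb r(2) \<rho> by (meson ball_trivial ball_subset_ball_iff subset_ball subset_iff)
      from DERIV_along_line[OF zd[OF this, unfolded q_def]]
      show "((\<lambda>s. z (q s)) has_real_derivative z' (q s) d) (at s)" unfolding q_def .
    qed
    then obtain s where s: "0 < s" "s < t" "z (q t) - z (q 0) = t * z' (q s) d" by auto
    have "q 0 \<in> D0 r" unfolding D0_def using qb[of 0] t \<rho> y(2) dd
      by (auto simp: q_def inner_diff_left t_def)
    then have "z (q 0) = f p" by (rule zc)
    moreover have "z (q t) = z y" by (simp add: q_def)
    ultimately have "\<sigma> * (z y - f p) = t * (\<sigma> * z' (q s) d)" using s(3) by simp
    moreover have "\<sigma> * z' (q s) d > 0" using s by (intro pos qb) auto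
    ultimately show ?thesis using t by (simp only: mult_pos_pos)
  qed
  obtain G where G: "open G" "p \<in> G"
    "\<And>x. x \<in> G \<Longrightarrow> x \<in> - closure \<Omega> \<Longrightarrow> (x, f x) \<in> U \<and>
      \<Phi> (x, f x) \<in> ball (\<Phi> (p, f p)) \<rho> \<inter> {y. y \<bullet> e = 0 \<and> y \<bullet> d > 0} \<and> \<Psi> (\<Phi> (x, f x)) = (x, f x)"
    "\<And>x. x \<in> G \<Longrightarrow> x \<in> frontier \<Omega> \<Longrightarrow> (x, f x) \<in> U \<and>
      \<Phi> (x, f x) \<in> ball (\<Phi> (p, f p)) \<rho> \<inter> {y. y \<bullet> e = 0 \<and> y \<bullet> d = 0} \<and> \<Psi> (\<Phi> (x, f x)) = (x, f x)"
  proof (rule half_ball[OF ch p \<rho>(1)])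
    show "ball (\<Phi> (p, f p)) \<rho> \<subseteq> V" using r(2) \<rho>(2) subset_ball[OF \<rho>(2), of y0] by (simp add: y0_def)
  qed (rule that)
  have "G \<inter> frontier \<Omega> \<subseteq> connected_component_set (frontier \<Omega>) p"
  proof
    fix x assume x: "x \<in> G \<inter> frontier \<Omega>"
    then have y: "\<Phi> (x, f x) \<in> D0 r" "\<Psi> (\<Phi> (x, f x)) = (x, f x)"
      using G(4)[of x] \<rho>(2) by (auto simp: D0_def y0_def)
    have "fst (\<Psi> (\<Phi> (x, f x))) \<in> connected_component_set (frontier \<Omega>) p" using fst_conn y(1) by blast
    then show "x \<in> connected_component_set (frontier \<Omega>) p" by (simp only: y(2) fst_conv)
  qed
  moreover have "\<sigma> * (f x - f p) > 0" if x: "x \<in> G \<inter> - closure \<Omega>" for x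
  proof -
    have g: "\<Phi> (x, f x) \<in> ball y0 \<rho>" "\<Phi> (x, f x) \<bullet> e = 0" "\<Phi> (x, f x) \<bullet> d > 0" "\<Psi> (\<Phi> (x, f x)) = (x, f x)"
      using G(3)[of x] x by (auto simp: y0_def)
    show ?thesis using up[OF g(1-3)] by (simp add: z_def g(4))
  qed
  then have "(\<forall>x\<in>G \<inter> - closure \<Omega>. f x > f p) \<or> (\<forall>x\<in>G \<inter> - closure \<Omega>. f x < f p)"
    using \<sigma>(2) by fastforce
  ultimately show ?thesis using G(1,2) by blast
qed

lemmas half_chart_consequences = mean_curvature_limit_chart boundary_sign_chart

end

lemma mean_curvature_limit:
  assumes p: "p \<in> frontier \<Omega>"
  shows "\<exists>l. (graph_mean_curvature f \<longlongrightarrow> l) (at p within - closure \<Omega>)"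
proof -
  obtain U V \<Phi> \<Psi> e d where ch: "half_chart \<Omega> f p U V \<Phi> \<Psi> e d"
    using half_chart_exists[OF open_\<Omega> p hypersurface] .
  show ?thesis by (rule half_chart_consequences(1)[OF p ch])
qed

lemma boundary_sign:
  assumes p: "p \<in> frontier \<Omega>"
  shows "\<exists>G. open G \<and> p \<in> G \<and> G \<inter> frontier \<Omega> \<subseteq> connected_component_set (frontier \<Omega>) p \<and>
     ((\<forall>x\<in>G \<inter> - closure \<Omega>. f x > f p) \<or> (\<forall>x\<in>G \<inter> - closure \<Omega>. f x < f p))"
proof -
  obtain U V \<Phi> \<Psi> e d where ch: "half_chart \<Omega> f p U V \<Phi> \<Psi> e d"
    using half_chart_exists[OF open_\<Omega> p hypersurface] .
  show ?thesis by (rule half_chart_consequences(2)[OF p ch])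
qed

end

section \<open>Second-order tests and topological preliminaries\<close>

lemma second_deriv_pos_increase:
  fixes g :: "real \<Rightarrow> real"
  assumes g: "r > 0" "\<And>t. 0 \<le> t \<Longrightarrow> t < r \<Longrightarrow> (g has_real_derivative g' t) (at t)"
    and D: "(g' has_real_derivative D) (at 0)" "D > 0" "g' 0 \<ge> 0"
  obtains s where "s > 0" "\<And>t. 0 < t \<Longrightarrow> t < s \<Longrightarrow> g 0 < g t"
proof -
  obtain d where d: "d > 0" "\<And>h. 0 < h \<Longrightarrow> h < d \<Longrightarrow> g' 0 < g' (0 + h)"
    using DERIV_pos_inc_right[OF D(1,2)] by blast
  show ?thesis
  proof (rule that[of "min d r"])
    show "min d r > 0" using d(1) g(1) by simp
    fix t assume t: "0 < t" "t < min d r"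
    have "\<exists>z. 0 < z \<and> z < t \<and> g t - g 0 = (t - 0) * g' z"
      by (rule MVT2[OF t(1)]) (use t g(2) in auto)
    then obtain z where z: "0 < z" "z < t" "g t - g 0 = t * g' z" by auto
    have "g' z > 0" using d(2)[of z] z t D(3) by simp
    then have "g t - g 0 > 0" unfolding z(3) using t by simp
    then show "g 0 < g t" by simp
  qed
qed

lemma second_deriv_max:
  fixes g :: "real \<Rightarrow> real"
  assumes g: "r > 0" "\<And>t. 0 \<le> t \<Longrightarrow> t < r \<Longrightarrow> (g has_real_derivative g' t) (at t)"
    and D: "(g' has_real_derivative D) (at 0)" "g' 0 \<ge> 0"
    and max: "\<And>t. 0 < t \<Longrightarrow> t < r \<Longrightarrow> g t \<le> g 0"
  shows "D \<le> 0"
proof (rule ccontr)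
  assume "\<not> D \<le> 0"
  then obtain s where s: "s > 0" "\<And>t. 0 < t \<Longrightarrow> t < s \<Longrightarrow> g 0 < g t"
    using second_deriv_pos_increase[OF g D(1) _ D(2)] by (metis linorder_not_le)
  define t where "t = min s r / 2"
  have "0 < t" "t < s" "t < r" using s(1) g(1) by (auto simp: t_def)
  then show False using s(2)[of t] max[of t] by simp
qed

lemma DERIV_along_curve:
  assumes "(f has_derivative f') (at (y + t *\<^sub>R v + t\<^sup>2 *\<^sub>R w))"
  shows "((\<lambda>t. f (y + t *\<^sub>R v + t\<^sup>2 *\<^sub>R w)) has_real_derivative f' (v + (2 * t) *\<^sub>R w)) (at t)"
proof -
  have "((\<lambda>t. y + t *\<^sub>R v + t\<^sup>2 *\<^sub>R w) has_derivative (\<lambda>s. s *\<^sub>R (v + (2 * t) *\<^sub>R w))) (at t)"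
    by (auto intro!: derivative_eq_intros simp: algebra_simps)
  then have "((\<lambda>t. f (y + t *\<^sub>R v + t\<^sup>2 *\<^sub>R w)) has_derivative (\<lambda>s. f' (s *\<^sub>R (v + (2 * t) *\<^sub>R w)))) (at t)"
    by (rule has_derivative_compose) (rule assms)
  moreover have "linear f'" using assms by (rule has_derivative_linear)
  then have "f' (s *\<^sub>R (v + (2 * t) *\<^sub>R w)) = f' (v + (2 * t) *\<^sub>R w) * s" for s
    by (simp only: linear_scale real_scaleR_def mult.commute)
  ultimately show ?thesis unfolding has_field_derivative_def by (simp only:)
qed

lemma C2_along_curve:
  fixes f :: "real^'n::finite \<Rightarrow> real"
  assumes f: "Ck_on 2 S f"
  shows "y + t *\<^sub>R v + t\<^sup>2 *\<^sub>R w \<in> S \<Longrightarrow>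
     ((\<lambda>t. f (y + t *\<^sub>R v + t\<^sup>2 *\<^sub>R w)) has_real_derivative
        grad f (y + t *\<^sub>R v + t\<^sup>2 *\<^sub>R w) \<bullet> (v + (2 * t) *\<^sub>R w)) (at t)"
    and "y \<in> S \<Longrightarrow>
     ((\<lambda>t. grad f (y + t *\<^sub>R v + t\<^sup>2 *\<^sub>R w) \<bullet> (v + (2 * t) *\<^sub>R w)) has_real_derivative
        v \<bullet> (hess f y *v v) + 2 * (grad f y \<bullet> w)) (at 0)"
proof -
  have f2: "Ck_on (Suc (Suc 0)) S f" using f by (simp add: numeral_2_eq_2)
  show "y + t *\<^sub>R v + t\<^sup>2 *\<^sub>R w \<in> S \<Longrightarrow>
     ((\<lambda>t. f (y + t *\<^sub>R v + t\<^sup>2 *\<^sub>R w)) has_real_derivative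
        grad f (y + t *\<^sub>R v + t\<^sup>2 *\<^sub>R w) \<bullet> (v + (2 * t) *\<^sub>R w)) (at t)"
    by (rule DERIV_along_curve) (rule Ck_on_has_derivative_grad[OF f2])
  assume y: "y \<in> S"
  have g: "(grad f has_derivative (\<lambda>u. hess f y *v u)) (at (y + 0 *\<^sub>R v + 0\<^sup>2 *\<^sub>R w))"
    using has_derivative_grad_hess[OF f y] by simp
  have p: "((\<lambda>t. y + t *\<^sub>R v + t\<^sup>2 *\<^sub>R w) has_derivative (\<lambda>s. s *\<^sub>R v)) (at 0)"
    by (auto intro!: derivative_eq_intros)
  have "((\<lambda>t. grad f (y + t *\<^sub>R v + t\<^sup>2 *\<^sub>R w)) has_derivative (\<lambda>s. hess f y *v (s *\<^sub>R v))) (at 0)"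
    by (rule has_derivative_compose[OF p g])
  moreover have "((\<lambda>t. v + (2 * t) *\<^sub>R w) has_derivative (\<lambda>s. (2 * s) *\<^sub>R w)) (at 0)"
    by (auto intro!: derivative_eq_intros)
  ultimately have "((\<lambda>t. grad f (y + t *\<^sub>R v + t\<^sup>2 *\<^sub>R w) \<bullet> (v + (2 * t) *\<^sub>R w)) has_derivative
      (\<lambda>s. grad f (y + 0 *\<^sub>R v + 0\<^sup>2 *\<^sub>R w) \<bullet> ((2 * s) *\<^sub>R w) + (hess f y *v (s *\<^sub>R v)) \<bullet> (v + (2 * 0) *\<^sub>R w))) (at 0)"
    by (rule has_derivative_inner)
  moreover have "grad f (y + 0 *\<^sub>R v + 0\<^sup>2 *\<^sub>R w) \<bullet> ((2 * s) *\<^sub>R w) + (hess f y *v (s *\<^sub>R v)) \<bullet> (v + (2 * 0) *\<^sub>R w)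
      = (v \<bullet> (hess f y *v v) + 2 * (grad f y \<bullet> w)) * s" for s
    by (simp add: matrix_vector_mult_scaleR inner_commute[of _ v] algebra_simps)
  ultimately show "((\<lambda>t. grad f (y + t *\<^sub>R v + t\<^sup>2 *\<^sub>R w) \<bullet> (v + (2 * t) *\<^sub>R w)) has_real_derivative
        v \<bullet> (hess f y *v v) + 2 * (grad f y \<bullet> w)) (at 0)"
    unfolding has_field_derivative_def by (simp only:)
qed

lemma curve_in_open:
  fixes y v w :: "'a::real_normed_vector"
  assumes "open S" "y \<in> S"
  obtains r where "r > 0" "\<And>t. 0 \<le> t \<Longrightarrow> t < r \<Longrightarrow> y + t *\<^sub>R v + t\<^sup>2 *\<^sub>R w \<in> S"
proof -
  have "((\<lambda>t. y + t *\<^sub>R v + t\<^sup>2 *\<^sub>R w) \<longlongrightarrow> y + 0 *\<^sub>R v + 0\<^sup>2 *\<^sub>R w) (at (0::real))"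
    by (intro tendsto_intros)
  then have "\<forall>\<^sub>F t in at 0. y + t *\<^sub>R v + t\<^sup>2 *\<^sub>R w \<in> S"
    using assms by (intro topological_tendstoD) auto
  then obtain r where r: "r > 0" "\<And>t. t \<noteq> 0 \<Longrightarrow> dist t 0 < r \<Longrightarrow> y + t *\<^sub>R v + t\<^sup>2 *\<^sub>R w \<in> S"
    unfolding eventually_at by auto
  show ?thesis
  proof (rule that[OF r(1)])
    fix t assume "0 \<le> t" "t < r"
    then show "y + t *\<^sub>R v + t\<^sup>2 *\<^sub>R w \<in> S" using r(2)[of t] assms(2) by (cases "t = 0") (auto simp: dist_real_def)
  qed
qed

lemma flat_expansion:
  fixes f :: "real^'n::finite \<Rightarrow> real"
  assumes f: "Ck_on 2 S f" and "open S" "x \<in> S" and flat: "hess f x = 0" and "\<epsilon> > 0"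
  obtains \<delta> where "\<delta> > 0" "ball x \<delta> \<subseteq> S"
    "\<And>k. norm k < \<delta> \<Longrightarrow> norm (grad f (x + k) - grad f x) \<le> \<epsilon> * norm k"
    "\<And>k. norm k < \<delta> \<Longrightarrow> \<bar>f (x + k) - f x - grad f x \<bullet> k\<bar> \<le> \<epsilon> * (norm k)\<^sup>2"
proof -
  have f2: "Ck_on (Suc (Suc 0)) S f" using f by (simp add: numeral_2_eq_2)
  have "(grad f has_derivative (\<lambda>u. 0)) (at x)" using has_derivative_grad_hess[OF f \<open>x \<in> S\<close>] flat by simp
  then obtain d1 where d1: "d1 > 0" "\<And>y. norm (y - x) < d1 \<Longrightarrow> norm (grad f y - grad f x) \<le> \<epsilon> * norm (y - x)"
    unfolding has_derivative_at_alt using \<open>\<epsilon> > 0\<close> by auto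
  obtain d2 where d2: "d2 > 0" "ball x d2 \<subseteq> S" using openE[OF \<open>open S\<close> \<open>x \<in> S\<close>] .
  define \<delta> where "\<delta> = min d1 d2"
  have g: "norm (grad f (x + k) - grad f x) \<le> \<epsilon> * norm k" if "norm k < \<delta>" for k
    using d1(2)[of "x + k"] that by (simp add: \<delta>_def)
  show ?thesis
  proof (rule that[of \<delta>])
    show "\<delta> > 0" using d1 d2 by (simp add: \<delta>_def)
    show "ball x \<delta> \<subseteq> S" using d2 by (auto simp: \<delta>_def)
    show "norm (grad f (x + k) - grad f x) \<le> \<epsilon> * norm k" if "norm k < \<delta>" for k by (rule g[OF that])
    fix k :: "real^'n" assume k: "norm k < \<delta>"
    have "\<exists>t. 0 < t \<and> t < 1 \<and> f (x + 1 *\<^sub>R k) - f (x + 0 *\<^sub>R k) = (1 - 0) * (grad f (x + t *\<^sub>R k) \<bullet> k)"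
    proof (rule MVT2)
      fix t :: real assume t: "0 \<le> t" "t \<le> 1"
      have "norm (t *\<^sub>R k) \<le> norm k" using t by (simp add: mult_left_le_one_le)
      then have "x + t *\<^sub>R k \<in> S" using k d2(2) by (intro subsetD[OF d2(2)]) (simp add: \<delta>_def dist_norm)
      then show "((\<lambda>t. f (x + t *\<^sub>R k)) has_real_derivative grad f (x + t *\<^sub>R k) \<bullet> k) (at t)"
        by (intro DERIV_along_line Ck_on_has_derivative_grad[OF f2])
    qed simp
    then obtain t where t: "0 < t" "t < 1" "f (x + k) - f x = grad f (x + t *\<^sub>R k) \<bullet> k" by auto
    have tk: "norm (t *\<^sub>R k) \<le> norm k" using t by (simp add: mult_left_le_one_le)
    have "\<bar>f (x + k) - f x - grad f x \<bullet> k\<bar> = \<bar>(grad f (x + t *\<^sub>R k) - grad f x) \<bullet> k\<bar>"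
      unfolding t(3) by (simp add: inner_diff_left)
    also have "\<dots> \<le> norm (grad f (x + t *\<^sub>R k) - grad f x) * norm k" by (rule Cauchy_Schwarz_ineq2)
    also have "\<dots> \<le> (\<epsilon> * norm (t *\<^sub>R k)) * norm k" using g[of "t *\<^sub>R k"] tk k by (intro mult_right_mono) auto
    also have "\<dots> \<le> (\<epsilon> * norm k) * norm k" using tk \<open>\<epsilon> > 0\<close> by (intro mult_right_mono mult_left_mono) auto
    finally show "\<bar>f (x + k) - f x - grad f x \<bullet> k\<bar> \<le> \<epsilon> * (norm k)\<^sup>2" by (simp add: power2_eq_square)
  qed
qed

lemma ray_exit:
  fixes C :: "'a::euclidean_space set"
  assumes "bounded C" "y \<in> C" "v \<noteq> 0"
  obtains t where "t \<ge> 0" "y + t *\<^sub>R v \<in> frontier C"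
proof -
  obtain B where B: "\<And>x. x \<in> C \<Longrightarrow> norm x \<le> B" using \<open>bounded C\<close> bounded_iff by blast
  define s where "s = (B + norm y + 1) / norm v"
  have "B \<ge> 0" using B[OF \<open>y \<in> C\<close>] norm_ge_zero[of y] by linarith
  then have "s > 0" using \<open>v \<noteq> 0\<close> by (simp add: s_def add_nonneg_pos)
  have "norm (s *\<^sub>R v) = s * norm v" using \<open>s > 0\<close> by simp
  also have "\<dots> = B + norm y + 1" using \<open>v \<noteq> 0\<close> by (simp add: s_def)
  finally have "norm (s *\<^sub>R v) = B + norm y + 1" .
  then have "norm (y + s *\<^sub>R v) > B" using norm_triangle_ineq4[of "y + s *\<^sub>R v" y] by simp
  then have "y + s *\<^sub>R v \<notin> C" using B by fastforce
  define L where "L = (\<lambda>t. y + t *\<^sub>R v) ` {0..s}"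
  have "connected L" unfolding L_def
    by (intro connected_continuous_image continuous_intros) simp
  moreover have "y \<in> L" unfolding L_def using \<open>s > 0\<close> by (intro image_eqI[of _ _ 0]) auto
  moreover have "y + s *\<^sub>R v \<in> L" unfolding L_def using \<open>s > 0\<close> by auto
  ultimately have "L \<inter> frontier C \<noteq> {}"
    using connected_Int_frontier[of L C] \<open>y \<in> C\<close> \<open>y + s *\<^sub>R v \<notin> C\<close> by blast
  then show ?thesis using that unfolding L_def by auto
qed

lemma path_in_component:
  fixes \<gamma> :: "real \<Rightarrow> 'a::topological_space"
  assumes C: "C \<in> components A" and "continuous_on {0..s} \<gamma>" "\<gamma> 0 \<in> C" "s \<ge> 0"
    and A: "\<And>t. 0 \<le> t \<Longrightarrow> t \<le> s \<Longrightarrow> \<gamma> t \<in> A"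
  shows "\<gamma> s \<in> C"
proof -
  have "\<gamma> ` {0..s} \<subseteq> C"
  proof (rule components_maximal[OF C])
    show "connected (\<gamma> ` {0..s})" by (rule connected_continuous_image[OF assms(2)]) simp
    show "\<gamma> ` {0..s} \<subseteq> A" using A by auto
    have "\<gamma> 0 \<in> \<gamma> ` {0..s}" using \<open>s \<ge> 0\<close> by simp
    then show "C \<inter> \<gamma> ` {0..s} \<noteq> {}" using \<open>\<gamma> 0 \<in> C\<close> by blast
  qed
  then show ?thesis using \<open>s \<ge> 0\<close> by auto
qed

lemma negligible_connected_real:
  fixes X :: "real set"
  assumes "negligible X" "connected X" "a \<in> X" "b \<in> X"
  shows "a = b"
proof -
  have "a = b" if ab: "a \<in> X" "b \<in> X" "a \<le> b" for a b
  proof (rule ccontr)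
    assume "a \<noteq> b"
    have "cbox a b \<subseteq> X" using connectedD_interval[OF assms(2) ab(1,2)] by auto
    then have "negligible (cbox a b)" using assms(1) negligible_subset by blast
    then have "box a b = {}" by (simp only: negligible_interval)
    then show False using \<open>a \<noteq> b\<close> ab(3) by simp
  qed
  then show ?thesis using assms(3,4) by (metis linorder_linear)
qed

lemma Morse_Sard_vec:
  fixes g :: "real^'n::finite \<Rightarrow> real"
  assumes "open S" "Ck_on CARD('n) S g"
  shows "negligible (g ` {x\<in>S. \<forall>i. pd i g x = 0})"
proof -
  have "{x\<in>S. \<forall>i. pd i g x = 0} = {x\<in>S. \<forall>b\<in>Basis. frechet_derivative g (at x) b = 0}"
    by (auto simp: pd_def Basis_vec_def)
  moreover have "DIM(real^'n) = CARD('n)" by simp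
  ultimately show ?thesis using Morse_Sard[of S g] assms by (simp only:)
qed

lemma constant_on_connected_critical_set:
  fixes g :: "real^'n::finite \<Rightarrow> real"
  assumes "open S" "Ck_on CARD('n) S g" "connected T" "T \<subseteq> S"
    and crit: "\<And>x i. x \<in> T \<Longrightarrow> pd i g x = 0" and "x \<in> T" "y \<in> T"
  shows "g x = g y"
proof (rule negligible_connected_real)
  show "negligible (g ` T)"
    by (rule negligible_subset[OF Morse_Sard_vec[OF assms(1,2)]]) (use crit assms(4) in auto)
  show "connected (g ` T)"
    by (rule connected_continuous_image[OF continuous_on_subset[OF Ck_on_continuous[OF assms(2)] assms(4)] assms(3)])
qed (use assms in auto)

lemma trace_lt_zero_on_complement:
  fixes h :: "real^'n::finite^'n" and a :: "real^'n"
  assumes "a \<noteq> 0" "CARD('n) \<ge> 2"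
    and neg: "\<And>v. v \<bullet> a = 0 \<Longrightarrow> v \<noteq> 0 \<Longrightarrow> v \<bullet> (h *v v) < 0"
  shows "(norm a)\<^sup>2 * trace h < a \<bullet> (h *v a)"
proof -
  define m where "m = (norm a)\<^sup>2"
  have m: "m > 0" using \<open>a \<noteq> 0\<close> by (simp add: m_def)
  define u where "u i = axis i 1 - ((1 / m) * a $ i) *\<^sub>R a" for i
  have ua: "u i \<bullet> a = 0" for i
    using m by (simp add: u_def inner_diff_left axis_inner m_def power2_norm_eq_inner)
  have le: "u i \<bullet> (h *v u i) \<le> 0" for i
    using neg[OF ua[of i]] by (cases "u i = 0") (auto intro: less_imp_le)
  have "\<exists>i. u i \<noteq> 0"
  proof (rule ccontr)
    assume "\<nexists>i. u i \<noteq> 0"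
    then have e: "axis i 1 = ((1 / m) * a $ i) *\<^sub>R a" for i by (simp add: u_def)
    obtain i j :: 'n where "i \<noteq> j"
    proof -
      have "\<not> (\<forall>j. j = (undefined :: 'n))"
      proof
        assume "\<forall>j. j = (undefined :: 'n)"
        then have "(UNIV :: 'n set) = {undefined}" by auto
        then have "CARD('n) = card {undefined :: 'n}" by (rule arg_cong)
        then have "CARD('n) = 1" by simp
        then show False using \<open>CARD('n) \<ge> 2\<close> by simp
      qed
      then show ?thesis using that by blast
    qed
    have "(axis i 1 :: real^'n) \<bullet> axis j 1 = 0" using \<open>i \<noteq> j\<close> by (simp add: inner_axis_axis)
    moreover have "(axis i 1 :: real^'n) \<bullet> axis j 1 = (a $ i * a $ j) / m"
      unfolding e[of i] e[of j] using m by (simp add: m_def power2_norm_eq_inner[symmetric] power2_eq_square)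
    ultimately have "a $ i = 0 \<or> a $ j = 0" using m by simp
    then have "axis i (1::real) = 0 \<or> axis j (1::real) = (0 :: real^'n)" using e by (metis mult_zero_right scale_zero_left)
    then show False by (simp add: axis_eq_0_iff)
  qed
  then obtain i0 where i0: "u i0 \<noteq> 0" by blast
  have "(\<Sum>i\<in>UNIV. u i \<bullet> (h *v u i)) < (\<Sum>i\<in>(UNIV::'n set). 0)"
    by (rule sum_strict_mono_ex1) (use le neg[OF ua i0] in auto)
  moreover have "(\<Sum>i\<in>UNIV. u i \<bullet> (h *v u i)) = trace h - (2 * (1 / m) - (1 / m)\<^sup>2 * m) * (a \<bullet> (h *v a))"
    using trace_congruence[of "1 / m" a h] by (simp add: u_def m_def)
  moreover have "2 * (1 / m) - (1 / m)\<^sup>2 * m = 1 / m" using m by (simp add: field_simps power2_eq_square)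
  ultimately have "trace h < (a \<bullet> (h *v a)) / m" by simp
  then show ?thesis using m by (simp add: field_simps m_def)
qed

section \<open>Components of the set of positive mean curvature\<close>

text \<open>All assumptions are invariant under \<open>f \<mapsto> - f\<close>, which exchanges the sets of positive and
  of negative mean curvature.\<close>

locale signed_graph =
  fixes \<Omega> :: "(real^'n::finite) set" and f :: "real^'n \<Rightarrow> real"
  assumes card: "CARD('n) \<ge> 3"
    and open_\<Omega>: "open \<Omega>" and bounded_\<Omega>: "bounded \<Omega>"
    and connected_E: "connected (- closure \<Omega>)"
    and Ck: "Ck_on (CARD('n) + 1) (- closure \<Omega>) f"
    and cont: "continuous_on (- \<Omega>) f"
    and const: "\<And>C. C \<in> components (frontier \<Omega>) \<Longrightarrow> f constant_on C"
    and vertical: "\<And>p. p \<in> frontier \<Omega> \<Longrightarrow>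
           filterlim (\<lambda>x. norm (grad f x)) at_top (at p within - closure \<Omega>)"
    and approachable: "\<And>p G. p \<in> frontier \<Omega> \<Longrightarrow> open G \<Longrightarrow> p \<in> G \<Longrightarrow> G \<inter> - closure \<Omega> \<noteq> {}"
    and boundary_sign: "\<And>p. p \<in> frontier \<Omega> \<Longrightarrow>
      \<exists>G. open G \<and> p \<in> G \<and> G \<inter> frontier \<Omega> \<subseteq> connected_component_set (frontier \<Omega>) p \<and>
        ((\<forall>x\<in>G \<inter> - closure \<Omega>. f x > f p) \<or> (\<forall>x\<in>G \<inter> - closure \<Omega>. f x < f p))"
    and hess_zero: "\<And>x. x \<in> - closure \<Omega> \<Longrightarrow> graph_mean_curvature f x = 0 \<Longrightarrow> hess f x = 0"
    and hess_pos: "\<And>x. x \<in> - closure \<Omega> \<Longrightarrow> graph_mean_curvature f x > 0 \<Longrightarrow>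
      grad f x \<bullet> (hess f x *v grad f x) \<le> (norm (grad f x))\<^sup>2 * trace (hess f x)"
    and hess_neg: "\<And>x. x \<in> - closure \<Omega> \<Longrightarrow> graph_mean_curvature f x < 0 \<Longrightarrow>
      (norm (grad f x))\<^sup>2 * trace (hess f x) \<le> grad f x \<bullet> (hess f x *v grad f x)"
    and limit: "(\<exists>C. (f \<longlongrightarrow> C) at_infinity) \<or> filterlim f at_top at_infinity \<or> filterlim f at_bot at_infinity"
    and grad_limit: "(grad f \<longlongrightarrow> 0) at_infinity"
begin

abbreviation "E \<equiv> - closure \<Omega>"
abbreviation "H \<equiv> graph_mean_curvature f"
abbreviation "Z \<equiv> {x \<in> E. H x = 0}"

lemma open_E: "open E" by auto

lemma Ck_le: "k \<le> CARD('n) + 1 \<Longrightarrow> Ck_on k E f"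
  using Ck_on_le[OF Ck] .

lemma C2: "Ck_on 2 E f" using card by (intro Ck_le) simp

lemma Compl_eq: "- \<Omega> = E \<union> frontier \<Omega>" by (rule Compl_open_eq[OF open_\<Omega>])

lemma continuous_H: "continuous_on E H" by (rule continuous_on_graph_mean_curvature[OF C2])

lemma continuous_grad: "continuous_on E (grad f)" by (rule continuous_on_grad_hess(1)[OF C2])

lemma grad_derivative: "x \<in> E \<Longrightarrow> (f has_derivative (\<lambda>u. grad f x \<bullet> u)) (at x)"
  using Ck_on_has_derivative_grad[of "Suc 0" E f] C2 by (simp add: numeral_2_eq_2)

lemma hess_entry: assumes "hess f x = 0" shows "pd j (pd i f) x = 0"
proof -
  have "hess f x $ i $ j = (0 :: real^'n^'n) $ i $ j" by (simp only: assms)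
  then show ?thesis by (simp add: hess_def)
qed

lemma Ck_pd: "Ck_on CARD('n) E (pd i f)"
  using Ck_on_pd[of "CARD('n)" E f i] Ck by simp

lemma affine_on_flat_set:
  assumes T: "connected T" "T \<subseteq> Z"
  obtains a b where "\<And>x. x \<in> T \<Longrightarrow> grad f x = a \<and> f x = a \<bullet> x + b"
proof (cases "T = {}")
  case True
  then show ?thesis using that by blast
next
  case False
  then obtain x0 where x0: "x0 \<in> T" by blast
  have TE: "T \<subseteq> E" using T by blast
  have h0: "hess f x = 0" if "x \<in> T" for x using hess_zero T that by blast
  have "pd i f x = pd i f x0" if "x \<in> T" for x i
    by (rule constant_on_connected_critical_set[OF open_E Ck_pd T(1) TE _ that x0])
      (rule hess_entry[OF h0])
  then have ga: "grad f x = grad f x0" if "x \<in> T" for x using that by (simp add: grad_def)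
  define a where "a = grad f x0"
  have L: "Ck_on CARD('n) E (\<lambda>x. f x - a \<bullet> x)"
    by (rule Ck_on_diff[OF open_E Ck_le Ck_on_linear[OF bounded_linear_inner_right]]) simp
  have "f x - a \<bullet> x = f x0 - a \<bullet> x0" if x: "x \<in> T" for x
  proof (rule constant_on_connected_critical_set[OF open_E L T(1) TE _ x x0])
    fix x i assume x: "x \<in> T"
    have "((\<lambda>x. f x - a \<bullet> x) has_derivative (\<lambda>u. grad f x \<bullet> u - a \<bullet> u)) (at x)"
      by (intro has_derivative_diff grad_derivative bounded_linear_imp_has_derivative
          bounded_linear_inner_right) (use x TE in blast)
    from pd_eq[OF this] show "pd i (\<lambda>x. f x - a \<bullet> x) x = 0" using ga[OF x] by (simp add: a_def)
  qed
  then show ?thesis using that[of a "f x0 - a \<bullet> x0"] ga unfolding a_def by (simp add: algebra_simps)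
qed

text \<open>On \<open>Z\<close> the function \<open>|Df|\<^sup>2\<close> takes a null set of values, and it is infinite on the boundary;
  so a connected set cannot pass from \<open>Z\<close> to the boundary.\<close>

lemma flat_or_boundary:
  assumes T: "connected T" "T \<subseteq> Z \<union> frontier \<Omega>"
  shows "T \<subseteq> Z \<or> T \<subseteq> frontier \<Omega>"
proof (rule ccontr)
  assume "\<not> ?thesis"
  then obtain x1 x2 where x1: "x1 \<in> T" "x1 \<in> Z" and x2: "x2 \<in> T" "x2 \<in> frontier \<Omega>" using T(2) by blast
  define g where "g x = (\<Sum>i\<in>UNIV. pd i f x * pd i f x)" for x
  have gn: "g x = (norm (grad f x))\<^sup>2" for x
    unfolding g_def power2_norm_sum by (simp add: grad_def power2_eq_square)
  have gC: "Ck_on CARD('n) E g"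
    unfolding g_def by (intro Ck_on_sum Ck_on_mult Ck_pd open_E)
  have "pd i g x = 0" if "x \<in> Z" for x i
  proof -
    have h: "hess f x = 0" using hess_zero that by blast
    have d: "pd l f differentiable at x" for l
    proof -
      have "Ck_on (Suc (Suc 0)) E f" using C2 by (simp add: numeral_2_eq_2)
      then show ?thesis using that by (intro differentiable_Ck[OF Ck_on_pd]) auto
    qed
    have "pd i g x = (\<Sum>l\<in>UNIV. pd i (\<lambda>x. pd l f x * pd l f x) x)"
      unfolding g_def by (rule pd_sum) (intro differentiable_mult d)
    also have "\<dots> = 0" by (simp add: pd_mult[OF d d] hess_entry[OF h])
    finally show ?thesis .
  qed
  then have "negligible (g ` Z)"
    by (intro negligible_subset[OF Morse_Sard_vec[OF open_E gC]]) auto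
  moreover have "\<not> negligible {g x1<..<g x1 + 1}"
    using negligible_interval(2)[of "g x1" "g x1 + 1"] by simp
  ultimately have "\<not> {g x1<..<g x1 + 1} \<subseteq> g ` Z" using negligible_subset by blast
  then obtain l where "l \<in> {g x1<..<g x1 + 1}" and l2: "l \<notin> g ` Z" by blast
  then have "l > g x1" by simp
  note l = this l2
  define A1 where "A1 = E \<inter> g -` {..<l}"
  have "open A1" unfolding A1_def
    by (rule continuous_open_preimage[OF Ck_on_continuous[OF gC] open_E]) auto
  define A2 where "A2 = \<Union>{G. open G \<and> (\<forall>x\<in>G \<inter> E. g x > l)}"
  have "open A2" unfolding A2_def by blast
  have "A1 \<inter> A2 \<inter> T = {}" unfolding A1_def A2_def by force
  moreover have "T \<subseteq> A1 \<union> A2"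
  proof
    fix x assume x: "x \<in> T"
    consider "x \<in> Z" "g x < l" | "x \<in> Z" "g x > l" | "x \<in> frontier \<Omega>" using T(2) x l(2) by fastforce
    then show "x \<in> A1 \<union> A2"
    proof cases
      case 1
      then show ?thesis by (auto simp: A1_def)
    next
      case 2
      have "open (E \<inter> g -` {l<..})"
        by (rule continuous_open_preimage[OF Ck_on_continuous[OF gC] open_E]) auto
      then have "E \<inter> g -` {l<..} \<subseteq> A2" unfolding A2_def by blast
      then show ?thesis using 2 by blast
    next
      case 3
      have "\<forall>\<^sub>F y in at x within E. norm (grad f y) > 1 + \<bar>l\<bar>"
        using vertical[OF 3] unfolding filterlim_at_top_dense by blast
      then obtain G where G: "open G" "x \<in> G" "\<And>y. y \<in> G \<Longrightarrow> y \<in> E \<Longrightarrow> y \<noteq> x \<Longrightarrow> norm (grad f y) > 1 + \<bar>l\<bar>"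
        unfolding eventually_at_topological by blast
      have "g y > l" if "y \<in> G \<inter> E" for y
      proof -
        have "y \<noteq> x" using that 3 by (auto simp: frontier_def)
        then have n: "norm (grad f y) > 1 + \<bar>l\<bar>" using G(3) that by blast
        then have "norm (grad f y) * 1 \<le> norm (grad f y) * norm (grad f y)" by (intro mult_left_mono) auto
        then show ?thesis unfolding gn power2_eq_square using n by linarith
      qed
      then show ?thesis using G(1,2) unfolding A2_def by blast
    qed
  qed
  moreover have "A1 \<inter> T \<noteq> {}" using x1 l(1) by (auto simp: A1_def)
  moreover have "A2 \<inter> T \<noteq> {}"
  proof -
    have "x2 \<notin> A1" using x2 by (auto simp: A1_def frontier_def)
    then show ?thesis using x2(1) \<open>T \<subseteq> A1 \<union> A2\<close> by blast
  qed
  ultimately show False using T(1) \<open>open A1\<close> \<open>open A2\<close> unfolding connected_def by blast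
qed

end

locale positive_component = signed_graph \<Omega> f for \<Omega> :: "(real^'n::finite) set" and f +
  fixes P assumes P: "P \<in> components {x \<in> E. H x > 0}"
begin

lemma P_basics: "open P" "connected P" "P \<subseteq> E" "P \<noteq> {}" "\<And>x. x \<in> P \<Longrightarrow> H x > 0"
proof -
  have o: "open {x \<in> E. H x > 0}"
  proof -
    have "open (E \<inter> H -` {0<..})" by (rule continuous_open_preimage[OF continuous_H open_E]) auto
    moreover have "E \<inter> H -` {0<..} = {x \<in> E. H x > 0}" by auto
    ultimately show ?thesis by simp
  qed
  show "open P" by (rule open_components[OF o P])
  show "connected P" "P \<noteq> {}" using P in_components_connected in_components_nonempty by blast+
  have "P \<subseteq> {x \<in> E. H x > 0}" using P by (rule in_components_subset)
  then show "P \<subseteq> E" "\<And>x. x \<in> P \<Longrightarrow> H x > 0" by auto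
qed

lemma closure_P: "closure P \<subseteq> - \<Omega>"
  using P_basics(3) closure_subset[of \<Omega>] open_\<Omega> by (intro closure_minimal) auto

lemma frontier_P: "frontier P \<subseteq> Z \<union> frontier \<Omega>"
proof
  fix x assume x: "x \<in> frontier P"
  then have xc: "x \<in> closure P" and xn: "x \<notin> P" using P_basics(1) by (auto simp: frontier_def interior_open)
  show "x \<in> Z \<union> frontier \<Omega>"
  proof (cases "x \<in> E")
    case True
    have "H x \<ge> 0"
    proof (rule ccontr)
      assume "\<not> H x \<ge> 0"
      have "open (E \<inter> H -` {..<0})" by (rule continuous_open_preimage[OF continuous_H open_E]) auto
      moreover have "x \<in> E \<inter> H -` {..<0}" using True \<open>\<not> H x \<ge> 0\<close> by auto
      ultimately have "(E \<inter> H -` {..<0}) \<inter> P \<noteq> {}"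
        using xc open_Int_closure_eq_empty by blast
      then show False using P_basics(5) by force
    qed
    moreover have "\<not> H x > 0"
    proof
      assume "H x > 0"
      have "open (E \<inter> H -` {0<..})" by (rule continuous_open_preimage[OF continuous_H open_E]) auto
      moreover have "x \<in> E \<inter> H -` {0<..}" using True \<open>H x > 0\<close> by auto
      ultimately obtain r where r: "r > 0" "ball x r \<subseteq> E \<inter> H -` {0<..}" by (rule openE)
      have "ball x r \<inter> P \<noteq> {}" using xc r(1) open_Int_closure_eq_empty[OF open_ball, of x r P] by force
      then have "ball x r \<subseteq> P"
        by (intro components_maximal[OF P]) (use r in \<open>auto simp: Int_commute\<close>)
      then show False using xn centre_in_ball[of x r] r(1) by blast
    qed
    ultimately show ?thesis using True by force
  next
    case False
    then show ?thesis using xc closure_P Compl_eq by blast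
  qed
qed

lemma complement_component:
  assumes C: "C \<in> components (- P)"
  shows "closed C" "connected (frontier C)" "frontier C \<subseteq> frontier P" "frontier C \<noteq> {}"
    "frontier C \<subseteq> C" "C \<inter> P = {}"
proof -
  show c: "closed C" using closed_components[OF _ C] P_basics(1) by (simp add: closed_Compl)
  show "connected (frontier C)" by (rule connected_frontier_component_complement[OF P_basics(2) C])
  show "frontier C \<subseteq> frontier P" using frontier_of_components_subset[OF C] by (simp add: frontier_complement)
  show "C \<inter> P = {}" using in_components_subset[OF C] by blast
  then have "C \<noteq> UNIV" using P_basics(4) by blast
  moreover have "C \<noteq> {}" using C by (rule in_components_nonempty)
  ultimately show "frontier C \<noteq> {}" by (simp add: frontier_eq_empty)
  show "frontier C \<subseteq> C" using c by (simp add: frontier_subset_closed)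
qed

lemma frontier_P_eq: "frontier P = closure P - P"
  using P_basics(1) by (simp add: frontier_def interior_open)

lemma in_frontier_component:
  assumes C: "C \<in> components (- P)" and x: "x \<in> C" "x \<in> closure P"
  shows "x \<in> frontier C"
proof -
  have "x \<notin> interior C"
  proof
    assume "x \<in> interior C"
    then have "interior C \<inter> P \<noteq> {}" using x(2) open_Int_closure_eq_empty[OF open_interior, of C P] by blast
    then show False using complement_component(6)[OF C] interior_subset by blast
  qed
  then show ?thesis using x(1) closure_subset by (auto simp: frontier_def)
qed

lemma component_of: "x \<notin> P \<Longrightarrow> connected_component_set (- P) x \<in> components (- P) \<and> x \<in> connected_component_set (- P) x"
  by (simp add: componentsI)

lemma component_eq: "C \<in> components (- P) \<Longrightarrow> x \<in> C \<Longrightarrow> connected_component_set (- P) x = C"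
  by (metis ComplI ComplD components_iff connected_component_eq)

lemma boundary_hole:
  assumes C: "C \<in> components (- P)" and x: "x \<in> frontier C" "x \<in> frontier \<Omega>"
  shows "frontier C \<subseteq> frontier \<Omega>" "C \<inter> E = {}"
proof -
  have "frontier C \<subseteq> Z \<union> frontier \<Omega>" using complement_component(3)[OF C] frontier_P by blast
  then have "frontier C \<subseteq> Z \<or> frontier C \<subseteq> frontier \<Omega>"
    by (rule flat_or_boundary[OF complement_component(2)[OF C]])
  moreover have "x \<notin> Z" using x(2) by (auto simp: frontier_def)
  ultimately show T: "frontier C \<subseteq> frontier \<Omega>" using x(1) by blast
  show "C \<inter> E = {}"
  proof (rule ccontr)
    assume "C \<inter> E \<noteq> {}"
    moreover have "E - C \<noteq> {}" using complement_component(6)[OF C] P_basics(3,4) by blast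
    ultimately have "E \<inter> frontier C \<noteq> {}" by (intro connected_Int_frontier[OF connected_E]) auto
    then show False using T by (auto simp: frontier_def)
  qed
qed

lemma hole_affine:
  assumes C: "C \<in> components (- P)" and nb: "\<not> frontier C \<subseteq> frontier \<Omega>"
  obtains a b where "\<And>x. x \<in> frontier C \<Longrightarrow> x \<in> Z \<and> grad f x = a \<and> f x = a \<bullet> x + b"
proof -
  have "frontier C \<subseteq> Z \<union> frontier \<Omega>" using complement_component(3)[OF C] frontier_P by blast
  then have FZ: "frontier C \<subseteq> Z"
    using flat_or_boundary[OF complement_component(2)[OF C]] nb by blast
  obtain a b where ab: "\<And>x. x \<in> frontier C \<Longrightarrow> grad f x = a \<and> f x = a \<bullet> x + b"
    by (rule affine_on_flat_set[OF complement_component(2)[OF C] FZ]) (rule that)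
  show ?thesis
    by (rule that[of a b]) (use ab FZ in blast)
qed

lemma hole_affine_E:
  assumes C: "C \<in> components (- P)" and x: "x \<in> C" "x \<in> E"
  obtains a b where "\<And>x. x \<in> frontier C \<Longrightarrow> x \<in> Z \<and> grad f x = a \<and> f x = a \<bullet> x + b"
proof -
  have "\<not> frontier C \<subseteq> frontier \<Omega>"
    using boundary_hole(2)[OF C] complement_component(4)[OF C] x by blast
  show ?thesis by (rule hole_affine[OF C \<open>\<not> frontier C \<subseteq> frontier \<Omega>\<close>]) (rule that)
qed

end

text \<open>The assumptions of the following locale are contradictory, i.e. \<open>f - a0 \<bullet> x\<close> has no maximum on
  the closure of \<open>P\<close>, provided that all unbounded complementary components of \<open>P\<close> have slope \<open>a0\<close>.\<close>

locale tilted_maximum = positive_component \<Omega> f P for \<Omega> :: "(real^'n::finite) set" and f P +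
  fixes a0 b0 m xm
  assumes unbounded: "\<And>C x. C \<in> components (- P) \<Longrightarrow> \<not> bounded C \<Longrightarrow> x \<in> frontier C \<Longrightarrow>
      x \<in> E \<and> grad f x = a0 \<and> f x = a0 \<bullet> x + b0"
    and max: "\<And>x. x \<in> closure P \<Longrightarrow> f x - a0 \<bullet> x \<le> m"
    and xm: "xm \<in> closure P" "f xm - a0 \<bullet> xm = m"
begin

lemma no_max_in_P:
  assumes x: "x \<in> P" shows "f x - a0 \<bullet> x < m"
proof (rule ccontr)
  assume "\<not> ?thesis"
  then have eq: "f x - a0 \<bullet> x = m" using max[of x] closure_subset x by (meson antisym_conv2 subset_iff not_less_iff_gr_or_eq order_le_less)
  have xE: "x \<in> E" using x P_basics(3) by blast
  have "u \<bullet> (hess f x *v u) \<le> 0" for u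
  proof -
    obtain r where r: "r > 0" "\<And>t. 0 \<le> t \<Longrightarrow> t < r \<Longrightarrow> x + t *\<^sub>R u + t\<^sup>2 *\<^sub>R 0 \<in> P"
      using curve_in_open[OF P_basics(1) x] by blast
    define g where "g u t = f (x + t *\<^sub>R u + t\<^sup>2 *\<^sub>R 0) - a0 \<bullet> (x + t *\<^sub>R u)" for u t
    define g' where "g' u t = grad f (x + t *\<^sub>R u + t\<^sup>2 *\<^sub>R 0) \<bullet> (u + (2 * t) *\<^sub>R 0) - a0 \<bullet> u" for u t
    have d: "(g u has_real_derivative g' u t) (at t)" if "x + t *\<^sub>R u + t\<^sup>2 *\<^sub>R 0 \<in> P" for u t
    proof -
      have "((\<lambda>t. a0 \<bullet> (x + t *\<^sub>R u)) has_real_derivative a0 \<bullet> u) (at t)"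
        by (intro DERIV_along_line bounded_linear_imp_has_derivative bounded_linear_inner_right)
      then show ?thesis unfolding g_def g'_def
        by (intro DERIV_diff C2_along_curve(1)[OF C2]) (use that P_basics(3) in auto)
    qed
    have d2: "(g' u has_real_derivative u \<bullet> (hess f x *v u)) (at 0)" for u
      using DERIV_diff[OF C2_along_curve(2)[OF C2 xE, of u 0] DERIV_const[of "a0 \<bullet> u"]]
      unfolding g'_def by simp
    have g0: "g' u 0 = 0"
    proof -
      obtain s where s: "s > 0" "ball x s \<subseteq> P" using openE[OF P_basics(1) x] .
      define d where "d = s / (norm u + 1)"
      have "d > 0" using s(1) by (simp add: d_def add_nonneg_pos)
      have "g u t \<le> g u 0" if "\<bar>0 - t\<bar> < d" for t
      proof -
        have "\<bar>t\<bar> * norm u \<le> \<bar>t\<bar> * (norm u + 1)" by (intro mult_left_mono) auto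
        also have "\<dots> < d * (norm u + 1)" using that by (intro mult_strict_right_mono) (auto simp: add_nonneg_pos)
        also have "\<dots> = s"
        proof -
          have "norm u + 1 \<noteq> 0" using norm_ge_zero[of u] by linarith
          then show ?thesis by (simp add: d_def)
        qed
        finally have "x + t *\<^sub>R u \<in> P" using s(2) by (intro subsetD[OF s(2)]) (simp add: dist_norm)
        then show ?thesis using max[of "x + t *\<^sub>R u"] closure_subset[of P] eq by (auto simp: g_def)
      qed
      then show ?thesis using DERIV_local_max[OF d[of 0 u] \<open>d > 0\<close>] x by simp
    qed
    show ?thesis
    proof (rule second_deriv_max[of r "g u" "g' u"])
      show "(g u has_real_derivative g' u t) (at t)" if "0 \<le> t" "t < r" for t by (rule d[OF r(2)[OF that]])
      show "g u t \<le> g u 0" if "0 < t" "t < r" for t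
        using max[of "x + t *\<^sub>R u"] closure_subset[of P] eq r(2)[of t] that by (auto simp: g_def)
    qed (use r d2 g0 in auto)
  qed
  then have "trace (hess f x) - grad f x \<bullet> (hess f x *v grad f x) / graph_W f x \<le> 0"
    using trace_inverse_metric_le[of "hess f x" 0 0 0 "grad f x"] by (simp add: graph_W_eq)
  then have "H x \<le> 0" unfolding graph_mean_curvature_eq using graph_W_ge_1[of f x]
    by (intro divide_nonpos_nonneg) auto
  then show False using P_basics(5)[OF x] by simp
qed

lemma step_outside_closure:
  fixes \<gamma> :: "real \<Rightarrow> real^'n"
  assumes C: "C \<in> components (- P)" and x: "x \<in> C" and \<gamma>: "continuous_on {0..s} \<gamma>" "\<gamma> 0 = x" "s \<ge> 0"
    and out: "\<And>t. 0 < t \<Longrightarrow> t \<le> s \<Longrightarrow> \<gamma> t \<notin> P"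
  shows "\<gamma> s \<in> C"
proof (rule path_in_component[OF C \<gamma>(1) _ \<gamma>(3)])
  show "\<gamma> 0 \<in> C" using \<gamma>(2) x by simp
  show "\<gamma> t \<in> - P" if "0 \<le> t" "t \<le> s" for t
    using out[of t] that \<gamma>(2) x in_components_subset[OF C] by (cases "t = 0") auto
qed

end

lemma gaussian_along_line:
  fixes A p q r :: real
  shows "((\<lambda>t. exp (- A * (p + 2 * t * q + t\<^sup>2 * r))) has_real_derivative
      (- A * (2 * q + 2 * t * r)) * exp (- A * (p + 2 * t * q + t\<^sup>2 * r))) (at t)"
    "((\<lambda>t. (- A * (2 * q + 2 * t * r)) * exp (- A * (p + 2 * t * q + t\<^sup>2 * r))) has_real_derivative
      (4 * A\<^sup>2 * q\<^sup>2 - 2 * A * r) * exp (- A * p)) (at 0)"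
  by (auto intro!: derivative_eq_intros simp: power2_eq_square algebra_simps)

context tilted_maximum
begin

text \<open>Replace \<open>f\<close> on each complementary component of \<open>P\<close> by the affine function it agrees with, to
  first order, on the boundary of that component. The resulting \<open>w\<close> is a subsolution.\<close>

definition hole :: "real^'n \<Rightarrow> (real^'n) set" where
  "hole x = connected_component_set (- P) x"

definition hole_coeffs :: "(real^'n) set \<Rightarrow> (real^'n) \<times> real" where
  "hole_coeffs C = (SOME ab. \<forall>x\<in>frontier C. x \<in> Z \<and> grad f x = fst ab \<and> f x = fst ab \<bullet> x + snd ab)"

definition w :: "real^'n \<Rightarrow> real" where
  "w x = (if x \<in> P then f x - a0 \<bullet> x
          else (fst (hole_coeffs (hole x)) - a0) \<bullet> x + snd (hole_coeffs (hole x)))"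

lemma hole: "x \<notin> P \<Longrightarrow> hole x \<in> components (- P)" "x \<notin> P \<Longrightarrow> x \<in> hole x"
  using component_of unfolding hole_def by blast+

lemma hole_eq: "y \<in> hole x \<Longrightarrow> x \<notin> P \<Longrightarrow> hole y = hole x"
  using component_eq[OF hole(1)] unfolding hole_def by blast

lemma hole_coeffs:
  assumes x: "x \<in> E" "x \<notin> P" and z: "z \<in> frontier (hole x)"
  shows "z \<in> Z" "grad f z = fst (hole_coeffs (hole x))"
    "f z = fst (hole_coeffs (hole x)) \<bullet> z + snd (hole_coeffs (hole x))"
proof -
  obtain a b where "\<And>y. y \<in> frontier (hole x) \<Longrightarrow> y \<in> Z \<and> grad f y = a \<and> f y = a \<bullet> y + b"
    by (rule hole_affine_E[OF hole(1)[OF x(2)] hole(2)[OF x(2)] x(1)]) (rule that)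
  then have "\<forall>y\<in>frontier (hole x). y \<in> Z \<and> grad f y = fst (a, b) \<and> f y = fst (a, b) \<bullet> y + snd (a, b)" by simp
  then have "\<forall>y\<in>frontier (hole x). y \<in> Z \<and> grad f y = fst (hole_coeffs (hole x)) \<and>
      f y = fst (hole_coeffs (hole x)) \<bullet> y + snd (hole_coeffs (hole x))"
    unfolding hole_coeffs_def by (rule someI)
  then show "z \<in> Z" "grad f z = fst (hole_coeffs (hole x))"
    "f z = fst (hole_coeffs (hole x)) \<bullet> z + snd (hole_coeffs (hole x))" using z by blast+
qed

lemma frontier_hole: "x \<notin> P \<Longrightarrow> frontier (hole x) \<subseteq> closure P - P"
  using complement_component(3)[OF hole(1)] frontier_P_eq by blast

lemma w_on_closure:
  assumes "x \<in> E" "x \<in> closure P" shows "w x = f x - a0 \<bullet> x"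
proof (cases "x \<in> P")
  case False
  have "x \<in> frontier (hole x)" by (rule in_frontier_component[OF hole[OF False] assms(2)])
  from hole_coeffs(3)[OF assms(1) False this] show ?thesis using False by (simp add: w_def inner_diff_left)
qed (simp add: w_def)

lemma w_le:
  assumes x: "x \<in> E" shows "w x \<le> m"
proof (cases "x \<in> P")
  case True
  then show ?thesis using no_max_in_P[OF True] by (simp add: w_def)
next
  case False
  note C = hole(1)[OF False]
  define v b where "v = fst (hole_coeffs (hole x)) - a0" and "b = snd (hole_coeffs (hole x))"
  have wx: "w x = v \<bullet> x + b" using False by (simp add: w_def v_def b_def)
  have on_front: "v \<bullet> q + b \<le> m" if q: "q \<in> frontier (hole x)" for q
  proof -
    have "f q = fst (hole_coeffs (hole x)) \<bullet> q + b" unfolding b_def by (rule hole_coeffs(3)[OF x False q])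
    moreover have "f q - a0 \<bullet> q \<le> m" using max frontier_hole[OF False] q by blast
    ultimately show ?thesis by (simp add: v_def inner_diff_left)
  qed
  show ?thesis
  proof (cases "v = 0")
    case True
    obtain q where "q \<in> frontier (hole x)" using complement_component(4)[OF C] by blast
    from on_front[OF this] show ?thesis using True wx by simp
  next
    case v: False
    have bC: "bounded (hole x)"
    proof (rule ccontr)
      assume nb: "\<not> bounded (hole x)"
      obtain q where q: "q \<in> frontier (hole x)" using complement_component(4)[OF C] by blast
      have "grad f q = a0" using unbounded[OF C nb q] by blast
      then show False using hole_coeffs(2)[OF x False q] v by (simp add: v_def)
    qed
    obtain t where t: "t \<ge> 0" "x + t *\<^sub>R v \<in> frontier (hole x)"
      using ray_exit[OF bC hole(2)[OF False] v] .
    have "v \<bullet> x + t * (v \<bullet> v) + b \<le> m" using on_front[OF t(2)] by (simp add: inner_add_right)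
    moreover have "t * (v \<bullet> v) \<ge> 0" using t(1) by simp
    ultimately show ?thesis using wx by linarith
  qed
qed

lemma w_expansion:
  assumes x: "x \<in> E" "x \<notin> P"
  obtains l where "\<And>\<epsilon>. \<epsilon> > 0 \<Longrightarrow> \<exists>\<delta>>0. ball x \<delta> \<subseteq> E \<and>
    (\<forall>h. norm h < \<delta> \<longrightarrow> \<bar>w (x + h) - w x - l \<bullet> h\<bar> \<le> \<epsilon> * (norm h)\<^sup>2)"
proof -
  define a b where "a = fst (hole_coeffs (hole x))" and "b = snd (hole_coeffs (hole x))"
  have wx: "w x = (a - a0) \<bullet> x + b" using x by (simp add: w_def a_def b_def)
  have same: "w y = (a - a0) \<bullet> y + b" if "y \<in> hole x" for y
  proof -
    have "y \<notin> P" using that complement_component(6)[OF hole(1)[OF x(2)]] by blast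
    then show ?thesis using hole_eq[OF that x(2)] by (simp add: w_def a_def b_def)
  qed
  show ?thesis
  proof (rule that[of "a - a0"])
    fix \<epsilon> :: real assume \<epsilon>: "\<epsilon> > 0"
    show "\<exists>\<delta>>0. ball x \<delta> \<subseteq> E \<and>
        (\<forall>h. norm h < \<delta> \<longrightarrow> \<bar>w (x + h) - w x - (a - a0) \<bullet> h\<bar> \<le> \<epsilon> * (norm h)\<^sup>2)"
    proof (cases "x \<in> frontier (hole x)")
      case False
      then have xi: "x \<in> interior (hole x) \<inter> E"
        using hole(2)[OF x(2)] closure_subset x(1) by (auto simp: frontier_def)
      obtain \<delta> where \<delta>: "\<delta> > 0" "ball x \<delta> \<subseteq> interior (hole x) \<inter> E"
        by (rule openE[OF open_Int[OF open_interior open_E] xi]) (rule that)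
      have "w (x + h) - w x - (a - a0) \<bullet> h = 0" if "norm h < \<delta>" for h
      proof -
        have "x + h \<in> ball x \<delta>" using that by (simp add: dist_norm)
        then have "x + h \<in> hole x" using \<delta>(2) interior_subset by blast
        from same[OF this] show ?thesis by (simp add: wx inner_add_right)
      qed
      then show ?thesis using \<delta> \<epsilon> by (intro exI[of _ \<delta>]) auto
    next
      case True
      have xZ: "x \<in> Z" and gx: "grad f x = a" and fx: "f x = a \<bullet> x + b"
        using hole_coeffs[OF x True] by (auto simp: a_def b_def)
      have h0: "hess f x = 0" using hess_zero xZ by blast
      obtain \<delta> where \<delta>: "\<delta> > 0" "ball x \<delta> \<subseteq> E"
        "\<And>k. norm k < \<delta> \<Longrightarrow> norm (grad f (x + k) - grad f x) \<le> \<epsilon> / 2 * norm k"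
        "\<And>k. norm k < \<delta> \<Longrightarrow> \<bar>f (x + k) - f x - grad f x \<bullet> k\<bar> \<le> \<epsilon> / 2 * (norm k)\<^sup>2"
        by (rule flat_expansion[OF C2 open_E x(1) h0, of "\<epsilon> / 2"]) (use \<epsilon> in simp, rule that)
      have "\<bar>w (x + h) - w x - (a - a0) \<bullet> h\<bar> \<le> \<epsilon> * (norm h)\<^sup>2" if h: "norm h < \<delta>" for h
      proof -
        have yE: "x + h \<in> E" using \<delta>(2) h by (intro subsetD[OF \<delta>(2)]) (simp add: dist_norm)
        consider "x + h \<in> P" | "x + h \<in> hole x" | "x + h \<notin> P" "x + h \<notin> hole x" by blast
        then show ?thesis
        proof cases
          case 1
          then have "w (x + h) - w x - (a - a0) \<bullet> h = f (x + h) - f x - grad f x \<bullet> h"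
            by (simp add: w_def[of "x + h"] wx fx gx inner_add_right inner_diff_left)
          moreover have "\<epsilon> / 2 * (norm h)\<^sup>2 \<le> \<epsilon> * (norm h)\<^sup>2" using \<epsilon> by (intro mult_right_mono) auto
          ultimately show ?thesis using \<delta>(4)[OF h] by linarith
        next
          case 2
          from same[OF this] show ?thesis using \<epsilon> by (simp add: wx inner_add_right)
        next
          case 3
          let ?C = "hole (x + h)"
          have "x \<notin> ?C" using hole_eq[of x "x + h"] hole(2) 3 x(2) by metis
          moreover have "x + h \<in> ?C" by (rule hole(2)[OF 3(1)])
          ultimately have "closed_segment x (x + h) \<inter> frontier ?C \<noteq> {}"
            by (intro connected_Int_frontier) auto
          then obtain t where t: "0 \<le> t" "t \<le> 1" and z: "x + t *\<^sub>R h \<in> frontier ?C"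
            by (auto simp: in_segment algebra_simps)
          define k where "k = t *\<^sub>R h"
          have kh: "norm k \<le> norm h" using t by (simp add: k_def mult_left_le_one_le)
          then have k\<delta>: "norm k < \<delta>" using h by simp
          have hk: "norm (h - k) \<le> norm h"
          proof -
            have "h - k = (1 - t) *\<^sub>R h" by (simp add: k_def algebra_simps)
            then show ?thesis using t by (simp add: mult_left_le_one_le)
          qed
          define a' b' where "a' = fst (hole_coeffs ?C)" and "b' = snd (hole_coeffs ?C)"
          have a': "grad f (x + k) = a'" "f (x + k) = a' \<bullet> (x + k) + b'"
            using hole_coeffs(2,3)[OF yE 3(1) z] by (auto simp: a'_def b'_def k_def)
          have wy: "w (x + h) = (a' - a0) \<bullet> (x + h) + b'" using 3(1) by (simp add: w_def a'_def b'_def)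
          have "w (x + h) - w x - (a - a0) \<bullet> h = (f (x + k) - f x - grad f x \<bullet> k) + (a' - a) \<bullet> (h - k)"
            unfolding wy wx a'(2) fx gx by (simp add: inner_add_right inner_diff_left inner_diff_right)
          also have "\<bar>\<dots>\<bar> \<le> \<bar>f (x + k) - f x - grad f x \<bullet> k\<bar> + \<bar>(a' - a) \<bullet> (h - k)\<bar>" by (rule abs_triangle_ineq)
          also have "\<dots> \<le> \<epsilon> / 2 * (norm h)\<^sup>2 + \<epsilon> / 2 * (norm h)\<^sup>2"
          proof (rule add_mono)
            have "\<epsilon> / 2 * (norm k)\<^sup>2 \<le> \<epsilon> / 2 * (norm h)\<^sup>2" using \<epsilon> kh by (intro mult_left_mono power_mono) auto
            then show "\<bar>f (x + k) - f x - grad f x \<bullet> k\<bar> \<le> \<epsilon> / 2 * (norm h)\<^sup>2" using \<delta>(4)[OF k\<delta>] by linarith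
            have "\<bar>(a' - a) \<bullet> (h - k)\<bar> \<le> norm (a' - a) * norm (h - k)" by (rule Cauchy_Schwarz_ineq2)
            also have "\<dots> \<le> (\<epsilon> / 2 * norm h) * norm h"
            proof (rule mult_mono)
              have "norm (a' - a) \<le> \<epsilon> / 2 * norm k" using \<delta>(3)[OF k\<delta>] by (simp add: a' gx)
              also have "\<dots> \<le> \<epsilon> / 2 * norm h" using kh \<epsilon> by (intro mult_left_mono) auto
              finally show "norm (a' - a) \<le> \<epsilon> / 2 * norm h" .
            qed (use hk \<epsilon> in auto)
            finally show "\<bar>(a' - a) \<bullet> (h - k)\<bar> \<le> \<epsilon> / 2 * (norm h)\<^sup>2" by (simp add: power2_eq_square)
          qed
          finally show ?thesis by simp
        qed
      qed
      then show ?thesis using \<delta>(1,2) by blast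
    qed
  qed
qed

lemma continuous_w: "continuous_on E w"
proof (rule continuous_at_imp_continuous_on, rule ballI)
  fix x assume x: "x \<in> E"
  show "isCont w x"
  proof (cases "x \<in> P")
    case True
    have "continuous_on P (\<lambda>x. f x - a0 \<bullet> x)"
      by (intro continuous_intros continuous_on_subset[OF Ck_on_continuous[OF C2] P_basics(3)])
    then have "continuous_on P w" by (subst continuous_on_cong[of P P w "\<lambda>x. f x - a0 \<bullet> x"]) (auto simp: w_def)
    then show ?thesis using P_basics(1) True continuous_on_eq_continuous_at by blast
  next
    case False
    obtain l where l: "\<And>\<epsilon>. \<epsilon> > 0 \<Longrightarrow> \<exists>\<delta>>0. ball x \<delta> \<subseteq> E \<and>
        (\<forall>h. norm h < \<delta> \<longrightarrow> \<bar>w (x + h) - w x - l \<bullet> h\<bar> \<le> \<epsilon> * (norm h)\<^sup>2)"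
      by (rule w_expansion[OF x False]) (rule that)
    obtain \<delta> where \<delta>: "\<delta> > 0" "\<And>h. norm h < \<delta> \<Longrightarrow> \<bar>w (x + h) - w x - l \<bullet> h\<bar> \<le> 1 * (norm h)\<^sup>2"
      using l[OF zero_less_one] by blast
    have "((\<lambda>h. w (x + h) - w x) \<longlongrightarrow> 0) (at 0)"
    proof (rule Lim_null_comparison)
      show "\<forall>\<^sub>F h in at 0. norm (w (x + h) - w x) \<le> \<bar>l \<bullet> h\<bar> + (norm h)\<^sup>2"
        unfolding eventually_at
      proof (intro exI[of _ \<delta>] conjI ballI impI)
        fix h :: "real^'n" assume "h \<noteq> 0 \<and> dist h 0 < \<delta>"
        then have "\<bar>w (x + h) - w x - l \<bullet> h\<bar> \<le> 1 * (norm h)\<^sup>2" by (intro \<delta>(2)) simp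
        then show "norm (w (x + h) - w x) \<le> \<bar>l \<bullet> h\<bar> + (norm h)\<^sup>2" unfolding real_norm_def by linarith
      qed (rule \<delta>(1))
      have "((\<lambda>h. \<bar>l \<bullet> h\<bar> + (norm h)\<^sup>2) \<longlongrightarrow> \<bar>l \<bullet> (0::real^'n)\<bar> + (norm (0::real^'n))\<^sup>2) (at 0)"
        by (intro tendsto_intros)
      then show "((\<lambda>h. \<bar>l \<bullet> h\<bar> + (norm h)\<^sup>2) \<longlongrightarrow> 0) (at (0::real^'n))" by simp
    qed
    then have "((\<lambda>h. w (x + h)) \<longlongrightarrow> w x) (at 0)" by (simp add: LIM_zero_iff)
    then show ?thesis by (simp add: isCont_iff)
  qed
qed

text \<open>Hopf's boundary point lemma at the point \<open>q\<close> of \<open>{w = m}\<close> nearest to a point of \<open>P\<close>.\<close>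

lemma no_max_in_E:
  assumes x1: "x1 \<in> E" "x1 \<in> closure P" "f x1 - a0 \<bullet> x1 = m"
  shows False
proof -
  have wx1: "w x1 = m" using w_on_closure[OF x1(1,2)] x1(3) by simp
  obtain \<rho> where \<rho>: "\<rho> > 0" "ball x1 \<rho> \<subseteq> E" using openE[OF open_E x1(1)] .
  have "ball x1 (\<rho> / 4) \<inter> P \<noteq> {}"
    using x1(2) \<rho>(1) open_Int_closure_eq_empty[OF open_ball, of x1 "\<rho> / 4" P] by force
  then obtain x0 where x0: "x0 \<in> P" "dist x1 x0 < \<rho> / 4" by auto
  have wx0: "w x0 < m" using no_max_in_P[OF x0(1)] x0(1) by (simp add: w_def)
  define r0 where "r0 = dist x0 x1"
  have K0: "cball x0 r0 \<subseteq> E"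
  proof
    fix x assume "x \<in> cball x0 r0"
    then have "dist x1 x < \<rho>"
      using dist_triangle[of x1 x x0] x0(2) \<rho>(1) by (auto simp: r0_def dist_commute)
    then show "x \<in> E" using \<rho>(2) by auto
  qed
  define Q where "Q = cball x0 r0 \<inter> w -` {m}"
  have "closed Q" unfolding Q_def
    by (rule continuous_closed_preimage[OF continuous_on_subset[OF continuous_w K0]]) auto
  then have "compact Q" unfolding Q_def by (simp add: compact_eq_bounded_closed bounded_Int)
  moreover have "x1 \<in> Q" using wx1 by (simp add: Q_def r0_def)
  ultimately obtain q where q: "q \<in> Q" "\<And>x. x \<in> Q \<Longrightarrow> dist x0 q \<le> dist x0 x"
    using distance_attains_inf[of Q x0] compact_imp_closed by blast
  define R where "R = dist x0 q"
  have wq: "w q = m" and qE: "q \<in> E" and Rr0: "R \<le> r0" using q(1) K0 by (auto simp: Q_def R_def)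
  have "q \<noteq> x0" using wx0 wq by auto
  then have R: "R > 0" by (simp add: R_def)
  have K: "cball x0 R \<subseteq> E" using K0 subset_cball[OF Rr0, of x0] by blast
  have inside: "w x < m" if "dist x0 x < R" for x
  proof -
    have "x \<notin> Q" using q(2)[of x] that by (auto simp: R_def)
    then have "w x \<noteq> m" using that Rr0 by (auto simp: Q_def)
    moreover have "w x \<le> m" by (rule w_le, rule subsetD[OF K]) (use that in simp)
    ultimately show ?thesis by simp
  qed
  have qP: "q \<notin> P" using no_max_in_P[of q] wq by (auto simp: w_def)
  obtain \<Lambda>0 where \<Lambda>0: "\<And>x. x \<in> cball x0 R \<Longrightarrow> norm (grad f x) \<le> \<Lambda>0"
  proof -
    have "compact (grad f ` cball x0 R)"
      by (rule compact_continuous_image[OF continuous_on_subset[OF continuous_grad K] compact_cball])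
    then have "bounded (grad f ` cball x0 R)" by (rule compact_imp_bounded)
    then obtain B where "\<forall>y\<in>grad f ` cball x0 R. norm y \<le> B" unfolding bounded_iff by blast
    then show ?thesis using that by blast
  qed
  define \<Lambda> where "\<Lambda> = 1 + \<Lambda>0\<^sup>2"
  have \<Lambda>: "\<Lambda> > 0" "\<And>x. x \<in> cball x0 R \<Longrightarrow> 1 + (norm (grad f x))\<^sup>2 \<le> \<Lambda>"
    using \<Lambda>0 by (auto simp: \<Lambda>_def add_pos_nonneg intro!: power_mono)
  define n where "n = real CARD('n)"
  have n: "n \<ge> 1" using card by (simp add: n_def)
  define A where "A = 4 * n * \<Lambda> / R\<^sup>2 + 4 / R\<^sup>2"
  have A: "A > 0" using n \<Lambda>(1) R unfolding A_def by (intro add_nonneg_pos) auto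
  define \<kappa> where "\<kappa> x = exp (- A * (norm (x - x0))\<^sup>2) - exp (- A * R\<^sup>2)" for x
  have \<kappa>_line: "\<kappa> (y + t *\<^sub>R s) = exp (- A * ((norm (y - x0))\<^sup>2 + 2 * t * ((y - x0) \<bullet> s) + t\<^sup>2 * (norm s)\<^sup>2)) - exp (- A * R\<^sup>2)"
    for y s t
  proof -
    have "(norm (y + t *\<^sub>R s - x0))\<^sup>2 = (norm ((y - x0) + t *\<^sub>R s))\<^sup>2" by (simp add: algebra_simps)
    also have "\<dots> = (norm (y - x0))\<^sup>2 + 2 * t * ((y - x0) \<bullet> s) + t\<^sup>2 * (norm s)\<^sup>2"
      unfolding power2_norm_eq_inner by (simp only: inner_add_left inner_add_right inner_scaleR_left
        inner_scaleR_right inner_commute[of s "y - x0"] power2_eq_square) (simp add: algebra_simps)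
    finally show ?thesis by (simp add: \<kappa>_def)
  qed
  have \<kappa>_cont: "continuous_on X \<kappa>" for X unfolding \<kappa>_def by (intro continuous_intros)
  have \<kappa>_le1: "\<kappa> x \<le> 1" for x
  proof -
    have "exp (- A * (norm (x - x0))\<^sup>2) \<le> 1" using A by simp
    then show ?thesis unfolding \<kappa>_def by (smt (verit) exp_gt_zero)
  qed
  define Sph where "Sph = sphere x0 (R / 2)"
  have SphK: "Sph \<subseteq> cball x0 R" using R by (auto simp: Sph_def)
  have "Sph \<noteq> {}" using R by (simp add: Sph_def)
  moreover have "continuous_on Sph w" by (rule continuous_on_subset[OF continuous_w]) (use SphK K in blast)
  moreover have "compact Sph" by (simp add: Sph_def)
  ultimately obtain x2 where x2: "x2 \<in> Sph" "\<And>x. x \<in> Sph \<Longrightarrow> w x \<le> w x2"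
    using continuous_attains_sup[of Sph w] by blast
  define \<epsilon> where "\<epsilon> = m - w x2"
  have \<epsilon>: "\<epsilon> > 0" using inside[of x2] x2(1) R by (simp add: \<epsilon>_def Sph_def)
  define Ann where "Ann = cball x0 R - ball x0 (R / 2)"
  have AnnK: "Ann \<subseteq> E" using K by (auto simp: Ann_def)
  have "compact Ann" unfolding Ann_def by (intro compact_diff compact_cball open_ball)
  moreover have "q \<in> Ann" using R by (auto simp: Ann_def R_def[symmetric])
  moreover have "continuous_on Ann (\<lambda>x. w x + \<epsilon> * \<kappa> x)"
    by (intro continuous_intros continuous_on_subset[OF continuous_w AnnK] \<kappa>_cont)
  ultimately obtain y where y: "y \<in> Ann" "\<And>x. x \<in> Ann \<Longrightarrow> w x + \<epsilon> * \<kappa> x \<le> w y + \<epsilon> * \<kappa> y"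
    using continuous_attains_sup[of Ann "\<lambda>x. w x + \<epsilon> * \<kappa> x"] by blast
  have "w y + \<epsilon> * \<kappa> y \<le> m"
  proof (rule ccontr)
    assume gt: "\<not> ?thesis"
    have yE: "y \<in> E" using y(1) AnnK by blast
    have yR: "dist x0 y \<le> R" "R / 2 \<le> dist x0 y" using y(1) by (auto simp: Ann_def)
    have "dist x0 y \<noteq> R"
    proof
      assume "dist x0 y = R"
      then have "\<kappa> y = 0" by (simp add: \<kappa>_def dist_norm norm_minus_commute)
      then show False using gt w_le[OF yE] by simp
    qed
    moreover have "dist x0 y \<noteq> R / 2"
    proof
      assume "dist x0 y = R / 2"
      then have "w y \<le> w x2" by (intro x2(2)) (simp add: Sph_def)
      moreover have "\<epsilon> * \<kappa> y \<le> \<epsilon> * 1" using \<epsilon> \<kappa>_le1 by (intro mult_left_mono) auto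
      ultimately show False using gt by (simp add: \<epsilon>_def)
    qed
    ultimately have yI: "y \<in> ball x0 R - cball x0 (R / 2)" using yR by auto
    have oI: "open (ball x0 R - cball x0 (R / 2))" by auto
    have IAnn: "ball x0 R - cball x0 (R / 2) \<subseteq> Ann" by (auto simp: Ann_def)
    define d where "d = y - x0"
    define ex where "ex = exp (- A * (norm d)\<^sup>2)"
    have ex: "ex > 0" by (simp add: ex_def)
    have dR: "norm d \<ge> R / 2" using yR by (simp add: d_def dist_norm norm_minus_commute)
    then have d2: "(norm d)\<^sup>2 \<ge> R\<^sup>2 / 4" using power_mono[OF dR, of 2] R by (simp add: power_divide)
    define k where "k s t = exp (- A * ((norm d)\<^sup>2 + 2 * t * (d \<bullet> s) + t\<^sup>2 * (norm s)\<^sup>2))" for s t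
    define k' where "k' s t = (- A * (2 * (d \<bullet> s) + 2 * t * (norm s)\<^sup>2)) *
        exp (- A * ((norm d)\<^sup>2 + 2 * t * (d \<bullet> s) + t\<^sup>2 * (norm s)\<^sup>2))" for s t
    define D where "D s = (4 * A\<^sup>2 * (d \<bullet> s)\<^sup>2 - 2 * A * (norm s)\<^sup>2) * ex" for s
    have dk: "(k s has_real_derivative k' s t) (at t)" "(k' s has_real_derivative D s) (at 0)" for s t
      unfolding k_def k'_def D_def ex_def by (rule gaussian_along_line)+
    have \<kappa>k: "\<kappa> (y + t *\<^sub>R s) - \<kappa> y = k s t - k s 0" for s t
      using \<kappa>_line[of y t s] \<kappa>_line[of y 0 s] by (simp add: k_def d_def)
    have line: "\<exists>r>0. \<forall>t. \<bar>t\<bar> < r \<longrightarrow> y + t *\<^sub>R s \<in> ball x0 R - cball x0 (R / 2)" for s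
    proof -
      obtain r where r: "r > 0" "ball y r \<subseteq> ball x0 R - cball x0 (R / 2)" using openE[OF oI yI] .
      show ?thesis
      proof (intro exI[of _ "r / (norm s + 1)"] conjI allI impI)
        have pos: "norm s + 1 > 0" by (simp add: add_nonneg_pos)
        then show "r / (norm s + 1) > 0" using r(1) by simp
        fix t assume t: "\<bar>t\<bar> < r / (norm s + 1)"
        have "\<bar>t\<bar> * norm s \<le> \<bar>t\<bar> * (norm s + 1)" by (intro mult_left_mono) auto
        also have "\<dots> < r" using t pos by (simp add: pos_less_divide_eq)
        finally show "y + t *\<^sub>R s \<in> ball x0 R - cball x0 (R / 2)"
          by (intro subsetD[OF r(2)]) (simp add: dist_norm)
      qed
    qed
    have locmax: "w (y + t *\<^sub>R s) - w y + \<epsilon> * (k s t - k s 0) \<le> 0" if "y + t *\<^sub>R s \<in> ball x0 R - cball x0 (R / 2)" for s t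
    proof -
      have "w (y + t *\<^sub>R s) + \<epsilon> * \<kappa> (y + t *\<^sub>R s) \<le> w y + \<epsilon> * \<kappa> y" using that IAnn by (intro y(2)) blast
      then show ?thesis unfolding \<kappa>k[symmetric] by (simp add: algebra_simps)
    qed
    show False
    proof (cases "y \<in> P")
      case False
      obtain l where l: "\<And>\<epsilon>. \<epsilon> > 0 \<Longrightarrow> \<exists>\<delta>>0. ball y \<delta> \<subseteq> E \<and>
          (\<forall>h. norm h < \<delta> \<longrightarrow> \<bar>w (y + h) - w y - l \<bullet> h\<bar> \<le> \<epsilon> * (norm h)\<^sup>2)"
        by (rule w_expansion[OF yE False]) (rule that)
      have nd: "norm d > 0" using dR R by linarith
      have "A * R\<^sup>2 \<ge> 4" using n \<Lambda>(1) R by (simp add: A_def distrib_right)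
      moreover have "A * (R\<^sup>2 / 4) \<le> A * (norm d)\<^sup>2" using d2 A by (intro mult_left_mono) auto
      ultimately have "A * (norm d)\<^sup>2 \<ge> 1" by simp
      then have "4 * A * (A * (norm d)\<^sup>2) \<ge> 4 * A * 1" using A by (intro mult_left_mono) auto
      then have "4 * A\<^sup>2 * (norm d)\<^sup>2 - 2 * A > 0" using A by (simp add: power2_eq_square mult_ac)
      then have "(4 * A\<^sup>2 * (norm d)\<^sup>2 - 2 * A) * (norm d)\<^sup>2 * ex > 0" using nd ex by simp
      moreover have "D d = (4 * A\<^sup>2 * (norm d)\<^sup>2 - 2 * A) * (norm d)\<^sup>2 * ex"
        by (simp add: D_def power2_norm_eq_inner[symmetric] algebra_simps power2_eq_square)
      ultimately have Dd: "D d > 0" by simp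
      define e where "e = \<epsilon> * D d / (4 * (norm d)\<^sup>2)"
      have e: "e > 0" using \<epsilon> Dd nd by (simp add: e_def)
      obtain \<delta> where \<delta>: "\<delta> > 0" "\<And>h. norm h < \<delta> \<Longrightarrow> \<bar>w (y + h) - w y - l \<bullet> h\<bar> \<le> e * (norm h)\<^sup>2"
        using l[OF e] by blast
      obtain r where r: "r > 0" "\<And>t. \<bar>t\<bar> < r \<Longrightarrow> y + t *\<^sub>R d \<in> ball x0 R - cball x0 (R / 2)"
        using line[of d] by blast
      define r' where "r' = min r (\<delta> / norm d)"
      have r': "r' > 0" using r(1) \<delta>(1) nd by (simp add: r'_def)
      define \<phi> where "\<phi> t = \<epsilon> * (k d t - k d 0) + t * (l \<bullet> d) - e * (norm d)\<^sup>2 * t\<^sup>2" for t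
      define \<phi>' where "\<phi>' t = \<epsilon> * k' d t + l \<bullet> d - 2 * e * (norm d)\<^sup>2 * t" for t
      have le: "\<phi> t \<le> \<phi> 0" if t: "\<bar>t\<bar> < r'" for t
      proof -
        have td: "norm (t *\<^sub>R d) < \<delta>" using t nd by (simp add: r'_def pos_less_divide_eq)
        have "\<bar>w (y + t *\<^sub>R d) - w y - t * (l \<bullet> d)\<bar> \<le> e * (norm d)\<^sup>2 * t\<^sup>2"
          using \<delta>(2)[OF td] by (simp add: power_mult_distrib mult_ac)
        moreover have "w (y + t *\<^sub>R d) - w y + \<epsilon> * (k d t - k d 0) \<le> 0"
          by (rule locmax[OF r(2)]) (use t in \<open>simp add: r'_def\<close>)
        ultimately show ?thesis by (simp add: \<phi>_def)
      qed
      have d1: "(\<phi> has_real_derivative \<phi>' t) (at t)" for t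
        unfolding \<phi>_def \<phi>'_def
        by (auto intro!: derivative_eq_intros dk(1))
      have d2: "(\<phi>' has_real_derivative \<epsilon> * D d - 2 * e * (norm d)\<^sup>2) (at 0)"
        unfolding \<phi>'_def by (auto intro!: derivative_eq_intros dk(2))
      have "\<phi>' 0 = 0" by (rule DERIV_local_max[OF d1 r']) (use le in auto)
      then have "\<epsilon> * D d - 2 * e * (norm d)\<^sup>2 \<le> 0"
        by (intro second_deriv_max[OF r' d1 d2]) (use le in auto)
      moreover have "2 * e * (norm d)\<^sup>2 = \<epsilon> * D d / 2" using nd by (simp add: e_def)
      moreover have "\<epsilon> * D d > 0" using \<epsilon> Dd by (rule mult_pos_pos)
      ultimately show False by linarith
    next
      case True
      have "s \<bullet> (hess f y *v s) \<le> 2 * A * \<epsilon> * ex * (norm s)\<^sup>2 - 4 * A\<^sup>2 * \<epsilon> * ex * (d \<bullet> s)\<^sup>2" for s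
      proof -
        obtain r1 where r1: "r1 > 0" "\<And>t. \<bar>t\<bar> < r1 \<Longrightarrow> y + t *\<^sub>R s \<in> ball x0 R - cball x0 (R / 2)"
          using line[of s] by blast
        obtain r2 where r2: "r2 > 0" "\<And>t. \<bar>t\<bar> < r2 \<Longrightarrow> y + t *\<^sub>R s \<in> P"
        proof -
          obtain r where r: "r > 0" "ball y r \<subseteq> P" using openE[OF P_basics(1) True] .
          have pos: "norm s + 1 > 0" by (simp add: add_nonneg_pos)
          show ?thesis
          proof (rule that[of "r / (norm s + 1)"])
            show "r / (norm s + 1) > 0" using r(1) pos by simp
            fix t assume t: "\<bar>t\<bar> < r / (norm s + 1)"
            have "\<bar>t\<bar> * norm s \<le> \<bar>t\<bar> * (norm s + 1)" by (intro mult_left_mono) auto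
            also have "\<dots> < r" using t pos by (simp add: pos_less_divide_eq)
            finally show "y + t *\<^sub>R s \<in> P"
              by (intro subsetD[OF r(2)]) (simp add: dist_norm)
          qed
        qed
        define r where "r = min r1 r2"
        have r: "r > 0" using r1(1) r2(1) by (simp add: r_def)
        define g where "g t = (f (y + t *\<^sub>R s + t\<^sup>2 *\<^sub>R 0) - t * (a0 \<bullet> s)) + \<epsilon> * k s t" for t
        define g' where "g' t = (grad f (y + t *\<^sub>R s + t\<^sup>2 *\<^sub>R 0) \<bullet> (s + (2 * t) *\<^sub>R 0) - a0 \<bullet> s) + \<epsilon> * k' s t" for t
        have le: "g t \<le> g 0" if t: "\<bar>t\<bar> < r" for t
        proof -
          have "w (y + t *\<^sub>R s) = f (y + t *\<^sub>R s) - a0 \<bullet> (y + t *\<^sub>R s)" "w y = f y - a0 \<bullet> y"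
            using r2(2)[of t] t True by (auto simp: w_def r_def)
          moreover have "w (y + t *\<^sub>R s) - w y + \<epsilon> * (k s t - k s 0) \<le> 0"
            by (rule locmax[OF r1(2)]) (use t in \<open>simp add: r_def\<close>)
          ultimately show ?thesis by (simp add: g_def inner_add_right algebra_simps)
        qed
        have d1: "(g has_real_derivative g' t) (at t)" if t: "\<bar>t\<bar> < r" for t
        proof -
          have "y + t *\<^sub>R s + t\<^sup>2 *\<^sub>R 0 \<in> E" using r2(2)[of t] t P_basics(3) by (auto simp: r_def)
          from C2_along_curve(1)[OF C2 this] show ?thesis unfolding g_def g'_def
            by (auto intro!: derivative_eq_intros dk(1))
        qed
        have d2: "(g' has_real_derivative s \<bullet> (hess f y *v s) + \<epsilon> * D s) (at 0)"
        proof -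
          have "((\<lambda>t. grad f (y + t *\<^sub>R s + t\<^sup>2 *\<^sub>R 0) \<bullet> (s + (2 * t) *\<^sub>R 0)) has_real_derivative
              s \<bullet> (hess f y *v s)) (at 0)"
            using C2_along_curve(2)[OF C2 yE, of s 0] by simp
          then show ?thesis unfolding g'_def by (auto intro!: derivative_eq_intros dk(2))
        qed
        have "g' 0 = 0" by (rule DERIV_local_max[OF d1 r]) (use le r in auto)
        then have "s \<bullet> (hess f y *v s) + \<epsilon> * D s \<le> 0"
          by (intro second_deriv_max[OF r d1 d2]) (use le in auto)
        then show ?thesis by (simp add: D_def algebra_simps)
      qed
      then have "trace (hess f y) - grad f y \<bullet> (hess f y *v grad f y) / (1 + (norm (grad f y))\<^sup>2)
         \<le> 2 * A * \<epsilon> * ex * CARD('n) - 4 * A\<^sup>2 * \<epsilon> * ex * (norm d)\<^sup>2 / (1 + (norm (grad f y))\<^sup>2)"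
        by (rule trace_inverse_metric_le) (use A \<epsilon> ex in auto)
      also have "\<dots> \<le> 2 * A * \<epsilon> * ex * n - 4 * A\<^sup>2 * \<epsilon> * ex * (R\<^sup>2 / 4) / \<Lambda>"
      proof -
        have "y \<in> cball x0 R" using yR by simp
        then have "1 + (norm (grad f y))\<^sup>2 \<le> \<Lambda>" by (rule \<Lambda>(2))
        moreover have "0 < 1 + (norm (grad f y))\<^sup>2" by (simp add: add_pos_nonneg)
        moreover have "4 * A\<^sup>2 * \<epsilon> * ex * (R\<^sup>2 / 4) \<le> 4 * A\<^sup>2 * \<epsilon> * ex * (norm d)\<^sup>2"
          using d2 \<epsilon> ex by (intro mult_left_mono) auto
        ultimately have "4 * A\<^sup>2 * \<epsilon> * ex * (R\<^sup>2 / 4) / \<Lambda> \<le> 4 * A\<^sup>2 * \<epsilon> * ex * (norm d)\<^sup>2 / (1 + (norm (grad f y))\<^sup>2)"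
          using \<epsilon> ex by (intro frac_le) auto
        then show ?thesis by (simp add: n_def)
      qed
      also have "\<dots> = A * \<epsilon> * ex * (2 * n - A * R\<^sup>2 / \<Lambda>)" by (simp add: power2_eq_square algebra_simps)
      also have "\<dots> \<le> 0"
      proof -
        have "A * R\<^sup>2 = 4 * n * \<Lambda> + 4" using R by (simp add: A_def distrib_right)
        then have "A * R\<^sup>2 / \<Lambda> = 4 * n + 4 / \<Lambda>" using \<Lambda>(1) by (simp add: add_divide_distrib)
        moreover have "4 / \<Lambda> > 0" using \<Lambda>(1) by simp
        ultimately have "2 * n - A * R\<^sup>2 / \<Lambda> \<le> 0" using n by linarith
        then show ?thesis using A \<epsilon> ex by (intro mult_nonneg_nonpos) auto
      qed
      finally have "trace (hess f y) - grad f y \<bullet> (hess f y *v grad f y) / graph_W f y \<le> 0"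
        by (simp add: graph_W_eq)
      then have "H y \<le> 0" unfolding graph_mean_curvature_eq using graph_W_ge_1[of f y]
        by (intro divide_nonpos_nonneg) auto
      then show False using P_basics(5)[OF True] by simp
    qed
  qed
  then have below: "w x \<le> m - \<epsilon> * \<kappa> x" if "x \<in> Ann" for x using y(2)[OF that] by linarith
  obtain l where l: "\<And>\<epsilon>. \<epsilon> > 0 \<Longrightarrow> \<exists>\<delta>>0. ball q \<delta> \<subseteq> E \<and>
      (\<forall>h. norm h < \<delta> \<longrightarrow> \<bar>w (q + h) - w q - l \<bullet> h\<bar> \<le> \<epsilon> * (norm h)\<^sup>2)"
    by (rule w_expansion[OF qE qP]) (rule that)
  obtain \<delta> where \<delta>: "\<delta> > 0" "ball q \<delta> \<subseteq> E" "\<And>h. norm h < \<delta> \<Longrightarrow> \<bar>w (q + h) - w q - l \<bullet> h\<bar> \<le> 1 * (norm h)\<^sup>2"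
    using l[OF zero_less_one] by blast
  define \<nu> where "\<nu> = (1 / R) *\<^sub>R (q - x0)"
  have n\<nu>: "norm \<nu> = 1" using R by (simp add: \<nu>_def R_def dist_norm norm_minus_commute)
  have qx: "q - x0 = R *\<^sub>R \<nu>" using R by (simp add: \<nu>_def)
  have l\<nu>: "l \<bullet> \<nu> \<le> t" if t: "0 < t" "t < \<delta>" for t
  proof -
    have nt: "norm (t *\<^sub>R \<nu>) = t" using t n\<nu> by simp
    have "q + t *\<^sub>R \<nu> \<in> E" by (rule subsetD[OF \<delta>(2)]) (use t nt in \<open>simp add: dist_norm\<close>)
    then have "w (q + t *\<^sub>R \<nu>) \<le> w q" using w_le wq by simp
    moreover have "\<bar>w (q + t *\<^sub>R \<nu>) - w q - t * (l \<bullet> \<nu>)\<bar> \<le> t\<^sup>2" using \<delta>(3)[of "t *\<^sub>R \<nu>"] t n\<nu> by simp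
    ultimately have "t * (l \<bullet> \<nu>) \<le> t * t" by (simp add: power2_eq_square)
    then show ?thesis using t(1) by simp
  qed
  have l0: "l \<bullet> \<nu> \<le> 0"
  proof (rule ccontr)
    assume "\<not> l \<bullet> \<nu> \<le> 0"
    define t where "t = min (l \<bullet> \<nu>) \<delta> / 2"
    have "0 < t" "t < \<delta>" "t < l \<bullet> \<nu>" using \<open>\<not> l \<bullet> \<nu> \<le> 0\<close> \<delta>(1) by (auto simp: t_def)
    then show False using l\<nu>[of t] by simp
  qed
  define c where "c = \<epsilon> * exp (- A * R\<^sup>2) * A * R"
  have c: "c > 0" using \<epsilon> A R by (simp add: c_def)
  define t where "t = min (min \<delta> (R / 2)) c / 2"
  have t: "0 < t" "t < \<delta>" "t < R / 2" "t < c" using \<delta>(1) R c by (auto simp: t_def)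
  let ?x = "q - t *\<^sub>R \<nu>"
  have xx: "?x - x0 = (R - t) *\<^sub>R \<nu>" using qx by (simp add: algebra_simps)
  have nx: "norm (?x - x0) = R - t" unfolding xx using t n\<nu> by simp
  have xAnn: "?x \<in> Ann" unfolding Ann_def using t nx by (simp add: dist_norm norm_minus_commute)
  have "\<kappa> ?x \<ge> exp (- A * R\<^sup>2) * (A * (R * t))"
  proof -
    have "- A * (R - t)\<^sup>2 = - A * R\<^sup>2 + A * (2 * R * t - t\<^sup>2)" by (simp add: power2_eq_square algebra_simps)
    then have "exp (- A * (R - t)\<^sup>2) = exp (- A * R\<^sup>2) * exp (A * (2 * R * t - t\<^sup>2))" by (simp only: exp_add)
    then have e: "\<kappa> ?x = exp (- A * R\<^sup>2) * (exp (A * (2 * R * t - t\<^sup>2)) - 1)"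
      unfolding \<kappa>_def nx by (simp add: algebra_simps)
    have "t * t \<le> R * t" using t R by (intro mult_right_mono) auto
    then have "R * t \<le> 2 * R * t - t\<^sup>2" by (simp add: power2_eq_square)
    then have "A * (R * t) \<le> A * (2 * R * t - t\<^sup>2)" using A by (intro mult_left_mono) auto
    also have "\<dots> \<le> exp (A * (2 * R * t - t\<^sup>2)) - 1" using exp_ge_add_one_self[of "A * (2 * R * t - t\<^sup>2)"] by linarith
    finally show ?thesis unfolding e by (intro mult_left_mono) auto
  qed
  then have "\<epsilon> * \<kappa> ?x \<ge> \<epsilon> * (exp (- A * R\<^sup>2) * (A * (R * t)))" using \<epsilon> by (intro mult_left_mono) auto
  then have "\<epsilon> * \<kappa> ?x \<ge> c * t" by (simp add: c_def mult_ac)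
  moreover have "w ?x \<ge> m - t\<^sup>2"
  proof -
    have "norm (- (t *\<^sub>R \<nu>)) = t" using t n\<nu> by simp
    then have "\<bar>w ?x - w q - l \<bullet> (- (t *\<^sub>R \<nu>))\<bar> \<le> t\<^sup>2" using \<delta>(3)[of "- (t *\<^sub>R \<nu>)"] t by simp
    moreover have "l \<bullet> (- (t *\<^sub>R \<nu>)) \<ge> 0" using mult_nonneg_nonpos[of t "l \<bullet> \<nu>"] t l0 by simp
    ultimately show ?thesis using wq by linarith
  qed
  ultimately have "c * t \<le> t * t" using below[OF xAnn] by (simp add: power2_eq_square)
  then show False using t by simp
qed

end

context tilted_maximum
begin

lemma xm_boundary: "xm \<in> frontier \<Omega>" "xm \<notin> P"
proof -
  have "xm \<notin> E" using no_max_in_E xm by blast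
  then show "xm \<in> frontier \<Omega>" using xm(1) closure_P Compl_eq by blast
  show "xm \<notin> P" using \<open>xm \<notin> E\<close> P_basics(3) by blast
qed

definition "C0 = hole xm"
definition "Sig = connected_component_set (frontier \<Omega>) xm"
definition "c = f xm"

lemma C0: "C0 \<in> components (- P)" "xm \<in> C0" "xm \<in> frontier C0" "frontier C0 \<subseteq> frontier \<Omega>"
  "C0 \<inter> E = {}" "compact C0"
proof -
  show C: "C0 \<in> components (- P)" and x: "xm \<in> C0" unfolding C0_def using hole[OF xm_boundary(2)] by auto
  show fr: "xm \<in> frontier C0" by (rule in_frontier_component[OF C x xm(1)])
  show "frontier C0 \<subseteq> frontier \<Omega>" and e: "C0 \<inter> E = {}" by (rule boundary_hole[OF C fr xm_boundary(1)])+
  have "bounded C0" using bounded_subset[OF bounded_closure[OF bounded_\<Omega>]] e by blast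
  then show "compact C0" using complement_component(1)[OF C] compact_eq_bounded_closed by blast
qed

lemma frontier_notin_E: "x \<in> frontier \<Omega> \<Longrightarrow> x \<notin> E"
  by (simp add: frontier_def)

lemma Sig: "connected Sig" "compact Sig" "Sig \<subseteq> frontier \<Omega>" "Sig \<subseteq> C0" "frontier C0 \<subseteq> Sig" "xm \<in> Sig"
  "\<And>x. x \<in> Sig \<Longrightarrow> f x = c" "\<And>x. x \<in> Sig \<Longrightarrow> connected_component_set (frontier \<Omega>) x = Sig"
proof -
  show con: "connected Sig" by (simp add: Sig_def)
  show sub: "Sig \<subseteq> frontier \<Omega>" by (simp add: Sig_def connected_component_subset)
  have "compact (frontier \<Omega>)" using bounded_\<Omega> by (simp add: compact_frontier_bounded)
  moreover have "closed Sig" unfolding Sig_def by (rule closed_connected_component) simp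
  ultimately show "compact Sig" using sub by (metis closed_Int_compact inf.absorb1)
  show xS: "xm \<in> Sig" using xm_boundary(1) by (simp add: Sig_def)
  show "Sig \<subseteq> C0"
    by (rule components_maximal[OF C0(1) con]) (use sub frontier_notin_E P_basics(3) xS C0(2) in blast)+
  show "frontier C0 \<subseteq> Sig" unfolding Sig_def
    by (rule connected_component_maximal[OF C0(3) complement_component(2)[OF C0(1)] C0(4)])
  have "Sig \<in> components (frontier \<Omega>)" unfolding Sig_def using xm_boundary(1) by (rule componentsI)
  then show "\<And>x. x \<in> Sig \<Longrightarrow> f x = c" using const xS unfolding constant_on_def c_def by metis
  show "connected_component_set (frontier \<Omega>) x = Sig" if "x \<in> Sig" for x
    using that unfolding Sig_def by (metis connected_component_eq)
qed

definition "upper = \<Union>{G. open G \<and> (\<forall>x\<in>G \<inter> E. f x > c)}"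
definition "lower = \<Union>{G. open G \<and> (\<forall>x\<in>G \<inter> E. f x < c)}"
definition "near = \<Union>{G. open G \<and> G \<inter> frontier \<Omega> \<subseteq> Sig}"

lemma open_regions: "open upper" "open lower" "open near"
  unfolding upper_def lower_def near_def by blast+

lemma regions:
  "x \<in> upper \<Longrightarrow> x \<in> E \<Longrightarrow> f x > c" "x \<in> lower \<Longrightarrow> x \<in> E \<Longrightarrow> f x < c"
  "x \<in> near \<Longrightarrow> x \<in> frontier \<Omega> \<Longrightarrow> x \<in> Sig"
  unfolding upper_def lower_def near_def by blast+

lemma Sig_near: "Sig \<subseteq> near" and Sig_cases: "Sig \<subseteq> upper \<or> Sig \<subseteq> lower"
proof -
  have loc: "x \<in> near \<and> (x \<in> upper \<or> x \<in> lower)" if x: "x \<in> Sig" for x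
  proof -
    obtain G where G: "open G" "x \<in> G" "G \<inter> frontier \<Omega> \<subseteq> connected_component_set (frontier \<Omega>) x"
      "(\<forall>y\<in>G \<inter> E. f y > f x) \<or> (\<forall>y\<in>G \<inter> E. f y < f x)"
      using boundary_sign[of x] x Sig(3) by blast
    have "x \<in> near" using G(1,2,3) Sig(8)[OF x] unfolding near_def by blast
    moreover have "x \<in> upper \<or> x \<in> lower"
      using G(1,2,4) unfolding Sig(7)[OF x] upper_def lower_def by blast
    ultimately show ?thesis by blast
  qed
  then show "Sig \<subseteq> near" by blast
  have "upper \<inter> lower \<inter> Sig = {}"
  proof (rule ccontr)
    assume "upper \<inter> lower \<inter> Sig \<noteq> {}"
    then obtain x where x: "x \<in> upper \<inter> lower" "x \<in> Sig" by blast
    have "upper \<inter> lower \<inter> E \<noteq> {}"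
      by (rule approachable[of x]) (use x Sig(3) open_regions in auto)
    then show False using regions(1,2) by force
  qed
  moreover have "Sig \<subseteq> upper \<union> lower" using loc by blast
  ultimately have "upper \<inter> Sig = {} \<or> lower \<inter> Sig = {}"
    using Sig(1) open_regions(1,2) unfolding connected_def by blast
  then show "Sig \<subseteq> upper \<or> Sig \<subseteq> lower" using \<open>Sig \<subseteq> upper \<union> lower\<close> by blast
qed

lemma not_upper: "\<not> Sig \<subseteq> upper"
proof
  assume "Sig \<subseteq> upper"
  then have xG: "xm \<in> upper \<inter> near" using Sig(6) Sig_near by blast
  have oG: "open (upper \<inter> near)" using open_regions by blast
  have ge: "f x \<ge> c" if "x \<in> upper \<inter> near" "x \<in> closure P" for x
  proof (cases "x \<in> E")
    case True
    then show ?thesis using regions(1) that by force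
  next
    case False
    then have "x \<in> frontier \<Omega>" using closure_P Compl_eq that(2) by blast
    then show ?thesis using regions(3) Sig(7) that(1) by force
  qed
  have m: "m = c - a0 \<bullet> xm" using xm(2) by (simp add: c_def)
  show False
  proof (cases "a0 = 0")
    case True
    have "(upper \<inter> near) \<inter> P \<noteq> {}" using xG xm(1) open_Int_closure_eq_empty[OF oG, of P] by blast
    then obtain x where x: "x \<in> upper" "x \<in> P" by blast
    have "f x > c" using regions(1)[OF x(1)] x(2) P_basics(3) by blast
    moreover have "f x - a0 \<bullet> x \<le> m" using max x(2) closure_subset by blast
    ultimately show False using True m by simp
  next
    case False
    obtain r where r: "r > 0" "\<And>t. 0 \<le> t \<Longrightarrow> t < r \<Longrightarrow> xm + t *\<^sub>R (- a0) + t\<^sup>2 *\<^sub>R 0 \<in> upper \<inter> near"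
      by (rule curve_in_open[OF oG xG]) (rule that)
    have aa: "a0 \<bullet> a0 > 0" using False by simp
    have out: "xm + t *\<^sub>R (- a0) \<notin> closure P" if "0 < t" "t < r" for t
    proof
      assume P: "xm + t *\<^sub>R (- a0) \<in> closure P"
      have "f (xm + t *\<^sub>R (- a0)) \<ge> c" by (rule ge[OF _ P]) (use r(2)[of t] that in simp)
      moreover have "t * (a0 \<bullet> a0) > 0" using that aa by simp
      ultimately show False using max[OF P] m by (simp add: inner_diff_right)
    qed
    have y: "xm + (r / 2) *\<^sub>R (- a0) \<in> C0"
    proof (rule step_outside_closure[OF C0(1,2), of "r / 2" "\<lambda>t. xm + t *\<^sub>R (- a0)"])
      show "xm + t *\<^sub>R (- a0) \<notin> P" if "0 < t" "t \<le> r / 2" for t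
      proof -
        have "t < r" using that r(1) by simp
        then show ?thesis using out[OF that(1)] closure_subset by blast
      qed
    qed (use r(1) in \<open>auto intro!: continuous_intros\<close>)
    obtain s where s: "s \<ge> 0" "(xm + (r / 2) *\<^sub>R (- a0)) + s *\<^sub>R (- a0) \<in> frontier C0"
      by (rule ray_exit[OF compact_imp_bounded[OF C0(6)] y, of "- a0"]) (use False in simp, rule that)
    define q where "q = (xm + (r / 2) *\<^sub>R (- a0)) + s *\<^sub>R (- a0)"
    have q: "q \<in> frontier C0" using s(2) by (simp add: q_def)
    have "f q = c" by (rule Sig(7)) (use q Sig(5) in blast)
    moreover have "q \<in> closure P" using complement_component(3)[OF C0(1)] q frontier_P_eq by blast
    then have "f q - a0 \<bullet> q \<le> m" by (rule max)
    ultimately have "(r / 2 + s) * (a0 \<bullet> a0) \<le> 0" using m by (simp add: q_def inner_diff_right inner_add_right algebra_simps)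
    moreover have "(r / 2 + s) * (a0 \<bullet> a0) > 0" using r(1) s(1) aa by (intro mult_pos_pos) auto
    ultimately show False by simp
  qed
qed

lemma norm_increases:
  fixes y v :: "'a::real_inner"
  assumes "y \<bullet> v \<ge> 0" "v \<noteq> 0" "t > 0"
  shows "norm (y + t *\<^sub>R v) > norm y"
proof (rule power2_less_imp_less)
  have "(norm (y + t *\<^sub>R v))\<^sup>2 = (norm y)\<^sup>2 + 2 * t * (y \<bullet> v) + t\<^sup>2 * (v \<bullet> v)"
    unfolding power2_norm_eq_inner
    by (simp add: inner_add_left inner_add_right inner_commute[of v y] power2_eq_square algebra_simps)
  moreover have "t * (y \<bullet> v) \<ge> 0" using assms by simp
  moreover have "t\<^sup>2 * (v \<bullet> v) > 0" using assms by simp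
  ultimately show "(norm y)\<^sup>2 < (norm (y + t *\<^sub>R v))\<^sup>2" by linarith
qed simp

lemma orthogonal_direction:
  fixes a y :: "real^'n"
  obtains v where "v \<noteq> 0" "v \<bullet> a = 0" "y \<bullet> v \<ge> 0"
proof -
  have "2 \<le> DIM(real^'n)" using card by simp
  then obtain u where u: "u \<noteq> 0" "orthogonal a u" by (rule orthogonal_to_vector_exists[of a]) (rule that)
  show ?thesis
  proof (cases "y \<bullet> u \<ge> 0")
    case True
    then show ?thesis using that[of u] u by (simp add: orthogonal_def inner_commute)
  next
    case False
    then show ?thesis using that[of "- u"] u by (simp add: orthogonal_def inner_commute)
  qed
qed

text \<open>The point \<open>y\<close> is farthest from the origin in a superlevel set of \<open>f\<close> close to \<open>Sig\<close>.\<close>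

lemma farthest_point:
  assumes low: "Sig \<subseteq> lower"
  obtains y e \<epsilon> \<Lambda> where "\<Lambda> \<ge> norm a0" "e > 0" "y \<in> closure P" "y \<in> E" "infdist y Sig < e" "norm (grad f y) > \<Lambda>"
    "f y \<ge> c - \<epsilon>"
    "\<And>x. x \<in> E \<Longrightarrow> infdist x Sig = e \<Longrightarrow> norm (grad f x) \<le> \<Lambda>"
    "\<And>x. x \<in> closure P \<Longrightarrow> infdist x Sig \<le> e \<Longrightarrow> f x \<ge> c - \<epsilon> \<Longrightarrow> norm x \<le> norm y"
proof -
  have Sne: "Sig \<noteq> {}" using Sig(6) by blast
  obtain e where e: "e > 0" "(\<Union>x\<in>Sig. cball x e) \<subseteq> lower \<inter> near"
    by (rule compact_subset_open_imp_cball_epsilon_subset[OF Sig(2), of "lower \<inter> near"])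
      (use open_regions low Sig_near in auto)
  define K where "K = {x. infdist x Sig \<le> e}"
  have K: "x \<in> lower \<inter> near" if "x \<in> K" for x
  proof -
    obtain z where z: "z \<in> Sig" "infdist x Sig = dist x z"
      using infdist_attains_inf[OF compact_imp_closed[OF Sig(2)] Sne] by blast
    then have "x \<in> cball z e" using that by (simp add: K_def dist_commute)
    then show ?thesis using e(2) z(1) by blast
  qed
  have compK: "compact K" unfolding K_def by (rule compact_infdist_le[OF Sne Sig(2) e(1)])
  have inf0: "infdist x Sig = 0" if "x \<in> Sig" for x using that by simp
  have SK: "Sig \<subseteq> K" using inf0 e(1) by (auto simp: K_def)
  have KF: "x \<in> Sig" if "x \<in> K" "x \<in> frontier \<Omega>" for x using regions(3) K that by blast
  have KE: "f x < c" if "x \<in> K" "x \<in> E" for x using regions(2) K that by blast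
  define S where "S = (K \<inter> - \<Omega>) \<inter> {x. infdist x Sig = e}"
  have "closed {x. infdist x Sig = e}"
    by (intro closed_Collect_eq continuous_on_infdist continuous_intros)
  then have compS: "compact S" unfolding S_def
    using compK open_\<Omega> by (intro compact_Int_closed) auto
  have SE: "S \<subseteq> E"
  proof
    fix x assume x: "x \<in> S"
    have "x \<notin> frontier \<Omega>"
    proof
      assume "x \<in> frontier \<Omega>"
      then have "x \<in> Sig" using KF x by (simp add: S_def)
      then show False using inf0 x e(1) by (simp add: S_def)
    qed
    then show "x \<in> E" using x Compl_eq by (auto simp: S_def)
  qed
  obtain \<Lambda>0 where \<Lambda>0: "\<And>x. x \<in> S \<Longrightarrow> norm (grad f x) \<le> \<Lambda>0"
  proof -
    have "bounded (grad f ` S)"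
      by (rule compact_imp_bounded[OF compact_continuous_image[OF continuous_on_subset[OF continuous_grad SE] compS]])
    then obtain B where "\<forall>y\<in>grad f ` S. norm y \<le> B" unfolding bounded_iff by blast
    then show ?thesis using that by blast
  qed
  define \<Lambda> where "\<Lambda> = max \<Lambda>0 (norm a0)"
  have \<Lambda>: "\<Lambda> \<ge> norm a0" "\<And>x. x \<in> S \<Longrightarrow> norm (grad f x) \<le> \<Lambda>" using \<Lambda>0 by (auto simp: \<Lambda>_def le_max_iff_disj)
  define steep where "steep = \<Union>{G. open G \<and> (\<forall>x\<in>G \<inter> E. norm (grad f x) > \<Lambda>)}"
  have Ssteep: "Sig \<subseteq> steep"
  proof
    fix x assume x: "x \<in> Sig"
    then have xf: "x \<in> frontier \<Omega>" using Sig(3) by blast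
    have "\<forall>\<^sub>F y in at x within E. norm (grad f y) > \<Lambda>"
      using vertical[OF xf] unfolding filterlim_at_top_dense by blast
    then obtain G where G: "open G" "x \<in> G" "\<And>y. y \<in> G \<Longrightarrow> y \<in> E \<Longrightarrow> y \<noteq> x \<Longrightarrow> norm (grad f y) > \<Lambda>"
      unfolding eventually_at_topological by blast
    then have "\<forall>y\<in>G \<inter> E. norm (grad f y) > \<Lambda>" using frontier_notin_E[OF xf] by blast
    then show "x \<in> steep" using G(1,2) unfolding steep_def by blast
  qed
  define N0 where "N0 = steep \<inter> {x. infdist x Sig < e}"
  have oN0: "open N0" unfolding N0_def steep_def
    by (intro open_Int open_Collect_less continuous_on_infdist continuous_intros) blast
  have SN0: "Sig \<subseteq> N0" using Ssteep inf0 e(1) by (auto simp: N0_def)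
  define D where "D = (K \<inter> closure P) - N0"
  have compD: "compact D" unfolding D_def by (intro compact_diff compact_Int_closed compK closed_closure oN0)
  have DE: "D \<subseteq> E"
  proof
    fix x assume x: "x \<in> D"
    then have "x \<notin> frontier \<Omega>" using KF SN0 by (auto simp: D_def)
    then show "x \<in> E" using x closure_P Compl_eq by (auto simp: D_def)
  qed
  obtain \<epsilon> where \<epsilon>: "\<epsilon> > 0" "\<And>x. x \<in> D \<Longrightarrow> f x < c - \<epsilon>"
  proof (cases "D = {}")
    case True
    then show ?thesis using that[of 1] by simp
  next
    case False
    have "continuous_on D f" by (rule continuous_on_subset[OF Ck_on_continuous[OF C2] DE])
    then obtain x where x: "x \<in> D" "\<And>z. z \<in> D \<Longrightarrow> f z \<le> f x"
      using continuous_attains_sup[OF compD False] by blast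
    have fx: "f x < c" using KE[of x] x(1) DE by (auto simp: D_def)
    show ?thesis
    proof (rule that[of "(c - f x) / 2"])
      show "(c - f x) / 2 > 0" using fx by simp
      fix z assume "z \<in> D"
      have "f x < c - (c - f x) / 2" using fx by (simp add: field_simps)
      then show "f z < c - (c - f x) / 2" using x(2)[OF \<open>z \<in> D\<close>] by simp
    qed
  qed
  obtain p where p: "p \<in> C0" "\<And>x. x \<in> C0 \<Longrightarrow> norm x \<le> norm p"
    using continuous_attains_sup[OF C0(6), of norm] C0(2) by (auto intro: continuous_intros)
  obtain v where v: "v \<noteq> 0" "v \<bullet> (0 :: real^'n) = 0" "p \<bullet> v \<ge> 0" by (rule orthogonal_direction[of 0 p]) (rule that)
  have outC: "p + t *\<^sub>R v \<notin> C0" if "t > 0" for t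
    using p(2)[of "p + t *\<^sub>R v"] norm_increases[OF v(3,1) that] by auto
  have pT: "p \<in> frontier C0"
  proof -
    obtain t where t: "t \<ge> 0" "p + t *\<^sub>R v \<in> frontier C0"
      by (rule ray_exit[OF compact_imp_bounded[OF C0(6)] p(1) v(1)]) (rule that)
    then have "t = 0" using outC[of t] complement_component(5)[OF C0(1)] by (cases "t = 0") auto
    then show ?thesis using t(2) by simp
  qed
  have pS: "p \<in> Sig" using pT Sig(5) by blast
  have pc: "p \<in> closure P" using pT complement_component(3)[OF C0(1)] frontier_P_eq by blast
  define X where "X = (K \<inter> closure P) \<inter> f -` {c - \<epsilon>..}"
  have "continuous_on (K \<inter> closure P) f" by (rule continuous_on_subset[OF cont]) (use closure_P in blast)
  moreover have cKP: "compact (K \<inter> closure P)" by (intro compact_Int_closed compK closed_closure)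
  ultimately have "closed X" unfolding X_def
    by (intro continuous_closed_preimage[OF _ compact_imp_closed closed_atLeast])
  then have compX: "compact X" using cKP unfolding X_def by (metis closed_Int_compact inf.left_idem inf_commute)
  have pX: "p \<in> X" using pS pc SK Sig(7) \<epsilon>(1) by (auto simp: X_def)
  obtain y where y: "y \<in> X" "\<And>x. x \<in> X \<Longrightarrow> norm x \<le> norm y"
    using continuous_attains_sup[OF compX, of norm] pX by (auto intro: continuous_intros)
  have "\<exists>x\<in>X. norm x > norm p"
  proof -
    have "p \<in> - \<Omega>" using pc closure_P by blast
    then obtain \<delta> where \<delta>: "\<delta> > 0" "\<And>x. x \<in> - \<Omega> \<Longrightarrow> dist x p < \<delta> \<Longrightarrow> dist (f x) (f p) < \<epsilon>"
      using cont \<epsilon>(1) unfolding continuous_on_iff by metis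
    have oN: "open (ball p \<delta> \<inter> {x. infdist x Sig < e})"
      by (intro open_Int open_Collect_less continuous_on_infdist continuous_intros open_ball)
    have pN: "p \<in> ball p \<delta> \<inter> {x. infdist x Sig < e}" using \<delta>(1) inf0[OF pS] e(1) by simp
    obtain r where r: "r > 0" "\<And>t. 0 \<le> t \<Longrightarrow> t < r \<Longrightarrow> p + t *\<^sub>R v + t\<^sup>2 *\<^sub>R 0 \<in> ball p \<delta> \<inter> {x. infdist x Sig < e}"
      by (rule curve_in_open[OF oN pN]) (rule that)
    have "\<exists>t. 0 < t \<and> t \<le> r / 2 \<and> p + t *\<^sub>R v \<in> P"
    proof (rule ccontr)
      assume "\<not> ?thesis"
      then have "p + (r / 2) *\<^sub>R v \<in> C0"
        by (intro step_outside_closure[OF C0(1) p(1), of "r / 2" "\<lambda>t. p + t *\<^sub>R v"])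
          (use r(1) in \<open>auto intro!: continuous_intros\<close>)
      then show False using outC[of "r / 2"] r(1) by simp
    qed
    then obtain t where t: "0 < t" "t \<le> r / 2" "p + t *\<^sub>R v \<in> P" by blast
    let ?x = "p + t *\<^sub>R v"
    have n: "?x \<in> ball p \<delta> \<inter> {x. infdist x Sig < e}" using r(2)[of t] t r(1) by simp
    have xc: "?x \<in> closure P" using t(3) closure_subset by blast
    then have "dist (f ?x) (f p) < \<epsilon>" using \<delta>(2)[of ?x] n closure_P by (auto simp: dist_commute)
    then have "f ?x \<ge> c - \<epsilon>" using Sig(7)[OF pS] by (simp add: dist_real_def)
    then have "?x \<in> X" using xc n by (simp add: X_def K_def)
    then show ?thesis using norm_increases[OF v(3,1) t(1)] by blast
  qed
  then have yp: "norm y > norm p" using y(2) by force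
  have yK: "y \<in> K" "y \<in> closure P" "f y \<ge> c - \<epsilon>" using y(1) by (auto simp: X_def)
  have "y \<notin> Sig" using p(2)[of y] Sig(4) yp by auto
  then have yE: "y \<in> E" using KF yK(1,2) closure_P Compl_eq by blast
  have "y \<in> N0"
  proof (rule ccontr)
    assume "y \<notin> N0"
    then have "y \<in> D" using yK(1,2) by (simp add: D_def)
    then show False using \<epsilon>(2) yK(3) by force
  qed
  then have yN: "infdist y Sig < e" "norm (grad f y) > \<Lambda>" using yE unfolding N0_def steep_def by blast+
  show ?thesis
  proof (rule that[OF \<Lambda>(1) e(1) yK(2) yE yN yK(3)])
    show "norm (grad f x) \<le> \<Lambda>" if "x \<in> E" "infdist x Sig = e" for x
      by (rule \<Lambda>(2)) (use that Compl_eq in \<open>auto simp: S_def K_def\<close>)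
    show "norm x \<le> norm y" if "x \<in> closure P" "infdist x Sig \<le> e" "f x \<ge> c - \<epsilon>" for x
      by (rule y(2)) (use that in \<open>auto simp: X_def K_def\<close>)
  qed
qed

text \<open>If \<open>D\<^sup>2f(v,v) \<ge> 0\<close> for a vector \<open>v\<close> tangent to the level set, then one can leave the ball
  through \<open>y\<close> while increasing \<open>f\<close>.\<close>

lemma escaping_curve:
  assumes y: "y \<in> E" and a: "a = grad f y" "a \<noteq> 0"
    and v: "v \<noteq> 0" "v \<bullet> a = 0" "y \<bullet> v \<ge> 0" "v \<bullet> (hess f y *v v) \<ge> 0"
  obtains \<eta> r where "\<eta> > 0" "r > 0" "\<And>t. 0 < t \<Longrightarrow> t < r \<Longrightarrow> f (y + t *\<^sub>R v + t\<^sup>2 *\<^sub>R (\<eta> *\<^sub>R a)) > f y"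
    "\<And>t. 0 < t \<Longrightarrow> t < r \<Longrightarrow> norm (y + t *\<^sub>R v + t\<^sup>2 *\<^sub>R (\<eta> *\<^sub>R a)) > norm y"
proof -
  define \<eta> where "\<eta> = (v \<bullet> v) / (4 * (1 + \<bar>y \<bullet> a\<bar>))"
  have vv: "v \<bullet> v > 0" and aa: "a \<bullet> a > 0" using v(1) a(2) by auto
  have \<eta>: "\<eta> > 0" using vv by (simp add: \<eta>_def add_pos_nonneg)
  have "\<eta> * \<bar>y \<bullet> a\<bar> \<le> \<eta> * (1 + \<bar>y \<bullet> a\<bar>)" using \<eta> by (intro mult_left_mono) auto
  also have "\<dots> = (v \<bullet> v) / 4"
  proof -
    have "1 + \<bar>y \<bullet> a\<bar> \<noteq> 0" using abs_ge_zero[of "y \<bullet> a"] by linarith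
    moreover have "x / (4 * b) * b = x / 4" if "b \<noteq> 0" for x b :: real using that by simp
    ultimately show ?thesis unfolding \<eta>_def by blast
  qed
  finally have "\<eta> * \<bar>y \<bullet> a\<bar> \<le> (v \<bullet> v) / 4" .
  moreover have "- (\<eta> * \<bar>y \<bullet> a\<bar>) \<le> \<eta> * (y \<bullet> a)"
    using \<eta> mult_left_mono[of "- \<bar>y \<bullet> a\<bar>" "y \<bullet> a" \<eta>] by simp
  ultimately have pos: "v \<bullet> v + 2 * (\<eta> * (y \<bullet> a)) > 0" using vv by linarith
  obtain r0 where r0: "r0 > 0" "\<And>t. 0 \<le> t \<Longrightarrow> t < r0 \<Longrightarrow> y + t *\<^sub>R v + t\<^sup>2 *\<^sub>R (\<eta> *\<^sub>R a) \<in> E"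
    by (rule curve_in_open[OF open_E y]) (rule that)
  obtain s where s: "s > 0" "\<And>t. 0 < t \<Longrightarrow> t < s \<Longrightarrow> f (y + 0 *\<^sub>R v + 0\<^sup>2 *\<^sub>R (\<eta> *\<^sub>R a)) < f (y + t *\<^sub>R v + t\<^sup>2 *\<^sub>R (\<eta> *\<^sub>R a))"
  proof (rule second_deriv_pos_increase[of r0 "\<lambda>t. f (y + t *\<^sub>R v + t\<^sup>2 *\<^sub>R (\<eta> *\<^sub>R a))"
        "\<lambda>t. grad f (y + t *\<^sub>R v + t\<^sup>2 *\<^sub>R (\<eta> *\<^sub>R a)) \<bullet> (v + (2 * t) *\<^sub>R (\<eta> *\<^sub>R a))"
        "v \<bullet> (hess f y *v v) + 2 * (grad f y \<bullet> (\<eta> *\<^sub>R a))"])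
    show "r0 > 0" by (rule r0(1))
    show "((\<lambda>t. f (y + t *\<^sub>R v + t\<^sup>2 *\<^sub>R (\<eta> *\<^sub>R a))) has_real_derivative
        grad f (y + t *\<^sub>R v + t\<^sup>2 *\<^sub>R (\<eta> *\<^sub>R a)) \<bullet> (v + (2 * t) *\<^sub>R (\<eta> *\<^sub>R a))) (at t)" if "0 \<le> t" "t < r0" for t
      by (rule C2_along_curve(1)[OF C2 r0(2)[OF that]])
    show "((\<lambda>t. grad f (y + t *\<^sub>R v + t\<^sup>2 *\<^sub>R (\<eta> *\<^sub>R a)) \<bullet> (v + (2 * t) *\<^sub>R (\<eta> *\<^sub>R a))) has_real_derivative
        v \<bullet> (hess f y *v v) + 2 * (grad f y \<bullet> (\<eta> *\<^sub>R a))) (at 0)"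
      by (rule C2_along_curve(2)[OF C2 y])
    show "0 < v \<bullet> (hess f y *v v) + 2 * (grad f y \<bullet> (\<eta> *\<^sub>R a))"
      using v(4) \<eta> aa a(1) by (simp add: add_nonneg_pos)
    show "0 \<le> grad f (y + 0 *\<^sub>R v + 0\<^sup>2 *\<^sub>R (\<eta> *\<^sub>R a)) \<bullet> (v + (2 * 0) *\<^sub>R (\<eta> *\<^sub>R a))"
      using v(2) a(1) by (simp add: inner_commute)
  qed (rule that)
  show ?thesis
  proof (rule that[OF \<eta> s(1)])
    fix t assume t: "0 < t" "t < s"
    show "f (y + t *\<^sub>R v + t\<^sup>2 *\<^sub>R (\<eta> *\<^sub>R a)) > f y" using s(2)[OF t] by simp
    show "norm (y + t *\<^sub>R v + t\<^sup>2 *\<^sub>R (\<eta> *\<^sub>R a)) > norm y"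
    proof (rule power2_less_imp_less)
      have va: "v \<bullet> a = 0" "a \<bullet> v = 0" using v(2) by (auto simp: inner_commute)
      have "(norm (y + t *\<^sub>R v + t\<^sup>2 *\<^sub>R (\<eta> *\<^sub>R a)))\<^sup>2 = (norm y)\<^sup>2 + 2 * (t * (y \<bullet> v))
          + t\<^sup>2 * (v \<bullet> v + 2 * (\<eta> * (y \<bullet> a))) + (t\<^sup>2 * \<eta>)\<^sup>2 * (a \<bullet> a)"
        unfolding power2_norm_eq_inner
        by (simp add: inner_add_left inner_add_right va inner_commute[of v y] inner_commute[of a y]
            power2_eq_square algebra_simps)
      moreover have "t * (y \<bullet> v) \<ge> 0" using v(3) t by simp
      moreover have "t\<^sup>2 * (v \<bullet> v + 2 * (\<eta> * (y \<bullet> a))) > 0" using pos t by simp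
      moreover have "(t\<^sup>2 * \<eta>)\<^sup>2 * (a \<bullet> a) \<ge> 0" by simp
      ultimately show "(norm y)\<^sup>2 < (norm (y + t *\<^sub>R v + t\<^sup>2 *\<^sub>R (\<eta> *\<^sub>R a)))\<^sup>2" by linarith
    qed simp
  qed
qed

theorem contradiction: False
proof -
  have low: "Sig \<subseteq> lower" using Sig_cases not_upper by blast
  obtain y e \<epsilon> \<Lambda> where \<Lambda>: "\<Lambda> \<ge> norm a0" and "e > 0" and y: "y \<in> closure P" "y \<in> E" "infdist y Sig < e"
    "norm (grad f y) > \<Lambda>" "f y \<ge> c - \<epsilon>"
    and steep: "\<And>x. x \<in> E \<Longrightarrow> infdist x Sig = e \<Longrightarrow> norm (grad f x) \<le> \<Lambda>"
    and far: "\<And>x. x \<in> closure P \<Longrightarrow> infdist x Sig \<le> e \<Longrightarrow> f x \<ge> c - \<epsilon> \<Longrightarrow> norm x \<le> norm y"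
    by (rule farthest_point[OF low]) (rule that)
  define a where "a = grad f y"
  have na: "norm a > norm a0" using y(4) \<Lambda> unfolding a_def by linarith
  then have "a \<noteq> 0" using norm_ge_zero[of a0] by auto
  note a = this na
  have oI: "open {x. infdist x Sig < e}"
    by (intro open_Collect_less continuous_on_infdist continuous_intros)
  have yI: "y \<in> {x. infdist x Sig < e}" using y(3) by simp
  show False
  proof (cases "y \<in> P")
    case True
    have neg: "v \<bullet> (hess f y *v v) < 0" if v: "v \<bullet> a = 0" "v \<noteq> 0" "y \<bullet> v \<ge> 0" for v
    proof (rule ccontr)
      assume "\<not> ?thesis"
      then have "v \<bullet> (hess f y *v v) \<ge> 0" by simp
      obtain \<eta> r where "\<eta> > 0" and \<eta>: "r > 0" "\<And>t. 0 < t \<Longrightarrow> t < r \<Longrightarrow> f (y + t *\<^sub>R v + t\<^sup>2 *\<^sub>R (\<eta> *\<^sub>R a)) > f y"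
        "\<And>t. 0 < t \<Longrightarrow> t < r \<Longrightarrow> norm (y + t *\<^sub>R v + t\<^sup>2 *\<^sub>R (\<eta> *\<^sub>R a)) > norm y"
        by (rule escaping_curve[OF y(2) a_def a(1) v(2,1,3) \<open>v \<bullet> (hess f y *v v) \<ge> 0\<close>]) (rule that)
      have o: "open (P \<inter> {x. infdist x Sig < e})" "y \<in> P \<inter> {x. infdist x Sig < e}"
        using P_basics(1) oI True yI by auto
      obtain r' where r': "r' > 0" "\<And>t. 0 \<le> t \<Longrightarrow> t < r' \<Longrightarrow> y + t *\<^sub>R v + t\<^sup>2 *\<^sub>R (\<eta> *\<^sub>R a) \<in> P \<inter> {x. infdist x Sig < e}"
        by (rule curve_in_open[OF o]) (rule that)
      define t where "t = min r r' / 2"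
      have t: "0 < t" "t < r" "t < r'" using \<eta>(1) r'(1) by (auto simp: t_def)
      let ?x = "y + t *\<^sub>R v + t\<^sup>2 *\<^sub>R (\<eta> *\<^sub>R a)"
      have x: "?x \<in> P \<inter> {x. infdist x Sig < e}" by (rule r'(2)) (use t in auto)
      have "norm ?x \<le> norm y"
        by (rule far) (use x closure_subset \<eta>(2)[OF t(1,2)] y(5) in auto)
      then show False using \<eta>(3)[OF t(1,2)] by simp
    qed
    have "v \<bullet> (hess f y *v v) < 0" if "v \<bullet> a = 0" "v \<noteq> 0" for v
    proof (cases "y \<bullet> v \<ge> 0")
      case True
      then show ?thesis by (rule neg[OF that])
    next
      case False
      have "(- v) \<bullet> (hess f y *v (- v)) < 0" by (rule neg) (use that False in auto)
      moreover have "hess f y *v (- v) = - (hess f y *v v)"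
        using matrix_vector_mult_scaleR[of "hess f y" "-1" v] by simp
      ultimately show ?thesis by simp
    qed
    then have "(norm a)\<^sup>2 * trace (hess f y) < a \<bullet> (hess f y *v a)"
      using card by (intro trace_lt_zero_on_complement[OF a(1)]) auto
    then show False using hess_pos[OF y(2) P_basics(5)[OF True]] by (simp add: a_def)
  next
    case False
    let ?C = "hole y"
    note C = hole(1)[OF False]
    have yT: "y \<in> frontier ?C" by (rule in_frontier_component[OF hole[OF False] y(1)])
    define b where "b = snd (hole_coeffs ?C)"
    have coeffs: "x \<in> Z" "grad f x = a" "f x = a \<bullet> x + b" if "x \<in> frontier ?C" for x
      using hole_coeffs[OF y(2) False that] hole_coeffs(2)[OF y(2) False yT] by (auto simp: a_def b_def)
    have h0: "hess f y = 0" using hess_zero coeffs(1)[OF yT] by blast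
    have bC: "bounded ?C"
    proof (rule ccontr)
      assume "\<not> bounded ?C"
      then have "grad f y = a0" using unbounded[OF C _ yT] by blast
      then show False using a(2) by (simp add: a_def)
    qed
    obtain v where v: "v \<noteq> 0" "v \<bullet> a = 0" "y \<bullet> v \<ge> 0" by (rule orthogonal_direction[of a y]) (rule that)
    obtain \<eta> r where \<eta>: "\<eta> > 0" "r > 0" "\<And>t. 0 < t \<Longrightarrow> t < r \<Longrightarrow> f (y + t *\<^sub>R v + t\<^sup>2 *\<^sub>R (\<eta> *\<^sub>R a)) > f y"
      "\<And>t. 0 < t \<Longrightarrow> t < r \<Longrightarrow> norm (y + t *\<^sub>R v + t\<^sup>2 *\<^sub>R (\<eta> *\<^sub>R a)) > norm y"
      by (rule escaping_curve[OF y(2) a_def a(1) v]) (use h0 in simp, rule that)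
    obtain r' where r': "r' > 0" "\<And>t. 0 \<le> t \<Longrightarrow> t < r' \<Longrightarrow> y + t *\<^sub>R v + t\<^sup>2 *\<^sub>R (\<eta> *\<^sub>R a) \<in> {x. infdist x Sig < e}"
      by (rule curve_in_open[OF oI yI]) (rule that)
    define s where "s = min r r' / 2"
    have s: "0 < s" "s < r" "s < r'" using \<eta>(2) r'(1) by (auto simp: s_def)
    define \<gamma> where "\<gamma> t = y + t *\<^sub>R v + t\<^sup>2 *\<^sub>R (\<eta> *\<^sub>R a)" for t
    have out: "\<gamma> t \<notin> P" if "0 < t" "t \<le> s" for t
    proof
      assume P: "\<gamma> t \<in> P"
      have "norm (\<gamma> t) \<le> norm y"
      proof (rule far)
        show "\<gamma> t \<in> closure P" using P closure_subset by blast
        show "infdist (\<gamma> t) Sig \<le> e" using r'(2)[of t] that s by (simp add: \<gamma>_def)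
        show "f (\<gamma> t) \<ge> c - \<epsilon>" using \<eta>(3)[of t] that s y(5) by (simp add: \<gamma>_def)
      qed
      then show False using \<eta>(4)[of t] that s by (simp add: \<gamma>_def)
    qed
    define y' where "y' = \<gamma> s"
    have y'C: "y' \<in> ?C" unfolding y'_def
      by (rule step_outside_closure[OF C hole(2)[OF False]])
        (use s out in \<open>auto simp: \<gamma>_def intro!: continuous_intros\<close>)
    have ny': "norm y' > norm y" using \<eta>(4)[of s] s by (simp add: y'_def \<gamma>_def)
    have ay': "a \<bullet> y' > a \<bullet> y"
    proof -
      have "a \<bullet> y' = a \<bullet> y + s\<^sup>2 * (\<eta> * (a \<bullet> a))" using v(2) by (simp add: y'_def \<gamma>_def inner_add_right inner_commute)
      moreover have "s\<^sup>2 * (\<eta> * (a \<bullet> a)) > 0" using s(1) \<eta>(1) a(1) by simp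
      ultimately show ?thesis by simp
    qed
    obtain v' where v': "v' \<noteq> 0" "v' \<bullet> a = 0" "y' \<bullet> v' \<ge> 0" by (rule orthogonal_direction[of a y']) (rule that)
    obtain t where t: "t \<ge> 0" "y' + t *\<^sub>R v' \<in> frontier ?C"
      by (rule ray_exit[OF bC y'C v'(1)]) (rule that)
    define q where "q = y' + t *\<^sub>R v'"
    have qT: "q \<in> frontier ?C" using t(2) by (simp add: q_def)
    have nq: "norm q \<ge> norm y'"
      using norm_increases[OF v'(3,1), of t] t(1) by (cases "t = 0") (auto simp: q_def)
    have "a \<bullet> q = a \<bullet> y'" using v'(2) by (simp add: q_def inner_add_right inner_commute)
    then have fq: "f q > f y" using coeffs(3)[OF qT] coeffs(3)[OF yT] ay' by simp
    have "infdist q Sig \<le> e"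
    proof (rule ccontr)
      assume gt: "\<not> infdist q Sig \<le> e"
      have "connected ((\<lambda>x. infdist x Sig) ` frontier ?C)"
        by (intro connected_continuous_image continuous_on_infdist continuous_intros complement_component(2)[OF C])
      then have "{infdist y Sig..infdist q Sig} \<subseteq> (\<lambda>x. infdist x Sig) ` frontier ?C"
        by (rule connected_contains_Icc) (use yT qT in auto)
      moreover have "e \<in> {infdist y Sig..infdist q Sig}" using y(3) gt by simp
      ultimately have "e \<in> (\<lambda>x. infdist x Sig) ` frontier ?C" by blast
      then obtain x where x: "x \<in> frontier ?C" "infdist x Sig = e" by auto
      have "norm (grad f x) \<le> \<Lambda>" by (rule steep[OF _ x(2)]) (use coeffs(1)[OF x(1)] in simp)
      then show False using coeffs(2)[OF x(1)] y(4) by (simp add: a_def)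
    qed
    moreover have "q \<in> closure P" using frontier_hole[OF False] qT by blast
    ultimately have "norm q \<le> norm y" using far fq y(5) by simp
    then show False using nq ny' by simp
  qed
qed

end

lemma (in positive_component) unbounded_P: "\<not> bounded P"
proof
  assume bP: "bounded P"
  have dim: "2 \<le> DIM(real^'n)" using card by simp
  have b': "bounded (- (- P))" using bP by simp
  obtain C1 where C1: "C1 \<in> components (- P)" "\<not> bounded C1" using cobounded_unbounded_components[OF b'] by blast
  have "C1 \<inter> E \<noteq> {}"
  proof
    assume "C1 \<inter> E = {}"
    then have "C1 \<subseteq> closure \<Omega>" by blast
    then show False using C1(2) bounded_subset[OF bounded_closure[OF bounded_\<Omega>]] by blast
  qed
  then obtain x where x: "x \<in> C1" "x \<in> E" by blast
  obtain a b where ab: "\<And>x. x \<in> frontier C1 \<Longrightarrow> x \<in> Z \<and> grad f x = a \<and> f x = a \<bullet> x + b"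
    by (rule hole_affine_E[OF C1(1) x]) (rule that)
  have "compact (closure P)" using bP by simp
  moreover have "closure P \<noteq> {}" using P_basics(4) by simp
  moreover have "continuous_on (closure P) (\<lambda>x. f x - a \<bullet> x)"
    by (intro continuous_intros continuous_on_subset[OF cont closure_P])
  ultimately obtain xm where xm: "xm \<in> closure P" "\<And>x. x \<in> closure P \<Longrightarrow> f x - a \<bullet> x \<le> f xm - a \<bullet> xm"
    using continuous_attains_sup[of "closure P" "\<lambda>x. f x - a \<bullet> x"] by blast
  have "tilted_maximum \<Omega> f P a b (f xm - a \<bullet> xm) xm"
  proof unfold_locales
    fix C x assume C: "C \<in> components (- P)" "\<not> bounded C" "x \<in> frontier C"
    have "C1 = C" by (rule cobounded_unique_unbounded_components[OF b' C(1,2) C1 dim])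
    then show "x \<in> E \<and> grad f x = a \<and> f x = a \<bullet> x + b" using ab C(3) by blast
  qed (use xm in auto)
  then show False by (rule tilted_maximum.contradiction)
qed

lemma unbounded_set_meets:
  fixes T :: "'a::real_normed_vector set"
  assumes "\<not> bounded T" "eventually Q at_infinity"
  obtains x where "x \<in> T" "Q x"
proof -
  obtain B where B: "\<And>x. B \<le> norm x \<Longrightarrow> Q x" using assms(2) unfolding eventually_at_infinity by blast
  obtain x where "x \<in> T" "\<not> norm x \<le> B" using assms(1) unfolding bounded_iff by blast
  then show ?thesis using that B by (meson linear)
qed

lemma (in positive_component) bounded_holes:
  assumes C1: "C1 \<in> components (- P)" "C1 \<inter> E \<noteq> {}"
  shows "bounded C1"
proof (rule ccontr)
  assume C1b: "\<not> bounded C1"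
  have dim: "2 \<le> DIM(real^'n)" using card by simp
  have frb: "\<not> bounded (frontier C)" if C: "C \<in> components (- P)" "\<not> bounded C" for C
  proof
    assume "bounded (frontier C)"
    then obtain B where "\<And>x. x \<in> frontier C \<Longrightarrow> norm x \<le> B" unfolding bounded_iff by blast
    then have B: "frontier C \<subseteq> cball 0 B" by auto
    have "connected (- cball (0 :: real^'n) B)"
      by (rule connected_complement_bounded_convex[OF bounded_cball convex_cball dim])
    moreover have "- cball 0 B \<inter> C \<noteq> {}"
      using C(2) bounded_subset[OF bounded_cball, of C 0 B] by blast
    moreover have "- cball 0 B - C \<noteq> {}"
    proof -
      have "\<not> P \<subseteq> cball 0 B" using unbounded_P bounded_subset[OF bounded_cball] by blast
      then show ?thesis using complement_component(6)[OF C(1)] by blast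
    qed
    ultimately have "- cball 0 B \<inter> frontier C \<noteq> {}" by (rule connected_Int_frontier)
    then show False using B by blast
  qed
  have flat: "\<exists>b. \<forall>x\<in>frontier C. x \<in> E \<and> grad f x = 0 \<and> f x = b" if C: "C \<in> components (- P)" "\<not> bounded C" for C
  proof -
    have "\<not> frontier C \<subseteq> frontier \<Omega>"
      using frb[OF C] bounded_subset[OF compact_imp_bounded[OF compact_frontier_bounded[OF bounded_\<Omega>]]] by blast
    obtain a b where ab: "\<And>x. x \<in> frontier C \<Longrightarrow> x \<in> Z \<and> grad f x = a \<and> f x = a \<bullet> x + b"
      by (rule hole_affine[OF C(1) \<open>\<not> frontier C \<subseteq> frontier \<Omega>\<close>]) (rule that)
    have "a = 0"
    proof (rule ccontr)
      assume "a \<noteq> 0"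
      then have "eventually (\<lambda>x. dist (grad f x) 0 < norm a) at_infinity"
        using grad_limit by (intro tendstoD) auto
      then obtain x where "x \<in> frontier C" "dist (grad f x) 0 < norm a"
        by (rule unbounded_set_meets[OF frb[OF C]]) (rule that)
      then show False using ab by simp
    qed
    then show ?thesis using ab by (intro exI[of _ b]) auto
  qed
  obtain b1 where b1: "\<And>x. x \<in> frontier C1 \<Longrightarrow> f x = b1" using flat[OF C1(1) C1b] by blast
  have "\<exists>L. (f \<longlongrightarrow> L) at_infinity"
  proof -
    have "\<not> filterlim f at_top at_infinity"
    proof
      assume "filterlim f at_top at_infinity"
      then have "eventually (\<lambda>x. f x > b1) at_infinity" unfolding filterlim_at_top_dense by blast
      then obtain x where "x \<in> frontier C1" "f x > b1"
        by (rule unbounded_set_meets[OF frb[OF C1(1) C1b]]) (rule that)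
      then show False using b1 by simp
    qed
    moreover have "\<not> filterlim f at_bot at_infinity"
    proof
      assume "filterlim f at_bot at_infinity"
      then have "eventually (\<lambda>x. f x < b1) at_infinity" unfolding filterlim_at_bot_dense by blast
      then obtain x where "x \<in> frontier C1" "f x < b1"
        by (rule unbounded_set_meets[OF frb[OF C1(1) C1b]]) (rule that)
      then show False using b1 by simp
    qed
    ultimately show ?thesis using limit by blast
  qed
  then obtain L where L: "(f \<longlongrightarrow> L) at_infinity" by blast
  have hole: "x \<in> E \<and> grad f x = 0 \<and> f x = L"
    if C: "C \<in> components (- P)" "\<not> bounded C" "x \<in> frontier C" for C x
  proof -
    obtain b where b: "\<And>x. x \<in> frontier C \<Longrightarrow> x \<in> E \<and> grad f x = 0 \<and> f x = b" using flat[OF C(1,2)] by blast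
    have "b = L"
    proof (rule ccontr)
      assume "b \<noteq> L"
      then have "eventually (\<lambda>x. dist (f x) L < dist b L) at_infinity" using L by (intro tendstoD) auto
      then obtain x where "x \<in> frontier C" "dist (f x) L < dist b L"
        by (rule unbounded_set_meets[OF frb[OF C(1,2)]]) (rule that)
      then show False using b by auto
    qed
    then show ?thesis using b[OF C(3)] by simp
  qed
  obtain x1 where x1: "x1 \<in> frontier C1" using complement_component(4)[OF C1(1)] by blast
  have x1c: "x1 \<in> closure P" using complement_component(3)[OF C1(1)] x1 frontier_P_eq by blast
  have fx1: "f x1 = L" using hole[OF C1(1) C1b x1] by blast
  obtain xm where xm: "xm \<in> closure P" "\<And>x. x \<in> closure P \<Longrightarrow> f x \<le> f xm"
  proof (cases "\<exists>x'\<in>closure P. f x' > L")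
    case False
    show ?thesis
      by (rule that[OF x1c]) (use False fx1 in force)
  next
    case True
    then obtain x' where x': "x' \<in> closure P" "f x' > L" by blast
    define X where "X = closure P \<inter> f -` {f x'..}"
    have "closed X" unfolding X_def
      by (rule continuous_closed_preimage[OF continuous_on_subset[OF cont closure_P] closed_closure closed_atLeast])
    moreover have "bounded X"
    proof (rule ccontr)
      assume nb: "\<not> bounded X"
      have "eventually (\<lambda>x. f x < f x') at_infinity" by (rule order_tendstoD(2)[OF L x'(2)])
      then obtain x where "x \<in> X" "f x < f x'" by (rule unbounded_set_meets[OF nb]) (rule that)
      then show False by (simp add: X_def)
    qed
    ultimately have cX: "compact X" by (simp add: compact_eq_bounded_closed)
    have x'X: "x' \<in> X" using x'(1) by (simp add: X_def)
    have "continuous_on X f" by (rule continuous_on_subset[OF cont]) (use closure_P in \<open>auto simp: X_def\<close>)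
    then obtain xm where xm: "xm \<in> X" "\<And>x. x \<in> X \<Longrightarrow> f x \<le> f xm"
      using continuous_attains_sup[OF cX] x'X by blast
    show ?thesis
    proof (rule that[of xm])
      show "xm \<in> closure P" using xm(1) by (simp add: X_def)
      fix x assume x: "x \<in> closure P"
      show "f x \<le> f xm"
      proof (cases "x \<in> X")
        case False
        then have "f x < f x'" using x by (simp add: X_def)
        then show ?thesis using xm(2)[OF x'X] by simp
      qed (rule xm(2))
    qed
  qed
  have "tilted_maximum \<Omega> f P 0 L (f xm - 0 \<bullet> xm) xm"
    by unfold_locales (use hole xm in auto)
  then show False by (rule tilted_maximum.contradiction)
qed

context signed_graph
begin

lemma minus_signed_graph: "signed_graph \<Omega> (\<lambda>x. - f x)"
proof unfold_locales
  note g = grad_hess_minus[OF C2 open_E]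
  note Hm = graph_mean_curvature_minus[OF C2 open_E]
  have hm: "(- h) *v (- v) = h *v v" for h :: "real^'n^'n" and v
    by (simp add: matrix_vector_mult_def sum_negf vec_eq_iff)
  have tr: "trace (- h) = - trace h" for h :: "real^'n^'n" by (simp add: trace_def sum_negf)
  have Einf: "eventually (\<lambda>x. x \<in> E) at_infinity"
  proof -
    obtain B where B: "\<And>x. x \<in> closure \<Omega> \<Longrightarrow> norm x \<le> B"
      using bounded_closure[OF bounded_\<Omega>] unfolding bounded_iff by blast
    have "x \<in> E" if "norm x \<ge> B + 1" for x using B[of x] that by auto
    then show ?thesis unfolding eventually_at_infinity by blast
  qed
  show "CARD('n) \<ge> 3" "open \<Omega>" "bounded \<Omega>" "connected E" by (rule card open_\<Omega> bounded_\<Omega> connected_E)+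
  show "Ck_on (CARD('n) + 1) E (\<lambda>x. - f x)" by (rule Ck_on_minus[OF open_E Ck])
  show "continuous_on (- \<Omega>) (\<lambda>x. - f x)" by (intro continuous_intros cont)
  show "(\<lambda>x. - f x) constant_on C" if "C \<in> components (frontier \<Omega>)" for C
    using const[OF that] unfolding constant_on_def by auto
  show "filterlim (\<lambda>x. norm (grad (\<lambda>x. - f x) x)) at_top (at p within E)" if "p \<in> frontier \<Omega>" for p
  proof -
    have "\<forall>\<^sub>F x in at p within E. norm (grad f x) = norm (grad (\<lambda>x. - f x) x)"
      unfolding eventually_at_filter using g(1) by (simp add: always_eventually)
    then show ?thesis using vertical[OF that] by (simp add: filterlim_cong)
  qed
  show "G \<inter> E \<noteq> {}" if "p \<in> frontier \<Omega>" "open G" "p \<in> G" for p G by (rule approachable[OF that])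
  show "\<exists>G. open G \<and> p \<in> G \<and> G \<inter> frontier \<Omega> \<subseteq> connected_component_set (frontier \<Omega>) p \<and>
        ((\<forall>x\<in>G \<inter> E. - f x > - f p) \<or> (\<forall>x\<in>G \<inter> E. - f x < - f p))" if "p \<in> frontier \<Omega>" for p
    using boundary_sign[OF that] by (simp only: neg_less_iff_less) blast
  show "hess (\<lambda>x. - f x) x = 0" if "x \<in> E" "graph_mean_curvature (\<lambda>x. - f x) x = 0" for x
    using hess_zero that by (simp add: g Hm)
  show "grad (\<lambda>x. - f x) x \<bullet> (hess (\<lambda>x. - f x) x *v grad (\<lambda>x. - f x) x)
      \<le> (norm (grad (\<lambda>x. - f x) x))\<^sup>2 * trace (hess (\<lambda>x. - f x) x)"
    if x: "x \<in> E" "graph_mean_curvature (\<lambda>x. - f x) x > 0" for x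
    using hess_neg[OF x(1)] x(2) unfolding g[OF x(1)] Hm[OF x(1)] by (simp add: hm tr)
  show "(norm (grad (\<lambda>x. - f x) x))\<^sup>2 * trace (hess (\<lambda>x. - f x) x)
      \<le> grad (\<lambda>x. - f x) x \<bullet> (hess (\<lambda>x. - f x) x *v grad (\<lambda>x. - f x) x)"
    if x: "x \<in> E" "graph_mean_curvature (\<lambda>x. - f x) x < 0" for x
    using hess_pos[OF x(1)] x(2) unfolding g[OF x(1)] Hm[OF x(1)] by (simp add: hm tr)
  show "(\<exists>C. ((\<lambda>x. - f x) \<longlongrightarrow> C) at_infinity) \<or> filterlim (\<lambda>x. - f x) at_top at_infinity \<or>
      filterlim (\<lambda>x. - f x) at_bot at_infinity"
    using limit tendsto_minus[of f _ at_infinity]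
    unfolding filterlim_uminus_at_top[of f] filterlim_uminus_at_bot[of f] by blast
  show "(grad (\<lambda>x. - f x) \<longlongrightarrow> 0) at_infinity"
  proof (rule Lim_transform_eventually)
    show "((\<lambda>x. - grad f x) \<longlongrightarrow> 0) at_infinity" using tendsto_minus[OF grad_limit] by simp
    show "\<forall>\<^sub>F x in at_infinity. - grad f x = grad (\<lambda>x. - f x) x"
      using Einf by (rule eventually_mono) (simp add: g)
  qed
qed

theorem mean_curvature_one_sign: "(\<forall>x\<in>E. H x \<ge> 0) \<or> (\<forall>x\<in>E. H x \<le> 0)"
proof (rule ccontr)
  assume "\<not> ?thesis"
  then obtain x y where x: "x \<in> E" "H x > 0" and y: "y \<in> E" "H y < 0" by (auto simp: not_le)
  define P where "P = connected_component_set {x \<in> E. H x > 0} x"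
  have P: "P \<in> components {x \<in> E. H x > 0}" unfolding P_def by (rule componentsI) (use x in simp)
  interpret p: positive_component \<Omega> f P by unfold_locales (rule P)
  define N where "N = connected_component_set {x \<in> E. graph_mean_curvature (\<lambda>x. - f x) x > 0} y"
  have Hm: "graph_mean_curvature (\<lambda>x. - f x) z = - H z" if "z \<in> E" for z
    by (rule graph_mean_curvature_minus[OF C2 open_E that])
  have N: "N \<in> components {x \<in> E. graph_mean_curvature (\<lambda>x. - f x) x > 0}"
    unfolding N_def by (rule componentsI) (use y Hm in simp)
  interpret n: signed_graph \<Omega> "\<lambda>x. - f x" by (rule minus_signed_graph)
  interpret n: positive_component \<Omega> "\<lambda>x. - f x" N by unfold_locales (rule N)
  have "N \<subseteq> - P"
  proof
    fix z assume z: "z \<in> N"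
    then have "H z < 0" using n.P_basics(3,5) Hm by force
    then show "z \<in> - P" using p.P_basics(5) by force
  qed
  moreover have "- P \<noteq> {}" using \<open>N \<subseteq> - P\<close> n.P_basics(4) by blast
  ultimately obtain C where C: "C \<in> components (- P)" "N \<subseteq> C"
    using exists_component_superset[OF _ _ n.P_basics(2)] by blast
  have "C \<inter> E \<noteq> {}" using C(2) n.P_basics(3,4) by blast
  from p.bounded_holes[OF C(1) this] have "bounded N" using C(2) bounded_subset by blast
  then show False using n.unbounded_P by blast
qed

end

theorem theorem3:
  fixes \<Omega> :: "(real^'n) set" and f :: "real^'n \<Rightarrow> real"
  assumes "CARD('n) \<ge> 3"
    and "open \<Omega>" and "bounded \<Omega>"
    and "Ck_on (CARD('n) + 1) (- closure \<Omega>) f" and "continuous_on (- \<Omega>) f"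
    and "asymptotically_flat \<Omega> f"
    and "Ck_hypersurface_with_boundary (CARD('n) + 1)
           (graph_over (- \<Omega>) f) (graph_over (frontier \<Omega>) f)"
    and "connected (graph_over (- \<Omega>) f)"
    and "\<And>C. C \<in> components (frontier \<Omega>) \<Longrightarrow> f constant_on C"
    and "\<And>p. p \<in> frontier \<Omega> \<Longrightarrow>
           filterlim (\<lambda>x. norm (grad f x)) at_top (at p within - closure \<Omega>)"
    and "\<And>x. x \<in> - closure \<Omega> \<Longrightarrow> graph_scalar_curvature f x \<ge> 0"
  shows "(\<forall>x\<in>- \<Omega>. mean_curvature_upto_boundary \<Omega> f x \<ge> 0) \<or>
         (\<forall>x\<in>- \<Omega>. mean_curvature_upto_boundary \<Omega> f x \<le> 0)"
proof -
  note n3 = assms(1) and op = assms(2) and bd = assms(3) and Ck = assms(4) and co = assms(5)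
    and af = assms(6) and conn = assms(8) and lev = assms(9) and vert = assms(10) and R = assms(11)
  let ?E = "- closure \<Omega>"
  have C2: "Ck_on 2 ?E f" and C3: "Ck_on 3 ?E f" using n3 by (auto intro: Ck_on_le[OF Ck])
  have oE: "open ?E" by auto
  interpret v: vertical_graph \<Omega> f
    by unfold_locales (use op co C2 lev vert af in \<open>auto simp: asymptotically_flat_def\<close>)
  have lim: "(\<exists>C. (f \<longlongrightarrow> C) at_infinity) \<or> filterlim f at_top at_infinity \<or> filterlim f at_bot at_infinity"
    using af unfolding asymptotically_flat_def by blast
  obtain q where q: "q > (real CARD('n) - 2) / 2"
    and big: "(\<lambda>x. norm (grad f x)) \<in> O[at_infinity](\<lambda>x. norm x powr (- q / 2))"
    using af unfolding asymptotically_flat_def by blast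
  have gl: "(grad f \<longlongrightarrow> 0) at_infinity"
  proof -
    have "real CARD('n) \<ge> 3" using n3 by simp
    with q have "q > 0" by simp
    then have "((\<lambda>x::real^'n. norm x powr (- q / 2)) \<longlongrightarrow> 0) at_infinity"
      by (intro tendsto_neg_powr filterlim_norm_at_top) auto
    obtain c where "c > 0" and c: "\<forall>\<^sub>F x in at_infinity. norm (norm (grad f x)) \<le> c * norm (norm x powr (- q / 2))"
      by (rule landau_o.bigE[OF big]) (rule that)
    show ?thesis
    proof (rule Lim_null_comparison)
      show "\<forall>\<^sub>F x in at_infinity. norm (grad f x) \<le> c * norm x powr (- q / 2)"
        using c by (rule eventually_mono) simp
      show "((\<lambda>x::real^'n. c * norm x powr (- q / 2)) \<longlongrightarrow> 0) at_infinity"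
        using tendsto_mult_left[OF \<open>((\<lambda>x::real^'n. norm x powr (- q / 2)) \<longlongrightarrow> 0) at_infinity\<close>, of c] by simp
    qed
  qed
  note minus = graph_mean_curvature_minus[OF C2 oE] grad_hess_minus[OF C2 oE]
  have hess_neg: "(norm (grad f x))\<^sup>2 * trace (hess f x) \<le> grad f x \<bullet> (hess f x *v grad f x)"
    if x: "x \<in> ?E" and neg: "graph_mean_curvature f x < 0" for x
  proof -
    have C3': "Ck_on 3 ?E (\<lambda>y. - f y)" by (rule Ck_on_minus[OF oE C3])
    have m: "graph_mean_curvature (\<lambda>y. - f y) x > 0" using neg minus(1)[OF x] by simp
    have R': "graph_scalar_curvature (\<lambda>y. - f y) x \<ge> 0"
    proof -
      have p: "pd i (\<lambda>y. - f y) x = - pd i f x" for i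
        using arg_cong[OF minus(2)[OF x], of "\<lambda>u. u $ i"] by (simp add: grad_def)
      have pp: "pd j (pd i (\<lambda>y. - f y)) x = - pd j (pd i f) x" for i j
        using arg_cong[OF minus(3)[OF x], of "\<lambda>u. u $ i $ j"] by (simp add: hess_def)
      have "graph_scalar_curvature (\<lambda>y. - f y) x = graph_scalar_curvature f x"
        unfolding graph_scalar_curvature_eq[OF C3 oE x] graph_scalar_curvature_eq[OF C3' oE x] graph_W_def p pp
        by (simp add: sum_negf)
      then show ?thesis using R[OF x] by simp
    qed
    have hm: "(- h) *v (- u) = h *v u" for h :: "real^'n^'n" and u
      by (simp add: matrix_vector_mult_def sum_negf vec_eq_iff)
    have tr: "trace (- h) = - trace h" for h :: "real^'n^'n" by (simp add: trace_def sum_negf)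
    show ?thesis
      using nonneg_scalar_curvature_hess(2)[OF C3' oE x R' m] unfolding minus(2,3)[OF x] by (simp add: hm tr)
  qed
  interpret s: signed_graph \<Omega> f
    by (unfold_locales; (fact n3 op bd Ck co lev vert lim gl v.connected_E[OF conn] hess_neg)?)
      (use v.frontier_approachable v.boundary_sign nonneg_scalar_curvature_hess[OF C3 oE _ R] in blast)+
  have bdry: "\<exists>l. (graph_mean_curvature f \<longlongrightarrow> l) (at p within ?E) \<and> mean_curvature_upto_boundary \<Omega> f p = l"
    if p: "p \<in> frontier \<Omega>" for p
  proof -
    obtain l where l: "(graph_mean_curvature f \<longlongrightarrow> l) (at p within ?E)" using v.mean_curvature_limit[OF p] by blast
    then have "Lim (at p within ?E) (graph_mean_curvature f) = l"
      by (rule tendsto_Lim[OF v.at_frontier_neq_bot[OF p]])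
    then show ?thesis using l p by (auto simp: mean_curvature_upto_boundary_def)
  qed
  have inE: "\<forall>\<^sub>F x in at p within ?E. x \<in> ?E" for p by (simp add: eventually_at_filter)
  have split: "x \<in> ?E \<or> x \<in> frontier \<Omega>" if "x \<in> - \<Omega>" for x using that Compl_open_eq[OF op] by blast
  have int: "mean_curvature_upto_boundary \<Omega> f x = graph_mean_curvature f x" if "x \<in> ?E" for x
    using that by (auto simp: mean_curvature_upto_boundary_def frontier_def)
  from s.mean_curvature_one_sign show ?thesis
  proof
    assume H: "\<forall>x\<in>?E. graph_mean_curvature f x \<ge> 0"
    have "mean_curvature_upto_boundary \<Omega> f p \<ge> 0" if p: "p \<in> frontier \<Omega>" for p
    proof -
      obtain l where l: "(graph_mean_curvature f \<longlongrightarrow> l) (at p within ?E)" "mean_curvature_upto_boundary \<Omega> f p = l"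
        using bdry[OF p] by blast
      have "0 \<le> l" by (rule tendsto_lowerbound[OF l(1) _ v.at_frontier_neq_bot[OF p]])
        (use H in \<open>auto intro: eventually_mono[OF inE]\<close>)
      then show ?thesis using l(2) by simp
    qed
    then show ?thesis using H int split by metis
  next
    assume H: "\<forall>x\<in>?E. graph_mean_curvature f x \<le> 0"
    have "mean_curvature_upto_boundary \<Omega> f p \<le> 0" if p: "p \<in> frontier \<Omega>" for p
    proof -
      obtain l where l: "(graph_mean_curvature f \<longlongrightarrow> l) (at p within ?E)" "mean_curvature_upto_boundary \<Omega> f p = l"
        using bdry[OF p] by blast
      have "l \<le> 0" by (rule tendsto_upperbound[OF l(1) _ v.at_frontier_neq_bot[OF p]])
        (use H in \<open>auto intro: eventually_mono[OF inE]\<close>)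
      then show ?thesis using l(2) by simp
    qed
    then show ?thesis using H int split by metis
  qed
qed

end
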